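(* Let $K$ be a field of characteristic different from $2$ with algebraic closure $\overline{K}$, let $f(z)=z^2-1$, and let $x_0\in K$ with $x_0\neq0,-1$. For $n\ge0$ let $K_n:=K(f^{-n}(x_0))$, $K_\infty:=\bigcup_nK_n$, $G_n:=\mathrm{Gal}(K_n/K)$, $G_\infty:=\mathrm{Gal}(K_\infty/K)$. Fix primitive $2$-power roots of unity $\zeta_{2^m}\in\overline{K}$ with $(\zeta_{2^m})^2=\zeta_{2^{m-1}}$ for $m\ge1$, and fix a labeling $w\mapsto[w]$ of the preimage tree of $x_0$ such that for every word $y$ over $\{a,b\}$ and every $i\ge0$, \[ \Bigg(\prod_{s_1,\ldots,s_i\in\{a,b\}}[y\,a\,s_1\,a\,s_2\cdots a\,s_i\,a]\Bigg)\Bigg(\prod_{s_1,\ldots,s_i\in\{a,b\}}[y\,b\,s_1\,a\,s_2\cdots a\,s_i\,a]\Bigg)^{-1}=\zeta_{2^{i+1}}. \] Then the following are equivalent: (1) $[K(\sqrt{-x_0},\sqrt{1+x_0},\zeta_8):K]=16$; (2) $[K_5:K]=2^{25}$; (3) $G_5\cong M_5$; (4) $G_n\cong M_n$ for all $n\ge1$; (5) $G_\infty\cong M_\infty$. Here the isomorphisms in (3)–(5) are isomorphisms of groups acting on trees, i.e., group isomorphisms that are equivariant with respect to some tree isomorphism between the preimage tree (of $f^{-m}(x_0)$, $m\le n$, resp. all $m$) and $T_n$ (resp. $T_\infty$).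
   Context: $f^n$ is the $n$-th iterate and $f^{-n}(x_0)$ the set of roots of $f^n(z)=x_0$ in $\overline{K}$. A labeling of the preimage tree is a bijection $w\mapsto[w]$ from finite words over $\{a,b\}$ onto $\coprod_{n\ge0}f^{-n}(x_0)$ with empty word $\mapsto x_0$, words of length $n$ mapping into $f^{-n}(x_0)$, and $\{[wa],[wb]\}=f^{-1}([w])$; Galois elements act on words via $\sigma([w])=[\sigma(w)]$. The word $y\,a\,s_1\cdots a\,s_i\,a$ is a concatenation. $T_\infty$ is the infinite binary rooted tree whose nodes at level $m\ge0$ are words of length $m$ over $\{a,b\}$ (root $x_0$ = empty word), each $w$ joined to $wa,wb$; $T_n$ the subtree of words of length $\le n$; $\mathrm{Aut}(T_\infty),\mathrm{Aut}(T_n)$ the root-preserving automorphism groups. $\mathrm{Par}(\sigma,x)=0$ if $\sigma(xa)=\sigma(x)a$ and $\sigma(xb)=\sigma(x)b$, and $=1$ if $\sigma(xa)=\sigma(x)b$ and $\sigma(xb)=\sigma(x)a$. For $\sigma\in\mathrm{Aut}(T_\infty)$: $Q(\sigma,x):=\sum_{i\ge0}2^i\sum_{s_1,\ldots,s_i\in\{a,b\}}\mathrm{Par}(\sigma,x\,a\,s_1\,a\,s_2\cdots a\,s_i)\in\mathbb{Z}_2$, $P(\sigma,x):=(-1)^{\mathrm{Par}(\sigma,x)}+2\sum_{t\in\{a,b\}}Q(\sigma,xbt)-2\sum_{t\in\{a,b\}}Q(\sigma,xat)\in\mathbb{Z}_2^\times$. For $\tau\in\mathrm{Aut}(T_n)$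 and $x$ of length $m\le n$, $P(\tau,x):=P(\tilde\tau,x)\bmod 2^{\lfloor(n-m+1)/2\rfloor}$ for any extension $\tilde\tau$ of $\tau$ to $T_\infty$. $M_\infty:=\{\sigma\in\mathrm{Aut}(T_\infty):P(\sigma,x)=P(\sigma,x_0)\ \forall x\}$; $M_n:=\{\sigma\in\mathrm{Aut}(T_n):$ for all $m\ge0$ and words $x$ of length $m$, $P(\sigma,x)\equiv P(\sigma,x_0)\pmod{2^{\lfloor(n-m+1)/2\rfloor}}\}$. *)

theory Defs
  imports Complex_Main "HOL-Algebra.Bij" "HOL-Algebra.Generated_Fields"
    "HOL-Algebra.Embedded_Algebras" "HOL-Algebra.Algebraic_Closure_Type"
begin

section \<open>The ring of 2-adic integers\<close>

text \<open>
  An element of the inverse limit of the rings \<open>\<int>/2\<^sup>k\<int>\<close> is the sequence of its residues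
  modulo \<open>2\<^sup>k\<close>, each represented in \<open>{0..<2\<^sup>k}\<close>; the range condition is implied by the
  compatibility condition below.
\<close>
typedef zint2 = "{x :: nat \<Rightarrow> int. \<forall>k. x (Suc k) mod 2 ^ k = x k}"
  morphisms residue2 Abs_zint2
  by (rule exI[of _ "\<lambda>_. 0"]) simp

setup_lifting type_definition_zint2

lemma mod_pow2_Suc: "(a mod 2 ^ Suc k) mod 2 ^ k = a mod (2 ^ k :: int)"
  by (simp add: mod_mod_cancel)

instantiation zint2 :: comm_ring_1
begin

lift_definition zero_zint2 :: zint2 is "\<lambda>_. 0" by simp

lift_definition one_zint2 :: zint2 is "\<lambda>k. 1 mod 2 ^ k"
  by (simp only: mod_pow2_Suc)

lift_definition plus_zint2 :: "zint2 \<Rightarrow> zint2 \<Rightarrow> zint2" is "\<lambda>x y k. (x k + y k) mod 2 ^ k"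
  by (simp only: mod_pow2_Suc) (metis mod_add_eq)

lift_definition minus_zint2 :: "zint2 \<Rightarrow> zint2 \<Rightarrow> zint2" is "\<lambda>x y k. (x k - y k) mod 2 ^ k"
  by (simp only: mod_pow2_Suc) (metis mod_diff_eq)

lift_definition uminus_zint2 :: "zint2 \<Rightarrow> zint2" is "\<lambda>x k. (- x k) mod 2 ^ k"
  by (simp only: mod_pow2_Suc) (metis mod_minus_eq)

lift_definition times_zint2 :: "zint2 \<Rightarrow> zint2 \<Rightarrow> zint2" is "\<lambda>x y k. (x k * y k) mod 2 ^ k"
  by (simp only: mod_pow2_Suc) (metis mod_mult_eq)

instance
proof
  have red: "x k mod 2 ^ k = x k" if "\<forall>k. x (Suc k) mod 2 ^ k = x k" for x :: "nat \<Rightarrow> int" and k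
    by (metis mod_mod_trivial that)
  fix x y z :: zint2
  show "x * y * z = x * (y * z)"
    by transfer (auto simp: mod_simps mult.assoc)
  show "x * y = y * x"
    by transfer (simp add: mult.commute)
  show "1 * x = x"
    by transfer (rule ext, metis mod_mult_left_eq mult_1 red)
  show "x + y + z = x + (y + z)"
    by transfer (auto simp: mod_simps add.assoc)
  show "x + y = y + x"
    by transfer (simp add: add.commute)
  show "0 + x = x"
    by transfer (auto simp: red)
  show "- x + x = 0"
    by transfer (auto simp: mod_simps)
  show "x - y = x + - y"
    by transfer (auto simp: mod_simps)
  show "(x + y) * z = x * z + y * z"
    by transfer (auto simp: mod_simps distrib_right)
  show "(0 :: zint2) \<noteq> 1"
  proof (transfer, rule notI)
    assume "(\<lambda>_. 0) = (\<lambda>k. 1 mod (2 :: int) ^ k)"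
    from fun_cong[OF this, of 1] show False by simp
  qed
qed

end

lemma residue2_mod: "j \<le> k \<Longrightarrow> residue2 x k mod 2 ^ j = residue2 x j"
proof (induction k rule: dec_induct)
  case base
  show ?case using residue2[of x] by (metis (mono_tags, lifting) mem_Collect_eq mod_mod_trivial)
next
  case (step k)
  have "residue2 x (Suc k) mod 2 ^ j = (residue2 x (Suc k) mod 2 ^ k) mod 2 ^ j"
    using step.hyps by (simp add: mod_mod_cancel le_imp_power_dvd)
  also have "residue2 x (Suc k) mod 2 ^ k = residue2 x k"
    using residue2[of x] by blast
  finally show ?case using step.IH by simp
qed

text \<open>The 2-adic topology: the residue classes modulo \<open>2\<^sup>k\<close> are a neighbourhood base.\<close>
instantiation zint2 :: t2_space
begin

definition open_zint2 :: "zint2 set \<Rightarrow> bool" where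
  "open_zint2 U \<longleftrightarrow> (\<forall>x\<in>U. \<exists>k. \<forall>y. residue2 y k = residue2 x k \<longrightarrow> y \<in> U)"

instance
proof
  show "open (UNIV :: zint2 set)" by (simp add: open_zint2_def)
next
  fix S T :: "zint2 set" assume "open S" "open T"
  show "open (S \<inter> T)"
    unfolding open_zint2_def
  proof
    fix x assume "x \<in> S \<inter> T"
    then obtain j k where j: "\<And>y. residue2 y j = residue2 x j \<Longrightarrow> y \<in> S"
      and k: "\<And>y. residue2 y k = residue2 x k \<Longrightarrow> y \<in> T"
      using \<open>open S\<close> \<open>open T\<close> unfolding open_zint2_def by blast
    have "y \<in> S \<inter> T" if "residue2 y (max j k) = residue2 x (max j k)" for y
      using that j k by (metis IntI max.cobounded1 max.cobounded2 residue2_mod)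
    then show "\<exists>k. \<forall>y. residue2 y k = residue2 x k \<longrightarrow> y \<in> S \<inter> T" by blast
  qed
next
  fix \<U> :: "zint2 set set" assume "\<forall>S\<in>\<U>. open S"
  then show "open (\<Union>\<U>)" unfolding open_zint2_def by (meson Union_iff)
next
  fix x y :: zint2 assume "x \<noteq> y"
  then obtain k where k: "residue2 x k \<noteq> residue2 y k"
    by (metis ext residue2_inject)
  have "open {z. residue2 z k = c}" for c
    unfolding open_zint2_def by (auto intro: exI[of _ k])
  then show "\<exists>U V. open U \<and> open V \<and> x \<in> U \<and> y \<in> V \<and> U \<inter> V = {}"
    using k by (intro exI[of _ "{z. residue2 z k = residue2 x k}"]
      exI[of _ "{z. residue2 z k = residue2 y k}"]) auto
qed

end

text \<open>In particular, the series defining \<open>Q_value\<close> below converge.\<close>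
lemma summable_zint2: "summable (\<lambda>i. 2 ^ i * a i :: zint2)"
proof -
  have res_add: "residue2 (x + y) k = (residue2 x k + residue2 y k) mod 2 ^ k"
    and res_mult: "residue2 (x * y) k = (residue2 x k * residue2 y k) mod 2 ^ k" for x y k
    by (simp_all add: plus_zint2.rep_eq times_zint2.rep_eq)
  have res_pow: "residue2 (2 ^ i) k = 2 ^ i mod 2 ^ k" for i k
  proof (induction i)
    case 0
    show ?case by (simp add: one_zint2.rep_eq)
  next
    case (Suc i)
    have "residue2 (1 + 1) k = 2 mod 2 ^ k"
      by (metis res_add one_zint2.rep_eq mod_add_eq one_add_one)
    then have "residue2 2 k = 2 mod 2 ^ k" by (simp only: one_add_one)
    then show ?case by (simp only: power_Suc res_mult Suc mod_mult_eq)
  qed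
  have tail: "residue2 (2 ^ i * a i) k = 0" if "k \<le> i" for i k
    using that by (simp add: res_mult res_pow le_imp_power_dvd)
  let ?S = "\<lambda>n. \<Sum>i<n. 2 ^ i * a i"
  have stab: "residue2 (?S n) k = residue2 (?S k) k" if "k \<le> n" for n k
    using that
  proof (induction n rule: dec_induct)
    case (step n)
    then show ?case
      using residue2_mod[of k k "?S k"] by (simp add: res_add tail)
  qed simp
  define L where "L = Abs_zint2 (\<lambda>k. residue2 (?S k) k)"
  have "residue2 (?S (Suc k)) (Suc k) mod 2 ^ k = residue2 (?S k) k" for k
    using residue2_mod[of k "Suc k" "?S (Suc k)"] stab[of k "Suc k"] by simp
  then have L: "residue2 L k = residue2 (?S k) k" for k
    unfolding L_def by (subst Abs_zint2_inverse) auto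
  have "?S \<longlonglongrightarrow> L"
  proof (rule topological_tendstoI)
    fix U assume "open U" "L \<in> U"
    then obtain k where k: "\<And>y. residue2 y k = residue2 L k \<Longrightarrow> y \<in> U"
      unfolding open_zint2_def by blast
    show "\<forall>\<^sub>F n in sequentially. ?S n \<in> U"
      using eventually_ge_at_top[of k] by eventually_elim (metis k L stab)
  qed
  then show ?thesis unfolding summable_def sums_def by blast
qed


section \<open>Rooted trees and equivariant isomorphisms\<close>

text \<open>The adjacency relation only matters on the set of nodes.\<close>
record 'v rooted_tree =
  nodes :: "'v set"
  root :: 'v
  adjacent :: "'v \<Rightarrow> 'v \<Rightarrow> bool"

definition tree_iso :: "'v rooted_tree \<Rightarrow> 'w rooted_tree \<Rightarrow> ('v \<Rightarrow> 'w) \<Rightarrow> bool" where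
  "tree_iso T T' \<psi> \<longleftrightarrow>
     bij_betw \<psi> (nodes T) (nodes T') \<and> \<psi> (root T) = root T' \<and>
     (\<forall>u\<in>nodes T. \<forall>v\<in>nodes T. adjacent T u v \<longleftrightarrow> adjacent T' (\<psi> u) (\<psi> v))"

definition tree_aut :: "'v rooted_tree \<Rightarrow> ('v \<Rightarrow> 'v) set" where
  "tree_aut T = {\<sigma> \<in> Bij (nodes T). tree_iso T T \<sigma>}"

text \<open>
  \<open>\<alpha>\<close> and \<open>\<beta>\<close> are the actions of the groups \<open>G\<close> and \<open>H\<close> on the nodes of \<open>T\<close> and \<open>T'\<close>.
\<close>
definition iso_acting_on_trees ::
    "('g, 'm) monoid_scheme \<Rightarrow> ('g \<Rightarrow> 'v \<Rightarrow> 'v) \<Rightarrow> 'v rooted_tree \<Rightarrow>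
     ('h, 'n) monoid_scheme \<Rightarrow> ('h \<Rightarrow> 'w \<Rightarrow> 'w) \<Rightarrow> 'w rooted_tree \<Rightarrow> bool" where
  "iso_acting_on_trees G \<alpha> T H \<beta> T' \<longleftrightarrow>
     (\<exists>\<phi>\<in>iso G H. \<exists>\<psi>. tree_iso T T' \<psi> \<and>
        (\<forall>g\<in>carrier G. \<forall>v\<in>nodes T. \<psi> (\<alpha> g v) = \<beta> (\<phi> g) (\<psi> v)))"


section \<open>The binary tree of words and the groups $M_n$, $M_\infty$\<close>

text \<open>\<open>LA\<close> and \<open>LB\<close> are the letters \<open>a\<close> and \<open>b\<close>; appending a letter goes one level up.\<close>
datatype letter = LA | LB

type_synonym word = "letter list"

definition word_tree :: "word rooted_tree" where
  "word_tree = \<lparr>nodes = UNIV, root = [],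
     adjacent = (\<lambda>u v. \<exists>c. v = u @ [c] \<or> u = v @ [c])\<rparr>"

definition word_tree_upto :: "nat \<Rightarrow> word rooted_tree" where
  "word_tree_upto n = word_tree\<lparr>nodes := {w. length w \<le> n}\<rparr>"

definition Par :: "(word \<Rightarrow> word) \<Rightarrow> word \<Rightarrow> nat" where
  "Par \<sigma> x = (if \<sigma> (x @ [LA]) = \<sigma> x @ [LA] \<and> \<sigma> (x @ [LB]) = \<sigma> x @ [LB] then 0 else 1)"

text \<open>The inner sum ranges over the words \<open>x a s\<^sub>1 a s\<^sub>2 \<dots> a s\<^sub>i\<close>.\<close>
definition Q_value :: "(word \<Rightarrow> word) \<Rightarrow> word \<Rightarrow> zint2" where
  "Q_value \<sigma> x = (\<Sum>i. 2 ^ i *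
     (\<Sum>s\<in>{s. length s = i}. of_nat (Par \<sigma> (x @ concat (map (\<lambda>t. [LA, t]) s)))))"

definition P_value :: "(word \<Rightarrow> word) \<Rightarrow> word \<Rightarrow> zint2" where
  "P_value \<sigma> x = (-1) ^ Par \<sigma> x + 2 * (\<Sum>t\<in>{LA, LB}. Q_value \<sigma> (x @ [LB, t]))
                            - 2 * (\<Sum>t\<in>{LA, LB}. Q_value \<sigma> (x @ [LA, t]))"

definition extends_to :: "nat \<Rightarrow> (word \<Rightarrow> word) \<Rightarrow> (word \<Rightarrow> word) \<Rightarrow> bool" where
  "extends_to n \<tau> \<sigma> \<longleftrightarrow> \<sigma> \<in> tree_aut word_tree \<and> (\<forall>w. length w \<le> n \<longrightarrow> \<sigma> w = \<tau> w)"

text \<open>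
  For \<open>\<tau>\<close> in the automorphism group of the tree of words of length at most \<open>n\<close>: the residue of
  \<open>P_value\<close> of an arbitrary extension, represented by an integer in \<open>{0..<2\<^sup>k}\<close> where
  \<open>k = \<lfloor>(n - m + 1) / 2\<rfloor>\<close> and \<open>m\<close> is the length of \<open>x\<close>.
\<close>
definition P_value_upto :: "nat \<Rightarrow> (word \<Rightarrow> word) \<Rightarrow> word \<Rightarrow> int" where
  "P_value_upto n \<tau> x = residue2 (P_value (SOME \<sigma>. extends_to n \<tau> \<sigma>) x) ((n - length x + 1) div 2)"

definition M_group :: "nat \<Rightarrow> (word \<Rightarrow> word) monoid" where
  "M_group n = BijGroup (nodes (word_tree_upto n))
     \<lparr>carrier := {\<sigma> \<in> tree_aut (word_tree_upto n).
        \<forall>x. length x \<le> n \<longrightarrow>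
          P_value_upto n \<sigma> x mod 2 ^ ((n - length x + 1) div 2)
            = P_value_upto n \<sigma> [] mod 2 ^ ((n - length x + 1) div 2)}\<rparr>"

definition M_group_infinity :: "(word \<Rightarrow> word) monoid" where
  "M_group_infinity = BijGroup (nodes word_tree)
     \<lparr>carrier := {\<sigma> \<in> tree_aut word_tree. \<forall>x. P_value \<sigma> x = P_value \<sigma> []}\<rparr>"


section \<open>Fields\<close>

definition primitive_root_of_unity :: "nat \<Rightarrow> 'a :: field \<Rightarrow> bool" where
  "primitive_root_of_unity n z \<longleftrightarrow> n > 0 \<and> z ^ n = 1 \<and> (\<forall>k. 0 < k \<and> k < n \<longrightarrow> z ^ k \<noteq> 1)"

definition adjoin :: "'a :: field set \<Rightarrow> 'a set \<Rightarrow> 'a set" where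
  "adjoin F S = generate_field ring_of_type_algebra (F \<union> S)"

definition has_degree :: "'a :: field set \<Rightarrow> 'a set \<Rightarrow> nat \<Rightarrow> bool" where
  "has_degree E F d \<longleftrightarrow> ring.dimension ring_of_type_algebra d F E"

text \<open>Automorphisms of \<open>E\<close> over \<open>F\<close>, as extensional functions on \<open>E\<close>.\<close>
definition Gal :: "'a :: field set \<Rightarrow> 'a set \<Rightarrow> ('a \<Rightarrow> 'a) monoid" where
  "Gal E F = BijGroup E
     \<lparr>carrier := {\<sigma> \<in> Bij E.
        (\<forall>x\<in>E. \<forall>y\<in>E. \<sigma> (x + y) = \<sigma> x + \<sigma> y \<and> \<sigma> (x * y) = \<sigma> x * \<sigma> y) \<and>
        (\<forall>x\<in>F. \<sigma> x = x)}\<rparr>"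


section \<open>Iterated preimages\<close>

definition basilica :: "'a :: field \<Rightarrow> 'a" where
  "basilica z = z ^ 2 - 1"

definition iter_preimage :: "('a \<Rightarrow> 'a) \<Rightarrow> 'a \<Rightarrow> nat \<Rightarrow> 'a set" where
  "iter_preimage f x n = {z. (f ^^ n) z = x}"

text \<open>
  The nodes form the disjoint union of the sets of \<open>n\<close>-th preimages, so they carry their level.
\<close>
definition preimage_tree :: "('a \<Rightarrow> 'a) \<Rightarrow> 'a \<Rightarrow> (nat \<times> 'a) rooted_tree" where
  "preimage_tree f x = \<lparr>nodes = (SIGMA n : UNIV. iter_preimage f x n), root = (0, x),
     adjacent = (\<lambda>(m, y) (n, z). (n = Suc m \<and> f z = y) \<or> (m = Suc n \<and> f y = z))\<rparr>"

definition preimage_tree_upto :: "('a \<Rightarrow> 'a) \<Rightarrow> 'a \<Rightarrow> nat \<Rightarrow> (nat \<times> 'a) rooted_tree" where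
  "preimage_tree_upto f x n =
     (preimage_tree f x)\<lparr>nodes := (SIGMA m : {..n}. iter_preimage f x m)\<rparr>"

definition galois_action :: "('a \<Rightarrow> 'a) \<Rightarrow> nat \<times> 'a \<Rightarrow> nat \<times> 'a" where
  "galois_action \<sigma> = (\<lambda>(n, z). (n, \<sigma> z))"

definition arboreal_field :: "'a :: field set \<Rightarrow> ('a \<Rightarrow> 'a) \<Rightarrow> 'a \<Rightarrow> nat \<Rightarrow> 'a set" where
  "arboreal_field F f x n = adjoin F (iter_preimage f x n)"

definition arboreal_field_infinity :: "'a :: field set \<Rightarrow> ('a \<Rightarrow> 'a) \<Rightarrow> 'a \<Rightarrow> 'a set" where
  "arboreal_field_infinity F f x = (\<Union>n. arboreal_field F f x n)"

text \<open>
  \<open>lab w\<close> is the field element underlying \<open>[w]\<close>; as a node of the tree, \<open>[w]\<close> is the pair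
  \<open>(length w, lab w)\<close>.
\<close>
definition tree_labeling :: "('a \<Rightarrow> 'a) \<Rightarrow> 'a \<Rightarrow> (word \<Rightarrow> 'a) \<Rightarrow> bool" where
  "tree_labeling f x lab \<longleftrightarrow>
     bij_betw (\<lambda>w. (length w, lab w)) UNIV (nodes (preimage_tree f x)) \<and> lab [] = x \<and>
     (\<forall>w. {lab (w @ [LA]), lab (w @ [LB])} = {z. f z = lab w})"

text \<open>The product of the \<open>[y c s\<^sub>1 a s\<^sub>2 \<dots> a s\<^sub>i a]\<close>; for \<open>i = 0\<close> this is just \<open>[y c]\<close>.\<close>
definition label_prod :: "(word \<Rightarrow> 'a :: field) \<Rightarrow> word \<Rightarrow> letter \<Rightarrow> nat \<Rightarrow> 'a" where
  "label_prod lab y c i =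
     (\<Prod>s\<in>{s. length s = i}. lab (y @ [c] @ concat (map (\<lambda>t. [t, LA]) s)))"

end

theory Submission
  imports Defs "HOL-Number_Theory.Cong" "HOL-Algebra.Group_Action"
begin

text \<open>
  Encode an automorphism of the binary tree of height \<open>n\<close> by its portrait, a perfect binary tree
  of flip bits. Put \<open>Q\<close> and \<open>R\<close> for the sums \<open>Q(\<sigma>, x)\<close> and \<open>Q(\<sigma>, xa) + Q(\<sigma>, xb)\<close> at the root. With
  sections \<open>g\<close>, \<open>h\<close> and root flip \<open>e\<close> one has \<open>Q = e + 2 R(g)\<close>, \<open>R = Q(g) + Q(h)\<close> and
  \<open>P = 1 - 2e + 2 R(h) - 2 R(g)\<close>. On \<open>M\<^sub>n\<close>, \<open>P\<close> is multiplicative and \<open>Q\<close>, \<open>R\<close> are cocycles for it, and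
  the recursion shows that all fibres of \<open>(P, Q, R)\<close> have the same cardinality, a power of 2; this
  gives \<open>|M\<^sub>5| = 2\<^sup>2\<^sup>5\<close> and the surjectivity of \<open>M\<^sub>\<infinity> \<rightarrow> M\<^sub>n\<close>.

  The self-similarity also shows, by induction on \<open>n\<close>, that the fibre \<open>P = 1\<close>, \<open>Q = R = 0\<close> consists
  of products of commutators. Hence the Frattini quotient of the 2-group \<open>M\<^sub>n\<close>, \<open>n \<ge> 5\<close>, is given by
  \<open>P\<close> mod 8, \<open>Q\<close> mod 2 and \<open>R\<close> mod 2, and a subgroup that surjects onto these 16 classes is all of
  \<open>M\<^sub>n\<close>. The labeling makes \<open>\<sigma>(\<zeta>) = \<zeta>\<^sup>P\<close> at every node, so \<open>G\<^sub>n\<close> embeds into \<open>M\<^sub>n\<close>. As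
  \<open>\<surd>(1 + x\<^sub>0) = \<plusminus>[a]\<close> and \<open>\<surd>(-x\<^sub>0) = \<plusminus>[aa][ba]\<close> carry the signs \<open>(-1)\<^sup>Q\<close> and \<open>(-1)\<^sup>R\<close>,
  the field of degree 16 detects exactly the 16 classes.
\<close>


section \<open>Portraits of tree automorphisms and the invariants $P$, $Q$, $R$\<close>

text \<open>The residues modulo 8, 2 and 2 are what squares cannot see: an odd number is a square
  modulo \<open>2 ^ k\<close>, \<open>k \<ge> 3\<close>, exactly if it is 1 modulo 8, and on
  \<open>P = 1\<close> squaring doubles \<open>Q\<close> and \<open>R\<close>. Height 5 is the least
  at which all of this is visible: \<open>P\<close> is known modulo 8 only from there on, and zeta_8
  is a quotient of products of labels of words of length 5.

  The obstacle throughout is finite precision: on a truncated tree the identities hold modulo a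
  power of 2 that gains one bit every two levels. Fibres are therefore indexed by integers
  \<open>p\<close>, \<open>q\<close>, \<open>r\<close>, with the modulus left to \<open>n\<close>,
  so that one triple names a fibre at every height.

  The commutator argument has to stay inside \<open>P = 1\<close>. The pair (1, u) has
  \<open>P = 1 + 2 R(u)\<close>, which forces \<open>R(u) = 0\<close> on one factor of each
  commutator; this restriction reproduces itself between consecutive levels with the factors
  interchanged. On the field side no Galois correspondence is invoked: degrees of towers of square
  roots are counted as numbers of embeddings.\<close>

datatype btree = Leaf | Node bool btree btree

primrec perfect :: "nat \<Rightarrow> btree set" where
  "perfect 0 = {Leaf}"
| "perfect (Suc n) = {Node e g h |e g h. g \<in> perfect n \<and> h \<in> perfect n}"

primrec tid :: "nat \<Rightarrow> btree" where
  "tid 0 = Leaf"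
| "tid (Suc n) = Node False (tid n) (tid n)"

text \<open>The right factor acts first: the section of the product at a letter is the section of
  \<open>s\<close> at the image of that letter under \<open>t\<close>, hence the interchange of
  \<open>g\<close> and \<open>h\<close> when \<open>e'\<close> holds.\<close>

fun tcomp :: "btree \<Rightarrow> btree \<Rightarrow> btree" where
  "tcomp (Node e g h) (Node e' g' h') =
     Node (e \<noteq> e') (if e' then tcomp h g' else tcomp g g') (if e' then tcomp g h' else tcomp h h')"
| "tcomp _ _ = Leaf"

primrec tinv :: "btree \<Rightarrow> btree" where
  "tinv Leaf = Leaf"
| "tinv (Node e g h) = Node e (if e then tinv h else tinv g) (if e then tinv g else tinv h)"

text \<open>Partial sums of the 2-adic series. Splitting off the first two letters
  \<open>a s\<close> of each word gives the mutual recursion; two of its steps, hence two levels,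
  cost one factor 2.\<close>

fun Qt :: "btree \<Rightarrow> int" and Rt :: "btree \<Rightarrow> int" where
  "Qt Leaf = 0"
| "Qt (Node e g h) = of_bool e + 2 * Rt g"
| "Rt Leaf = 0"
| "Rt (Node e g h) = Qt g + Qt h"

primrec Pt :: "btree \<Rightarrow> int" where
  "Pt Leaf = 1"
| "Pt (Node e g h) = 1 - 2 * of_bool e + 2 * Rt h - 2 * Rt g"

text \<open>Only a node and its two children are compared; deeper nodes follow by transitivity
  because the moduli shrink with depth. The exponent \<open>Suc n div 2\<close> is the precision of
  \<open>P\<close> on a child of height \<open>n\<close>.\<close>

primrec Mt :: "nat \<Rightarrow> btree set" where
  "Mt 0 = {Leaf}"
| "Mt (Suc n) = {Node e g h |e g h. g \<in> Mt n \<and> h \<in> Mt n \<and>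
     [Pt g = Pt (Node e g h)] (mod 2 ^ (Suc n div 2)) \<and>
     [Pt h = Pt (Node e g h)] (mod 2 ^ (Suc n div 2))}"

lemma Node_in_perfect [simp]: "Node e g h \<in> perfect (Suc n) \<longleftrightarrow> g \<in> perfect n \<and> h \<in> perfect n"
  by auto

lemma Node_in_Mt: "Node e g h \<in> Mt (Suc n) \<longleftrightarrow> g \<in> Mt n \<and> h \<in> Mt n \<and>
     [Pt g = Pt (Node e g h)] (mod 2 ^ (Suc n div 2)) \<and>
     [Pt h = Pt (Node e g h)] (mod 2 ^ (Suc n div 2))"
  by auto

lemma perfect_SucE:
  assumes "t \<in> perfect (Suc n)"
  obtains e g h where "t = Node e g h" "g \<in> perfect n" "h \<in> perfect n"
  using assms by auto

lemma Mt_SucE: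
  assumes "t \<in> Mt (Suc n)"
  obtains e g h where "t = Node e g h" "g \<in> Mt n" "h \<in> Mt n"
    "[Pt g = Pt t] (mod 2 ^ (Suc n div 2))" "[Pt h = Pt t] (mod 2 ^ (Suc n div 2))"
  using assms that by auto

declare perfect.simps(2) [simp del] Mt.simps(2) [simp del]

lemma Mt_perfect: "t \<in> Mt n \<Longrightarrow> t \<in> perfect n"
  by (induction n arbitrary: t) (auto elim!: Mt_SucE)

lemma tid_perfect [simp]: "tid n \<in> perfect n"
  by (induction n) auto

lemma tcomp_perfect: "s \<in> perfect n \<Longrightarrow> t \<in> perfect n \<Longrightarrow> tcomp s t \<in> perfect n"
  by (induction n arbitrary: s t) (auto elim!: perfect_SucE)

lemma tinv_perfect: "t \<in> perfect n \<Longrightarrow> tinv t \<in> perfect n"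
  by (induction n arbitrary: t) (auto elim!: perfect_SucE)

lemma tcomp_assoc:
  "r \<in> perfect n \<Longrightarrow> s \<in> perfect n \<Longrightarrow> t \<in> perfect n \<Longrightarrow> tcomp (tcomp r s) t = tcomp r (tcomp s t)"
  by (induction n arbitrary: r s t) (auto elim!: perfect_SucE)

lemma tcomp_tid_left [simp]: "t \<in> perfect n \<Longrightarrow> tcomp (tid n) t = t"
  by (induction n arbitrary: t) (auto elim!: perfect_SucE)

lemma tcomp_tid_right [simp]: "t \<in> perfect n \<Longrightarrow> tcomp t (tid n) = t"
  by (induction n arbitrary: t) (auto elim!: perfect_SucE)

lemma tcomp_tinv_left: "t \<in> perfect n \<Longrightarrow> tcomp (tinv t) t = tid n"
  by (induction n arbitrary: t) (auto elim!: perfect_SucE)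

lemma tcomp_tinv_right: "t \<in> perfect n \<Longrightarrow> tcomp t (tinv t) = tid n"
  by (induction n arbitrary: t) (auto elim!: perfect_SucE)

lemma QRt_tid [simp]: "Qt (tid n) = 0" "Rt (tid n) = 0"
  by (induction n) auto

lemma Pt_tid [simp]: "Pt (tid n) = 1"
  by (cases n) auto

lemma tid_Mt [simp]: "tid n \<in> Mt n"
  by (induction n) (auto simp: Node_in_Mt)

section \<open>Cocycle identities and the group M_n\<close>

lemma odd_Pt: "odd (Pt t)"
  by (cases t) auto

lemma cong_double_iff: "[2 * x = 2 * y] (mod (2::int) ^ Suc k) \<longleftrightarrow> [x = y] (mod 2 ^ k)"
  by (simp only: cong_def power_Suc mult_mod_right[symmetric]) simp

lemmas cong_double = cong_double_iff[THEN iffD2]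

lemma cong_pow_le: "[x = y] (mod (2::int) ^ k) \<Longrightarrow> j \<le> k \<Longrightarrow> [x = y] (mod 2 ^ j)"
  by (meson cong_dvd_modulus le_imp_power_dvd)

lemma cong_add_mult_left: "[a = b] (mod m) \<Longrightarrow> [x + a * y = x + b * y] (mod (m::int))"
  by (intro cong_add cong_mult cong_refl)

lemma Suc_Suc_div: "Suc (Suc n) div 2 = Suc (n div 2)"
  by simp

text \<open>The three identities need each other: \<open>Q\<close> and \<open>P\<close> of a node
  involve \<open>2 R\<close> of the children, so that \<open>R\<close> modulo
  \<open>2 ^ (n div 2)\<close> yields one more bit, and \<open>R\<close> involves \<open>Q\<close>
  of the children. The twist \<open>Pt s\<close> is common to both children because membership in
  \<open>Mt\<close> makes their \<open>P\<close> agree with that of the root.\<close>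

lemma tcomp_cocycle:
  assumes "s \<in> Mt n" "t \<in> Mt n"
  shows "[Qt (tcomp s t) = Qt s + Pt s * Qt t] (mod 2 ^ (Suc n div 2)) \<and>
         [Rt (tcomp s t) = Rt s + Pt s * Rt t] (mod 2 ^ (n div 2)) \<and>
         [Pt (tcomp s t) = Pt s * Pt t] (mod 2 ^ (Suc n div 2))"
  using assms
proof (induction n arbitrary: s t)
  case 0
  then show ?case by simp
next
  case (Suc n)
  from Suc.prems(1) obtain e g h where s: "s = Node e g h" "g \<in> Mt n" "h \<in> Mt n"
    "[Pt g = Pt s] (mod 2 ^ (Suc n div 2))" "[Pt h = Pt s] (mod 2 ^ (Suc n div 2))"
    by (rule Mt_SucE)
  from Suc.prems(2) obtain e' g' h' where t: "t = Node e' g' h'" "g' \<in> Mt n" "h' \<in> Mt n"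
    "[Pt g' = Pt t] (mod 2 ^ (Suc n div 2))" "[Pt h' = Pt t] (mod 2 ^ (Suc n div 2))"
    by (rule Mt_SucE)
  have Q: "[Qt (tcomp x y) = Qt x + Pt s * Qt y] (mod 2 ^ (Suc n div 2))"
    if "x \<in> {g, h}" "y \<in> {g', h'}" for x y
  proof -
    have "x \<in> Mt n" "y \<in> Mt n" using that s(2,3) t(2,3) by auto
    from Suc.IH[OF this] have "[Qt (tcomp x y) = Qt x + Pt x * Qt y] (mod 2 ^ (Suc n div 2))" ..
    also have "[Qt x + Pt x * Qt y = Qt x + Pt s * Qt y] (mod 2 ^ (Suc n div 2))"
      by (rule cong_add_mult_left) (use that s(4,5) in auto)
    finally show ?thesis .
  qed
  have R: "[2 * Rt (tcomp x y) = 2 * Rt x + Pt s * (2 * Rt y)] (mod 2 ^ (Suc (Suc n) div 2))"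
    if "x \<in> {g, h}" "y \<in> {g', h'}" for x y
  proof -
    have "x \<in> Mt n" "y \<in> Mt n" using that s(2,3) t(2,3) by auto
    from Suc.IH[OF this] have "[Rt (tcomp x y) = Rt x + Pt x * Rt y] (mod 2 ^ (n div 2))" by (elim conjE)
    also have "[Rt x + Pt x * Rt y = Rt x + Pt s * Rt y] (mod 2 ^ (n div 2))"
      by (rule cong_add_mult_left) (use that cong_pow_le[OF s(4), of "n div 2"] cong_pow_le[OF s(5), of "n div 2"] in auto)
    finally have "[2 * Rt (tcomp x y) = 2 * (Rt x + Pt s * Rt y)] (mod 2 ^ (Suc (Suc n) div 2))"
      unfolding Suc_Suc_div by (rule cong_double)
    moreover have "2 * (Rt x + Pt s * Rt y) = 2 * Rt x + Pt s * (2 * Rt y)"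
      by (simp add: algebra_simps)
    ultimately show ?thesis by (simp only:)
  qed
  let ?x = "if e' then h else g" and ?y = "if e' then g else h"
  have eq: "tcomp s t = Node (e \<noteq> e') (tcomp ?x g') (tcomp ?y h')"
    by (simp add: s(1) t(1))
  have Rxg: "[2 * Rt (tcomp ?x g') = 2 * Rt ?x + Pt s * (2 * Rt g')] (mod 2 ^ (Suc (Suc n) div 2))"
    and Ryh: "[2 * Rt (tcomp ?y h') = 2 * Rt ?y + Pt s * (2 * Rt h')] (mod 2 ^ (Suc (Suc n) div 2))"
    by (rule R; simp)+
  have "[Qt (tcomp s t) = of_bool (e \<noteq> e') + (2 * Rt ?x + Pt s * (2 * Rt g'))] (mod 2 ^ (Suc (Suc n) div 2))"
    unfolding eq Qt.simps Rt.simps by (rule cong_add[OF cong_refl Rxg])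
  also have "of_bool (e \<noteq> e') + (2 * Rt ?x + Pt s * (2 * Rt g')) = Qt s + Pt s * Qt t"
    by (auto simp: s(1) t(1) algebra_simps)
  finally have 1: "[Qt (tcomp s t) = Qt s + Pt s * Qt t] (mod 2 ^ (Suc (Suc n) div 2))" .
  have "[Pt (tcomp s t) = 1 - 2 * of_bool (e \<noteq> e') + (2 * Rt ?y + Pt s * (2 * Rt h'))
      - (2 * Rt ?x + Pt s * (2 * Rt g'))] (mod 2 ^ (Suc (Suc n) div 2))"
    unfolding eq Pt.simps by (intro cong_add cong_diff cong_refl Rxg Ryh)
  \<comment> \<open>If \<open>e'\<close> interchanges the sections of \<open>s\<close>, their
    contribution becomes \<open>- Pt s\<close>; at the same time the part coming from
    \<open>t\<close> is \<open>Pt s\<close> times \<open>Pt t + 1\<close> instead of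
    \<open>Pt t - 1\<close>.\<close>
  also have "1 - 2 * of_bool (e \<noteq> e') + (2 * Rt ?y + Pt s * (2 * Rt h'))
      - (2 * Rt ?x + Pt s * (2 * Rt g')) = Pt s * Pt t"
    by (auto simp: s(1) t(1) algebra_simps)
  finally have 2: "[Pt (tcomp s t) = Pt s * Pt t] (mod 2 ^ (Suc (Suc n) div 2))" .
  have "[Rt (tcomp s t) = (Qt ?x + Pt s * Qt g') + (Qt ?y + Pt s * Qt h')] (mod 2 ^ (Suc n div 2))"
    unfolding eq Qt.simps Rt.simps by (intro cong_add Q) auto
  also have "(Qt ?x + Pt s * Qt g') + (Qt ?y + Pt s * Qt h') = Rt s + Pt s * Rt t"
    by (auto simp: s(1) t(1) algebra_simps)
  finally have 3: "[Rt (tcomp s t) = Rt s + Pt s * Rt t] (mod 2 ^ (Suc n div 2))" .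
  show ?case by (intro conjI 1 2 3)
qed

lemmas Qt_tcomp = tcomp_cocycle[THEN conjunct1]
  and Rt_tcomp = tcomp_cocycle[THEN conjunct2, THEN conjunct1]
  and Pt_tcomp = tcomp_cocycle[THEN conjunct2, THEN conjunct2]

lemma tcomp_Mt: "s \<in> Mt n \<Longrightarrow> t \<in> Mt n \<Longrightarrow> tcomp s t \<in> Mt n"
proof (induction n arbitrary: s t)
  case (Suc n)
  note P = Pt_tcomp[OF Suc.prems]
  from Suc.prems(1) obtain e g h where s: "s = Node e g h" "g \<in> Mt n" "h \<in> Mt n"
    "[Pt g = Pt s] (mod 2 ^ (Suc n div 2))" "[Pt h = Pt s] (mod 2 ^ (Suc n div 2))"
    by (rule Mt_SucE)
  from Suc.prems(2) obtain e' g' h' where t: "t = Node e' g' h'" "g' \<in> Mt n" "h' \<in> Mt n"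
    "[Pt g' = Pt t] (mod 2 ^ (Suc n div 2))" "[Pt h' = Pt t] (mod 2 ^ (Suc n div 2))"
    by (rule Mt_SucE)
  have *: "[Pt (tcomp x y) = Pt (tcomp s t)] (mod 2 ^ (Suc n div 2))"
    if "x \<in> {g, h}" "y \<in> {g', h'}" for x y
  proof -
    have "[Pt (tcomp x y) = Pt x * Pt y] (mod 2 ^ (Suc n div 2))"
      using that s(2,3) t(2,3) by (intro Pt_tcomp) blast+
    also have "[Pt x * Pt y = Pt s * Pt t] (mod 2 ^ (Suc n div 2))"
      using that s(4,5) t(4,5) by (intro cong_mult) blast+
    also have "[Pt s * Pt t = Pt (tcomp s t)] (mod 2 ^ (Suc n div 2))"
      by (rule cong_sym[OF cong_pow_le[OF P]]) simp
    finally show ?thesis .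
  qed
  let ?x = "if e' then h else g" and ?y = "if e' then g else h"
  have eq: "tcomp s t = Node (e \<noteq> e') (tcomp ?x g') (tcomp ?y h')"
    by (simp add: s(1) t(1))
  have "tcomp ?x g' \<in> Mt n" "tcomp ?y h' \<in> Mt n"
    by (rule Suc.IH; simp add: s(2,3) t(2,3))+
  moreover have "[Pt (tcomp ?x g') = Pt (tcomp s t)] (mod 2 ^ (Suc n div 2))"
    "[Pt (tcomp ?y h') = Pt (tcomp s t)] (mod 2 ^ (Suc n div 2))"
    by (rule *; simp)+
  ultimately show ?case
    unfolding eq Node_in_Mt by blast
qed simp

lemma finite_perfect: "finite (perfect n)"
proof (induction n)
  case (Suc n)
  have "perfect (Suc n) = (\<lambda>(e, g, h). Node e g h) ` (UNIV \<times> perfect n \<times> perfect n)"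
    by (force elim!: perfect_SucE)
  then show ?case using Suc by simp
qed simp

lemma finite_Mt [simp]: "finite (Mt n)"
  by (meson Mt_perfect finite_perfect finite_subset subsetI)

text \<open>In a finite cancellative monoid left translations are onto.\<close>
lemma tinv_Mt: "t \<in> Mt n \<Longrightarrow> tinv t \<in> Mt n"
proof -
  assume t: "t \<in> Mt n"
  have inv: "tcomp (tinv t) (tcomp t s) = s" if "s \<in> perfect n" for s
    using t that by (metis Mt_perfect tcomp_assoc tcomp_tid_left tcomp_tinv_left tinv_perfect)
  have "inj_on (tcomp t) (Mt n)"
    by (rule inj_on_inverseI[of _ "tcomp (tinv t)"]) (simp add: inv Mt_perfect)
  then have "tcomp t ` Mt n = Mt n"
    using t by (intro card_subset_eq) (auto simp: tcomp_Mt card_image)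
  then obtain s where s: "s \<in> Mt n" "tcomp t s = tid n"
    by (metis imageE tid_Mt)
  then have "tinv t = s"
    using inv[of s] t by (metis Mt_perfect tcomp_tid_right tinv_perfect)
  then show ?thesis using s by simp
qed

definition Mgrp :: "nat \<Rightarrow> btree monoid" where
  "Mgrp n = \<lparr>carrier = Mt n, monoid.mult = tcomp, one = tid n\<rparr>"

lemma Mgrp_simps [simp]:
  "carrier (Mgrp n) = Mt n" "x \<otimes>\<^bsub>Mgrp n\<^esub> y = tcomp x y" "\<one>\<^bsub>Mgrp n\<^esub> = tid n"
  by (simp_all add: Mgrp_def)

lemma group_Mgrp: "group (Mgrp n)"
proof (rule groupI)
  show "\<exists>y\<in>carrier (Mgrp n). y \<otimes>\<^bsub>Mgrp n\<^esub> x = \<one>\<^bsub>Mgrp n\<^esub>" if "x \<in> carrier (Mgrp n)" for x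
    using that by (auto intro!: bexI[of _ "tinv x"] simp: Mt_perfect tinv_Mt tcomp_tinv_left)
qed (auto simp: tcomp_Mt Mt_perfect tcomp_assoc[of _ n])

lemma inv_Mgrp: "t \<in> Mt n \<Longrightarrow> inv\<^bsub>Mgrp n\<^esub> t = tinv t"
  by (rule group.inv_equality[OF group_Mgrp]) (auto simp: Mt_perfect tinv_Mt tcomp_tinv_left)

text \<open>On the first \<open>n\<close> levels, \<open>P\<close> and \<open>Q\<close> are determined modulo \<open>2\<^bsup>\<lceil>n/2\<rceil>\<^esup>\<close>, and \<open>R\<close>
  modulo \<open>2\<^bsup>\<lfloor>n/2\<rfloor>\<^esup>\<close>.\<close>
definition fibre :: "nat \<Rightarrow> int \<Rightarrow> int \<Rightarrow> int \<Rightarrow> btree set" where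
  "fibre n p q r = {t \<in> Mt n. [Pt t = p] (mod 2 ^ (Suc n div 2)) \<and>
     [Qt t = q] (mod 2 ^ (Suc n div 2)) \<and> [Rt t = r] (mod 2 ^ (n div 2))}"

text \<open>The constraints are triangular. The parity of \<open>q\<close> is the flip;
  \<open>Q = e + 2 R(g)\<close> then fixes \<open>R(g)\<close>,
  \<open>P = 1 - 2e + 2 R(h) - 2 R(g)\<close> fixes \<open>R(h)\<close>, and
  \<open>R = Q(g) + Q(h)\<close> ties \<open>Q(h)\<close> to \<open>Q(g)\<close>, the only free
  quantity. No precision is lost: halving removes exactly the bit that the children lack.\<close>

lemma Node_in_fibre:
  assumes p: "odd p" and e: "e = odd q"
  shows "Node e g h \<in> fibre (Suc n) p q r \<longleftrightarrow>
    g \<in> fibre n p (Qt g) ((q - of_bool e) div 2) \<and>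
    h \<in> fibre n p (r - Qt g) ((q - of_bool e) div 2 + (p - 1 + 2 * of_bool e) div 2)"
proof -
  obtain \<rho> where \<rho>: "q = 2 * \<rho> + of_bool e"
    using e by (metis add.right_neutral dvdE odd_two_times_div_two_succ of_bool_eq(1,2))
  obtain u where u: "p = 2 * u + 1"
    using p by (metis oddE)
  let ?N = "Node e g h"
  have P: "[Pt ?N = p] (mod 2 ^ Suc (n div 2)) \<longleftrightarrow> [Rt h - Rt g - of_bool e = u] (mod 2 ^ (n div 2))"
  proof -
    have "Pt ?N = 2 * (Rt h - Rt g - of_bool e) + 1" by simp
    then show ?thesis unfolding u by (simp only: cong_add_rcancel cong_double_iff)
  qed
  have Q: "[Qt ?N = q] (mod 2 ^ Suc (n div 2)) \<longleftrightarrow> [Rt g = \<rho>] (mod 2 ^ (n div 2))"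
    by (simp only: \<rho> Qt.simps add.commute[of "2 * \<rho>"] cong_add_lcancel cong_double_iff)
  have R: "[Rt ?N = r] (mod 2 ^ (Suc n div 2)) \<longleftrightarrow> [Qt h = r - Qt g] (mod 2 ^ (Suc n div 2))"
    by (metis Rt.simps(2) add.commute add_diff_cancel_right' cong_diff_iff_cong_0 diff_diff_eq2 diff_add_eq)
  have PR: "[Rt h - Rt g - of_bool e = u] (mod 2 ^ (n div 2)) \<longleftrightarrow>
      [Rt h = \<rho> + (u + of_bool e)] (mod 2 ^ (n div 2))" if g: "[Rt g = \<rho>] (mod 2 ^ (n div 2))"
  proof
    assume "[Rt h - Rt g - of_bool e = u] (mod 2 ^ (n div 2))"
    from cong_add[OF cong_add[OF this g] cong_refl[of "of_bool e"]]
    show "[Rt h = \<rho> + (u + of_bool e)] (mod 2 ^ (n div 2))" by (simp add: algebra_simps)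
  next
    assume "[Rt h = \<rho> + (u + of_bool e)] (mod 2 ^ (n div 2))"
    from cong_diff[OF cong_diff[OF this g] cong_refl[of "of_bool e"]]
    show "[Rt h - Rt g - of_bool e = u] (mod 2 ^ (n div 2))" by (simp add: algebra_simps)
  qed
  \<comment> \<open>\<open>Mt\<close> compares the children with \<open>Pt ?N\<close>, a fibre
    compares them with \<open>p\<close>. The two agree once \<open>Pt ?N\<close> is congruent to
    \<open>p\<close>, since the modulus for the children is never the finer one.\<close>
  have MP: "?N \<in> Mt (Suc n) \<longleftrightarrow> g \<in> Mt n \<and> h \<in> Mt n \<and> [Pt g = p] (mod 2 ^ (Suc n div 2)) \<and>
      [Pt h = p] (mod 2 ^ (Suc n div 2))" if "[Pt ?N = p] (mod 2 ^ Suc (n div 2))"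
  proof -
    have "[Pt ?N = p] (mod 2 ^ (Suc n div 2))"
      using that by (rule cong_pow_le) auto
    then show ?thesis unfolding Node_in_Mt by (meson cong_sym cong_trans)
  qed
  have \<rho>': "(q - of_bool e) div 2 = \<rho>" using \<rho> by simp
  have u': "(p - 1 + 2 * of_bool e) div 2 = u + of_bool e" using u by simp
  show ?thesis
    unfolding fibre_def mem_Collect_eq Suc_Suc_div P Q R \<rho>' u'
    using PR MP P by auto
qed

lemma Node_in_fibre_odd: "Node e g h \<in> fibre (Suc n) p q r \<Longrightarrow> e = odd q"
proof -
  assume "Node e g h \<in> fibre (Suc n) p q r"
  then have "[Qt (Node e g h) = q] (mod 2 ^ Suc (n div 2))" by (simp add: fibre_def)
  then have "[Qt (Node e g h) = q] (mod 2)"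
    by (rule cong_dvd_modulus) simp
  then show ?thesis by (auto simp: cong_def mod_2_eq_odd split: if_splits)
qed

section \<open>Sizes of the fibres and of M_n\<close>

lemma fibre_subset: "fibre n p q r \<subseteq> Mt n"
  by (auto simp: fibre_def)

lemma finite_fibre [simp]: "finite (fibre n p q r)"
  by (rule finite_subset[OF fibre_subset finite_Mt])

lemma fibre_cong: "g \<in> fibre n p q r \<Longrightarrow> [q = q'] (mod 2 ^ (Suc n div 2)) \<Longrightarrow> g \<in> fibre n p q' r"
  unfolding fibre_def by (auto intro: cong_trans)

text \<open>Exponent of the size of a fibre: the residue of \<open>Q(g)\<close> takes
  \<open>2 ^ (Suc n div 2)\<close> values, and for each of them both sections range over a full
  fibre one level down.\<close>

fun fib_exp :: "nat \<Rightarrow> nat" where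
  "fib_exp 0 = 0"
| "fib_exp (Suc n) = 2 * fib_exp n + Suc n div 2"

lemma card_fibre: "odd p \<Longrightarrow> card (fibre n p q r) = 2 ^ fib_exp n"
proof (induction n arbitrary: q r)
  case 0
  have "fibre 0 p q r = {Leaf}" by (auto simp: fibre_def)
  then show ?case by simp
next
  case (Suc n)
  define \<rho> where "\<rho> = (q - of_bool (odd q)) div 2"
  define \<rho>' where "\<rho>' = (q - of_bool (odd q)) div 2 + (p - 1 + 2 * of_bool (odd q)) div 2"
  let ?J = "{0..<(2::int) ^ (Suc n div 2)}"
  let ?S = "SIGMA j : ?J. fibre n p j \<rho> \<times> fibre n p (r - j) \<rho>'"
  have cg: "[r - x = r - y] (mod 2 ^ (Suc n div 2))" if "[x = y] (mod 2 ^ (Suc n div 2))" for x y :: int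
    using that by (intro cong_diff cong_refl)
  have iff: "Node (odd q) g h \<in> fibre (Suc n) p q r \<longleftrightarrow>
      g \<in> fibre n p (Qt g) \<rho> \<and> h \<in> fibre n p (r - Qt g) \<rho>'" for g h
    using Node_in_fibre[OF Suc.prems refl, of q g h n r] by (simp add: \<rho>_def \<rho>'_def)
  have "bij_betw (\<lambda>(j, g, h). Node (odd q) g h) ?S (fibre (Suc n) p q r)"
  proof (rule bij_betw_imageI)
    have jk: "j = k" if "j \<in> ?J" "k \<in> ?J" "g \<in> fibre n p j \<rho>" "g \<in> fibre n p k \<rho>" for j g k
    proof -
      have "[Qt g = j] (mod 2 ^ (Suc n div 2))" "[Qt g = k] (mod 2 ^ (Suc n div 2))"
        using that(3,4) by (simp_all add: fibre_def)
      then have "j mod 2 ^ (Suc n div 2) = k mod 2 ^ (Suc n div 2)" by (simp add: cong_def)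
      then show "j = k" using that(1,2) by simp
    qed
    show "inj_on (\<lambda>(j, g, h). Node (odd q) g h) ?S"
    proof (rule inj_onI)
      fix x y assume xy: "x \<in> ?S" "y \<in> ?S"
        "(\<lambda>(j, g, h). Node (odd q) g h) x = (\<lambda>(j, g, h). Node (odd q) g h) y"
      obtain j g h k g' h' where eq: "x = (j, g, h)" "y = (k, g', h')" by (metis prod_cases3)
      show "x = y" using xy jk[of j k g] unfolding eq by simp
    qed
    show "(\<lambda>(j, g, h). Node (odd q) g h) ` ?S = fibre (Suc n) p q r"
    proof (intro equalityI subsetI)
      fix t assume "t \<in> (\<lambda>(j, g, h). Node (odd q) g h) ` ?S"
      then obtain j g h where t: "t = Node (odd q) g h" "g \<in> fibre n p j \<rho>" "h \<in> fibre n p (r - j) \<rho>'"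
        by auto
      then have "[j = Qt g] (mod 2 ^ (Suc n div 2))" by (simp add: fibre_def cong_def)
      from fibre_cong[OF t(2) this] fibre_cong[OF t(3) cg[OF this]] show "t \<in> fibre (Suc n) p q r"
        unfolding t(1) iff by (rule conjI)
    next
      fix t assume t: "t \<in> fibre (Suc n) p q r"
      then obtain e g h where "t = Node e g h" using fibre_subset by (blast elim: Mt_SucE)
      with t Node_in_fibre_odd have eq: "t = Node (odd q) g h" by blast
      let ?j = "Qt g mod 2 ^ (Suc n div 2)"
      have c: "[Qt g = ?j] (mod 2 ^ (Suc n div 2))" by simp
      have "g \<in> fibre n p (Qt g) \<rho>" "h \<in> fibre n p (r - Qt g) \<rho>'" using t eq iff by auto
      from fibre_cong[OF this(1) c] fibre_cong[OF this(2) cg[OF c]]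
      have "g \<in> fibre n p ?j \<rho>" "h \<in> fibre n p (r - ?j) \<rho>'" .
      then show "t \<in> (\<lambda>(j, g, h). Node (odd q) g h) ` ?S"
        unfolding eq by (intro image_eqI[of _ _ "(?j, g, h)"]) auto
    qed
  qed
  then have "card (fibre (Suc n) p q r) = card ?S" by (simp add: bij_betw_same_card)
  also have "\<dots> = (\<Sum>j\<in>?J. card (fibre n p j \<rho> \<times> fibre n p (r - j) \<rho>'))"
    by (rule card_SigmaI) auto
  also have "\<dots> = (\<Sum>j\<in>?J. 2 ^ (2 * fib_exp n))"
    using Suc by (intro sum.cong) (auto simp: card_cartesian_product mult_2 power_add)
  also have "\<dots> = 2 ^ fib_exp (Suc n)" by (simp add: power_add nat_power_eq)
  finally show ?case .
qed

lemma fibre_nonempty: "odd p \<Longrightarrow> \<exists>t. t \<in> fibre n p q r"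
  using card_fibre[of p n q r] by (metis card.empty ex_in_conv power_not_zero zero_neq_numeral)

text \<open>The fibres partition the group. As \<open>P\<close> is odd it is indexed as
  \<open>2 * p + 1\<close>, which leaves one bit fewer for \<open>p\<close> than for
  \<open>q\<close>.\<close>

lemma card_Mt: "card (Mt (Suc n)) = 2 ^ (n div 2 + Suc (n div 2) + Suc n div 2 + fib_exp (Suc n))"
proof -
  let ?A = "{0..<(2::int) ^ (n div 2)} \<times> {0..<(2::int) ^ Suc (n div 2)} \<times> {0..<(2::int) ^ (Suc n div 2)}"
  let ?F = "\<lambda>(p, q, r). fibre (Suc n) (2 * p + 1) q r"
  have eq: "Mt (Suc n) = (\<Union>x\<in>?A. ?F x)"
  proof (intro equalityI subsetI)
    fix t assume t: "t \<in> Mt (Suc n)"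
    define u where "u = Pt t div 2"
    have u: "Pt t = 2 * u + 1" unfolding u_def using odd_Pt[of t] by simp
    have "t \<in> ?F (u mod 2 ^ (n div 2), Qt t mod 2 ^ Suc (n div 2), Rt t mod 2 ^ (Suc n div 2))"
      using t by (auto simp: fibre_def u cong_double_iff simp del: power_Suc intro!: cong_add)
    moreover have "(u mod 2 ^ (n div 2), Qt t mod 2 ^ Suc (n div 2), Rt t mod 2 ^ (Suc n div 2)) \<in> ?A"
      by auto
    ultimately show "t \<in> (\<Union>x\<in>?A. ?F x)" by blast
  qed (auto simp: fibre_def)
  have disj: "?F x \<inter> ?F y = {}" if "x \<in> ?A" "y \<in> ?A" "x \<noteq> y" for x y
  proof (rule ccontr)
    assume "?F x \<inter> ?F y \<noteq> {}"
    then obtain t where t: "t \<in> ?F x" "t \<in> ?F y" by blast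
    obtain p q r p' q' r' where xy: "x = (p, q, r)" "y = (p', q', r')" by (metis prod_cases3)
    from t have "[2 * p + 1 = 2 * p' + 1] (mod 2 ^ Suc (n div 2))" "[q = q'] (mod 2 ^ Suc (n div 2))"
        "[r = r'] (mod 2 ^ (Suc n div 2))"
      unfolding xy fibre_def by (auto simp del: power_Suc dest: cong_sym cong_trans)
    then have "[p = p'] (mod 2 ^ (n div 2))" "[q = q'] (mod 2 ^ Suc (n div 2))"
        "[r = r'] (mod 2 ^ (Suc n div 2))"
      by (simp_all only: cong_add_rcancel cong_double_iff)
    then show False using that unfolding xy cong_def by auto
  qed
  have "card (Mt (Suc n)) = (\<Sum>x\<in>?A. card (?F x))"
    unfolding eq using disj by (intro card_UN_disjoint) auto
  also have "\<dots> = (\<Sum>x\<in>?A. 2 ^ fib_exp (Suc n))"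
    by (intro sum.cong refl) (auto simp: card_fibre simp del: fib_exp.simps)
  also have "\<dots> = card ?A * 2 ^ fib_exp (Suc n)" by simp
  also have "card ?A = 2 ^ (n div 2 + Suc (n div 2) + Suc n div 2)"
    by (simp add: card_cartesian_product power_add nat_power_eq nat_mult_distrib)
  finally show ?thesis by (simp only: power_add)
qed

lemma card_Mt_pow2: "\<exists>k. card (Mt n) = 2 ^ k"
proof (cases n)
  case 0
  then show ?thesis by (intro exI[of _ 0]) simp
next
  case (Suc m)
  then show ?thesis using card_Mt[of m] by blast
qed

text \<open>25 = (2 + 3 + 2) + 18: there are \<open>2 ^ 2\<close> odd residues of \<open>P\<close>
  modulo 8, \<open>2 ^ 3\<close> residues of \<open>Q\<close> modulo 8 and \<open>2 ^ 2\<close> of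
  \<open>R\<close> modulo 4, and 18 is \<open>fib_exp 5\<close>.\<close>

lemma card_Mt_5: "card (Mt 5) = 2 ^ 25"
proof -
  have 5: "5 = Suc (Suc (Suc (Suc (Suc 0))))" by simp
  have "4 div 2 + Suc (4 div 2) + Suc 4 div 2 + fib_exp (Suc 4) = 25"
    by (simp add: 5)
  then show ?thesis using card_Mt[of 4] by (simp del: fib_exp.simps)
qed

section \<open>Lifting automorphisms and commutators\<close>

primrec trunc :: "nat \<Rightarrow> btree \<Rightarrow> btree" where
  "trunc 0 t = Leaf"
| "trunc (Suc n) t = (case t of Leaf \<Rightarrow> Leaf | Node e g h \<Rightarrow> Node e (trunc n g) (trunc n h))"

lemma trunc_self [simp]: "t \<in> perfect n \<Longrightarrow> trunc n t = t"
  by (induction n arbitrary: t) (auto elim!: perfect_SucE)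

lemma trunc_trunc: "n \<le> m \<Longrightarrow> trunc n (trunc m t) = trunc n t"
proof (induction n arbitrary: t m)
  case (Suc n)
  then show ?case by (cases m) (auto split: btree.splits)
qed simp

lemma trunc_cong:
  "t \<in> perfect (Suc n) \<Longrightarrow> [Qt (trunc n t) = Qt t] (mod 2 ^ (Suc n div 2)) \<and>
     [Rt (trunc n t) = Rt t] (mod 2 ^ (n div 2)) \<and> [Pt (trunc n t) = Pt t] (mod 2 ^ (Suc n div 2))"
proof (induction n arbitrary: t)
  case (Suc n)
  from Suc.prems obtain e g h where t: "t = Node e g h" "g \<in> perfect (Suc n)" "h \<in> perfect (Suc n)"
    by (rule perfect_SucE)
  note g = Suc.IH[OF t(2)] and h = Suc.IH[OF t(3)]
  have R2: "[2 * Rt (trunc n x) = 2 * Rt x] (mod 2 ^ (Suc (Suc n) div 2))" if "x \<in> {g, h}" for x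
    unfolding Suc_Suc_div using that g h by (intro cong_double) auto
  have "[Qt (trunc (Suc n) t) = Qt t] (mod 2 ^ (Suc (Suc n) div 2))"
    unfolding t(1) trunc.simps btree.case Qt.simps by (intro cong_add cong_refl R2) simp
  moreover have "[Pt (trunc (Suc n) t) = Pt t] (mod 2 ^ (Suc (Suc n) div 2))"
    unfolding t(1) trunc.simps btree.case Pt.simps by (intro cong_add cong_diff cong_refl R2) auto
  moreover have "[Rt (trunc (Suc n) t) = Rt t] (mod 2 ^ (Suc n div 2))"
    unfolding t(1) trunc.simps btree.case Rt.simps using g h by (intro cong_add) auto
  ultimately show ?case by blast
qed simp

lemma Mt_trunc_Suc: "t \<in> Mt (Suc n) \<Longrightarrow> trunc n t \<in> Mt n"
proof (induction n arbitrary: t)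
  case (Suc n)
  from Suc.prems obtain e g h where t: "t = Node e g h" "g \<in> Mt (Suc n)" "h \<in> Mt (Suc n)"
    "[Pt g = Pt t] (mod 2 ^ (Suc (Suc n) div 2))" "[Pt h = Pt t] (mod 2 ^ (Suc (Suc n) div 2))"
    by (rule Mt_SucE)
  let ?t = "trunc (Suc n) t"
  have T: "[Pt t = Pt ?t] (mod 2 ^ (Suc n div 2))"
    by (rule cong_sym[OF cong_pow_le[OF trunc_cong[OF Mt_perfect[OF Suc.prems], THEN conjunct2, THEN conjunct2]]]) simp
  have *: "[Pt (trunc n x) = Pt ?t] (mod 2 ^ (Suc n div 2))" if "x \<in> {g, h}" for x
  proof -
    have x: "x \<in> Mt (Suc n)" "[Pt x = Pt t] (mod 2 ^ (Suc (Suc n) div 2))" using that t by auto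
    have "[Pt (trunc n x) = Pt x] (mod 2 ^ (Suc n div 2))"
      by (rule trunc_cong[OF Mt_perfect[OF x(1)], THEN conjunct2, THEN conjunct2])
    also have "[Pt x = Pt t] (mod 2 ^ (Suc n div 2))" by (rule cong_pow_le[OF x(2)]) simp
    also note T
    finally show ?thesis .
  qed
  have eq: "?t = Node e (trunc n g) (trunc n h)" by (simp add: t(1))
  have "[Pt (trunc n g) = Pt ?t] (mod 2 ^ (Suc n div 2))" "[Pt (trunc n h) = Pt ?t] (mod 2 ^ (Suc n div 2))"
    by (rule *; simp)+
  then show ?case
    using Suc.IH[OF t(2)] Suc.IH[OF t(3)] unfolding eq Node_in_Mt by (intro conjI)
qed simp

lemma Mt_trunc: "t \<in> Mt m \<Longrightarrow> n \<le> m \<Longrightarrow> trunc n t \<in> Mt n"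
proof (induction m arbitrary: t)
  case (Suc m)
  show ?case
  proof (cases "n = Suc m")
    case True
    then show ?thesis using Suc.prems trunc_self[OF Mt_perfect[OF Suc.prems(1)]] by metis
  next
    case False
    then have "n \<le> m" using Suc.prems by simp
    with Suc.IH[OF Mt_trunc_Suc[OF Suc.prems(1)]] show ?thesis by (simp add: trunc_trunc)
  qed
qed simp

lemma Node_FibI:
  assumes "odd p" "e = odd q" "g \<in> fibre n p j ((q - of_bool e) div 2)"
    "h \<in> fibre n p (r - j) ((q - of_bool e) div 2 + (p - 1 + 2 * of_bool e) div 2)"
  shows "Node e g h \<in> fibre (Suc n) p q r"
proof -
  have j: "[j = Qt g] (mod 2 ^ (Suc n div 2))" using assms(3) by (simp add: fibre_def cong_def)
  have "[r - j = r - Qt g] (mod 2 ^ (Suc n div 2))" by (rule cong_diff[OF cong_refl j])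
  from fibre_cong[OF assms(3) j] fibre_cong[OF assms(4) this]
  show ?thesis unfolding Node_in_fibre[OF assms(1,2)] by (rule conjI)
qed

text \<open>Being integers, \<open>p\<close>, \<open>q\<close>, \<open>r\<close> also prescribe the
  bits that first matter at height \<open>n + 1\<close>. The sections are lifted inside their own
  fibres, with \<open>Qt g\<close> kept as the same integer for both so that the lifts still fit
  together.\<close>

lemma fibre_lift: "odd p \<Longrightarrow> t \<in> fibre n p q r \<Longrightarrow> \<exists>t'\<in>fibre (Suc n) p q r. trunc n t' = t"
proof (induction n arbitrary: t q r)
  case 0
  then have "Node (odd q) Leaf Leaf \<in> fibre (Suc 0) p q r"
    by (intro Node_FibI[where j = 0]) (auto simp: fibre_def)
  with 0 show ?case by (auto simp: fibre_def)
next
  case (Suc n)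
  then obtain e g h where t: "t = Node e g h" using fibre_subset by (blast elim: Mt_SucE)
  have e: "e = odd q" using Suc.prems t Node_in_fibre_odd by blast
  from Suc.prems(2) have gh: "g \<in> fibre n p (Qt g) ((q - of_bool e) div 2)"
    "h \<in> fibre n p (r - Qt g) ((q - of_bool e) div 2 + (p - 1 + 2 * of_bool e) div 2)"
    unfolding t Node_in_fibre[OF Suc.prems(1) e] by (rule conjunct1, rule conjunct2)
  obtain g' where g': "g' \<in> fibre (Suc n) p (Qt g) ((q - of_bool e) div 2)" "trunc n g' = g"
    using Suc.IH[OF Suc.prems(1) gh(1)] by blast
  obtain h' where h': "h' \<in> fibre (Suc n) p (r - Qt g) ((q - of_bool e) div 2 + (p - 1 + 2 * of_bool e) div 2)"
      "trunc n h' = h"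
    using Suc.IH[OF Suc.prems(1) gh(2)] by blast
  show ?case
    using Node_FibI[OF Suc.prems(1) e g'(1) h'(1)] g'(2) h'(2)
    by (intro bexI[of _ "Node e g' h'"]) (simp_all add: t)
qed

lemma Mt_lift: "t \<in> Mt n \<Longrightarrow> \<exists>t'\<in>Mt (Suc n). trunc n t' = t"
  using fibre_lift[of "Pt t" t n "Qt t" "Rt t"] odd_Pt[of t] fibre_subset by (auto simp: fibre_def)

section \<open>Products of fibres and commutators\<close>

lemma fibre_tcomp:
  assumes "x \<in> fibre n p q r" "y \<in> fibre n p' q' r'"
  shows "tcomp x y \<in> fibre n (p * p') (q + p * q') (r + p * r')"
proof -
  have xy: "x \<in> Mt n" "y \<in> Mt n" using assms by (auto simp: fibre_def)
  have le: "n div 2 \<le> Suc n div 2" by (simp add: div_le_mono)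
  have "[Qt x + Pt x * Qt y = q + p * q'] (mod 2 ^ (Suc n div 2))"
    "[Pt x * Pt y = p * p'] (mod 2 ^ (Suc n div 2))"
    using assms unfolding fibre_def by (auto intro!: cong_add cong_mult)
  moreover have "[Rt x + Pt x * Rt y = r + p * r'] (mod 2 ^ (n div 2))"
    using assms cong_pow_le[OF _ le] unfolding fibre_def by (auto intro!: cong_add cong_mult)
  ultimately show ?thesis
    unfolding fibre_def using xy
    by (auto intro: tcomp_Mt cong_trans[OF Qt_tcomp] cong_trans[OF Rt_tcomp] cong_trans[OF Pt_tcomp])
qed

lemma cong_mult_odd_cancel:
  "odd (p::int) \<Longrightarrow> [x * p = y * p] (mod 2 ^ k) \<longleftrightarrow> [x = y] (mod 2 ^ k)"
  by (rule cong_mult_rcancel) simp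

text \<open>Write \<open>x = z y\<close>. Multiplicativity of \<open>P\<close> and cancellation of
  the odd \<open>p\<close> force \<open>P(z) = 1\<close>; then the cocycle identities become
  additive and \<open>Q\<close>, \<open>R\<close> of \<open>z\<close> cancel. Fibres thus behave
  like cosets of the fibre of the identity.\<close>

lemma fibre_diff:
  assumes p: "odd p" and x: "x \<in> fibre n p q r" and y: "y \<in> fibre n p q r"
  shows "tcomp x (tinv y) \<in> fibre n 1 0 0"
proof -
  define z where "z = tcomp x (tinv y)"
  have M: "x \<in> Mt n" "y \<in> Mt n" using x y by (auto simp: fibre_def)
  have z: "z \<in> Mt n" using M by (simp add: z_def tcomp_Mt tinv_Mt)
  have xz: "x = tcomp z y"
    using M tcomp_tinv_left[of y n] tcomp_assoc[of x n "tinv y" y]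
    by (simp add: z_def Mt_perfect tinv_perfect)
  have le: "n div 2 \<le> Suc n div 2" by (simp add: div_le_mono)
  have "[Pt z * p = Pt z * Pt y] (mod 2 ^ (Suc n div 2))"
    using y by (intro cong_mult[OF cong_refl]) (simp add: fibre_def cong_sym_eq)
  also have "[Pt z * Pt y = Pt x] (mod 2 ^ (Suc n div 2))"
    using Pt_tcomp[OF z M(2)] unfolding xz[symmetric] by (rule cong_sym)
  also have "[Pt x = 1 * p] (mod 2 ^ (Suc n div 2))" using x by (simp add: fibre_def)
  finally have P: "[Pt z = 1] (mod 2 ^ (Suc n div 2))" unfolding cong_mult_odd_cancel[OF p] .
  have *: "[f z = 0] (mod 2 ^ k)"
    if "[f (tcomp z y) = f z + Pt z * f y] (mod 2 ^ k)" "[f x = c] (mod 2 ^ k)" "[f y = c] (mod 2 ^ k)"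
      "k \<le> Suc n div 2" for f :: "btree \<Rightarrow> int" and c k
  proof -
    have "[f z + 1 * c = f z + Pt z * f y] (mod 2 ^ k)"
      by (intro cong_add cong_mult cong_refl cong_sym[OF that(3)] cong_sym[OF cong_pow_le[OF P that(4)]])
    also have "[f z + Pt z * f y = f x] (mod 2 ^ k)"
      using that(1) unfolding xz[symmetric] by (rule cong_sym)
    also have "[f x = 0 + 1 * c] (mod 2 ^ k)" using that(2) by simp
    finally show ?thesis by (simp only: cong_add_rcancel)
  qed
  have "[Qt z = 0] (mod 2 ^ (Suc n div 2))"
    by (rule *[where f = Qt and c = q, OF Qt_tcomp[OF z M(2)]]) (use x y in \<open>auto simp: fibre_def\<close>)
  moreover have "[Rt z = 0] (mod 2 ^ (n div 2))"
    by (rule *[where f = Rt and c = r, OF Rt_tcomp[OF z M(2)]]) (use x y le in \<open>auto simp: fibre_def\<close>)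
  ultimately show ?thesis using P z unfolding z_def[symmetric] by (simp add: fibre_def)
qed

lemma fibre1_tcomp:
  "x \<in> fibre n 1 q r \<Longrightarrow> y \<in> fibre n 1 q' r' \<Longrightarrow> tcomp x y \<in> fibre n 1 (q + q') (r + r')"
  using fibre_tcomp[of x n 1 q r y 1 q' r'] by simp

lemma tid_fibre: "tid n \<in> fibre n 1 0 0"
  by (simp add: fibre_def)

lemma fibre1_tinv:
  assumes "x \<in> fibre n 1 q r"
  shows "tinv x \<in> fibre n 1 (- q) (- r)"
proof -
  have x: "x \<in> Mt n" using assms by (simp add: fibre_def)
  \<comment> \<open>For any \<open>z\<close> with the opposite values, \<open>z x\<close> lies in
    the fibre of the identity, whose closure under inverses is \<open>fibre_diff\<close> with
    \<open>x\<close> taken to be \<open>tid n\<close>. The inverse of \<open>x\<close> is then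
    recovered as \<open>(z x)^-1 z\<close>.\<close>
  obtain z where z: "z \<in> fibre n 1 (- q) (- r)" using fibre_nonempty[OF odd_one] by blast
  then have zM: "z \<in> Mt n" by (simp add: fibre_def)
  have "tcomp z x \<in> fibre n 1 0 0" using fibre1_tcomp[OF z assms] by simp
  from fibre_diff[OF _ tid_fibre this] have "tcomp (tid n) (tinv (tcomp z x)) \<in> fibre n 1 0 0" by simp
  then have "tinv (tcomp z x) \<in> fibre n 1 0 0"
    using x zM by (simp add: tinv_perfect tcomp_perfect Mt_perfect)
  from fibre1_tcomp[OF this z] have "tcomp (tinv (tcomp z x)) z \<in> fibre n 1 (- q) (- r)" by simp
  moreover have "tcomp (tinv (tcomp z x)) z = tinv x"
  proof -
    have p: "x \<in> perfect n" "z \<in> perfect n" "tcomp z x \<in> perfect n"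
      using x zM by (simp_all add: Mt_perfect tcomp_perfect)
    have "z = tcomp (tcomp z x) (tinv x)"
      using p tcomp_tinv_right[of x n] by (simp add: tcomp_assoc[of _ n] tinv_perfect)
    then have "tcomp (tinv (tcomp z x)) z = tcomp (tinv (tcomp z x)) (tcomp (tcomp z x) (tinv x))"
      by (rule arg_cong)
    also have "\<dots> = tcomp (tcomp (tinv (tcomp z x)) (tcomp z x)) (tinv x)"
      using p by (intro tcomp_assoc[of _ n, symmetric]) (simp_all add: tinv_perfect)
    also have "\<dots> = tinv x" using p tcomp_tinv_left[of "tcomp z x" n] by (simp add: tinv_perfect)
    finally show ?thesis .
  qed
  ultimately show ?thesis by simp
qed

lemma tinv_tid [simp]: "tinv (tid n) = tid n"
  by (induction n) auto

definition tcomm :: "btree \<Rightarrow> btree \<Rightarrow> btree" where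
  "tcomm s t = tcomp (tcomp s t) (tcomp (tinv s) (tinv t))"

text \<open>The induction runs over all \<open>H\<close> at once: the elements \<open>y\<close> with
  (1, y) in \<open>H\<close>, and likewise those with (y, 1) in \<open>H\<close>, satisfy the
  hypotheses one level down. A pair \<open>u\<close>, \<open>b\<close> there is realised above by
  (1, u) and (m, b), in which the roles of the two factors are exchanged; this is why both orders of
  the commutator are assumed. The remaining freedom, opposite values of \<open>Q\<close> on the two
  sections, is absorbed by a commutator that involves a flip.\<close>

lemma fibre_one_subset_of_commutators:
  assumes "\<And>x y. x \<in> H \<Longrightarrow> y \<in> H \<Longrightarrow> tcomp x y \<in> H" "\<And>x. x \<in> H \<Longrightarrow> tinv x \<in> H"
    "\<And>u b q q' r. u \<in> fibre n 1 q 0 \<Longrightarrow> b \<in> fibre n 1 q' r \<Longrightarrow> tcomm u b \<in> H \<and> tcomm b u \<in> H"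
  shows "fibre n 1 0 0 \<subseteq> H"
  using assms
proof (induction n arbitrary: H)
  case 0
  have "tcomm Leaf Leaf \<in> H" using "0.prems"(3)[of Leaf 0 Leaf 0 0] by (simp add: fibre_def)
  then show ?case by (auto simp: fibre_def tcomm_def)
next
  case (Suc n)
  note mult = Suc.prems(1) and inv = Suc.prems(2) and comm = Suc.prems(3)
  have perf: "x \<in> perfect n" if "x \<in> fibre n p q r" for x p q r
    using that by (simp add: fibre_def Mt_perfect)
  have right: "fibre n 1 0 0 \<subseteq> {y. Node False (tid n) y \<in> H}"
  proof (rule Suc.IH)
    fix x y assume "x \<in> {y. Node False (tid n) y \<in> H}" "y \<in> {y. Node False (tid n) y \<in> H}"
    then show "tcomp x y \<in> {y. Node False (tid n) y \<in> H}"
      using mult[of "Node False (tid n) x" "Node False (tid n) y"] by simp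
  next
    fix x assume "x \<in> {y. Node False (tid n) y \<in> H}"
    then show "tinv x \<in> {y. Node False (tid n) y \<in> H}"
      using inv[of "Node False (tid n) x"] by simp
  next
    fix u b q q' r assume u: "u \<in> fibre n 1 q 0" and b: "b \<in> fibre n 1 q' r"
    \<comment> \<open>\<open>R(m) = R(b)\<close> makes \<open>P = 1\<close> for the pair (m, b), and
      \<open>Q(m) = - Q(b)\<close> makes its \<open>R\<close> vanish, so it can take the part of
      \<open>u\<close> one level up. Dually (1, u) has \<open>P = 1\<close> because
      \<open>R(u) = 0\<close>.\<close>
    obtain m where m: "m \<in> fibre n 1 (- q') r" using fibre_nonempty[OF odd_one] by blast
    have "Node False m b \<in> fibre (Suc n) 1 (2 * r) 0"
      using m b by (intro Node_FibI[where j = "- q'"]) auto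
    moreover have "Node False (tid n) u \<in> fibre (Suc n) 1 0 q"
      using u tid_fibre by (intro Node_FibI[where j = 0]) auto
    ultimately have "tcomm (Node False m b) (Node False (tid n) u) \<in> H"
      "tcomm (Node False (tid n) u) (Node False m b) \<in> H"
      using comm by blast+
    then show "tcomm u b \<in> {y. Node False (tid n) y \<in> H} \<and> tcomm b u \<in> {y. Node False (tid n) y \<in> H}"
      using perf[OF m] perf[OF u] perf[OF b] tcomp_tinv_right[of m n]
      by (simp add: tcomm_def tinv_perfect tcomp_perfect)
  qed
  have left: "fibre n 1 0 0 \<subseteq> {y. Node False y (tid n) \<in> H}"
  proof (rule Suc.IH)
    fix x y assume "x \<in> {y. Node False y (tid n) \<in> H}" "y \<in> {y. Node False y (tid n) \<in> H}"
    then show "tcomp x y \<in> {y. Node False y (tid n) \<in> H}"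
      using mult[of "Node False x (tid n)" "Node False y (tid n)"] by simp
  next
    fix x assume "x \<in> {y. Node False y (tid n) \<in> H}"
    then show "tinv x \<in> {y. Node False y (tid n) \<in> H}"
      using inv[of "Node False x (tid n)"] by simp
  next
    fix u b q q' r assume u: "u \<in> fibre n 1 q 0" and b: "b \<in> fibre n 1 q' r"
    obtain m where m: "m \<in> fibre n 1 (- q') r" using fibre_nonempty[OF odd_one] by blast
    have "Node False b m \<in> fibre (Suc n) 1 (2 * r) 0"
      using m b by (intro Node_FibI[where j = q']) auto
    moreover have "Node False u (tid n) \<in> fibre (Suc n) 1 0 q"
      using u tid_fibre by (intro Node_FibI[where j = q]) auto
    ultimately have "tcomm (Node False b m) (Node False u (tid n)) \<in> H"
      "tcomm (Node False u (tid n)) (Node False b m) \<in> H"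
      using comm by blast+
    then show "tcomm u b \<in> {y. Node False y (tid n) \<in> H} \<and> tcomm b u \<in> {y. Node False y (tid n) \<in> H}"
      using perf[OF m] perf[OF u] perf[OF b] tcomp_tinv_right[of m n]
      by (simp add: tcomm_def tinv_perfect tcomp_perfect)
  qed
  show ?case
  proof
    fix v assume v: "v \<in> fibre (Suc n) 1 0 0"
    then obtain e g h where "v = Node e g h" using fibre_subset by (blast elim: Mt_SucE)
    with v Node_in_fibre_odd[of e g h n 1 0 0] have eq: "v = Node False g h" by simp
    define q where "q = Qt g"
    have g: "g \<in> fibre n 1 q 0" and h: "h \<in> fibre n 1 (- q) 0"
      using v Node_in_fibre[of 1 False 0 g h n 0] unfolding eq q_def by simp_all
    obtain a where a: "a \<in> fibre n 1 q 0" using fibre_nonempty[OF odd_one] by blast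
    \<comment> \<open>\<open>R(\<beta>) = 1\<close> compensates the flip:
      \<open>P = 1 - 2 + 2 R(\<beta>) = 1\<close>. The commutator of the flipped pair (1, \<beta>)
      with (1, a) is (c, a^-1), which carries the values \<open>q\<close> and \<open>- q\<close> of
      \<open>Q\<close>.\<close>
    obtain \<beta> where \<beta>: "\<beta> \<in> fibre n 1 0 1" using fibre_nonempty[OF odd_one] by blast
    define c where "c = tcomp (tcomp \<beta> a) (tinv \<beta>)"
    have "Node True (tid n) \<beta> \<in> fibre (Suc n) 1 1 0"
      using \<beta> tid_fibre by (intro Node_FibI[where j = 0]) auto
    moreover have "Node False (tid n) a \<in> fibre (Suc n) 1 0 q"
      using a tid_fibre by (intro Node_FibI[where j = 0]) auto
    ultimately have "tcomm (Node True (tid n) \<beta>) (Node False (tid n) a) \<in> H"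
      using comm by blast
    then have w: "Node False c (tinv a) \<in> H"
      using perf[OF a] perf[OF \<beta>] by (simp add: tcomm_def c_def tinv_perfect)
    have c: "c \<in> fibre n 1 q 0"
      using fibre1_tcomp[OF fibre1_tcomp[OF \<beta> a] fibre1_tinv[OF \<beta>]] by (simp add: c_def)
    have "tcomp g (tinv c) \<in> fibre n 1 0 0" "tcomp h a \<in> fibre n 1 0 0"
      using fibre1_tcomp[OF g fibre1_tinv[OF c]] fibre1_tcomp[OF h a] by simp_all
    then have "Node False (tcomp g (tinv c)) (tid n) \<in> H" "Node False (tid n) (tcomp h a) \<in> H"
      using left right by blast+
    \<comment> \<open>The factorization is
      \<open>v = (g c^-1, 1) (1, h a) (c, a^-1)\<close>.\<close>
    from mult[OF mult[OF this] w] show "v \<in> H"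
      using perf[OF g] perf[OF h] perf[OF a] perf[OF c]
        tcomp_tinv_left[of c n] tcomp_tinv_right[of a n]
      by (simp add: eq tcomp_perfect tinv_perfect tcomp_assoc[of _ n])
  qed
qed

section \<open>Subgroups surjecting onto the Frattini quotient\<close>

text \<open>The inverse turns right multiplication of cosets into a left action, to which orbit
  counting applies.\<close>

lemma (in group) rcosets_right_action:
  assumes H: "subgroup H G"
  shows "group_action (G\<lparr>carrier := H\<rparr>) (rcosets H) (\<lambda>h. \<lambda>c\<in>rcosets H. c #> inv h)"
proof -
  have grpH: "group (G\<lparr>carrier := H\<rparr>)" using H subgroup.subgroup_is_group by blast
  have HG: "H \<subseteq> carrier G" using H subgroup.subset by blast
  have CG: "c \<subseteq> carrier G" if "c \<in> rcosets H" for c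
    using that H subgroup.rcosets_carrier[OF H is_group] by simp
  have closed: "c #> g \<in> rcosets H" if "c \<in> rcosets H" "g \<in> carrier G" for c g
    using that HG unfolding RCOSETS_def by (auto simp: coset_mult_assoc)
  let ?\<phi> = "\<lambda>h. \<lambda>c\<in>rcosets H. c #> inv h"
  have bij: "?\<phi> h \<in> Bij (rcosets H)" if "h \<in> H" for h
  proof -
    have h: "h \<in> carrier G" using that HG by blast
    have "bij_betw (?\<phi> h) (rcosets H) (rcosets H)"
      by (rule bij_betw_byWitness[where f' = "\<lambda>c. c #> h"])
        (use h CG closed in \<open>auto simp: coset_mult_assoc\<close>)
    then show ?thesis by (simp add: Bij_def)
  qed
  have hom: "?\<phi> (h \<otimes> k) = compose (rcosets H) (?\<phi> h) (?\<phi> k)" if "h \<in> H" "k \<in> H" for h k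
  proof
    fix c
    have "h \<in> carrier G" "k \<in> carrier G" using that HG by blast+
    then show "?\<phi> (h \<otimes> k) c = compose (rcosets H) (?\<phi> h) (?\<phi> k) c"
      using CG closed by (auto simp: compose_def coset_mult_assoc inv_mult_group)
  qed
  have "?\<phi> \<in> hom (G\<lparr>carrier := H\<rparr>) (BijGroup (rcosets H))"
    using bij hom by (auto simp: hom_def BijGroup_def)
  then show ?thesis
    using grpH group_BijGroup by (simp add: group_action_def group_hom_def group_hom_axioms_def)
qed

text \<open>Normalizers grow in a 2-group. \<open>H\<close> acts on its right cosets with orbits of
  2-power size and fixes the coset \<open>H\<close>; the number of cosets is even, so a second coset
  \<open>H x\<close> is fixed, and \<open>H x h = H x\<close> gives
  \<open>x h x^-1 \<in> H\<close>.\<close>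

lemma (in group) proper_subgroup_normalized:
  assumes order: "Coset.order G = 2 ^ k" and H: "subgroup H G" "H \<noteq> carrier G"
  shows "\<exists>x\<in>carrier G - H. \<forall>h\<in>H. x \<otimes> h \<otimes> inv x \<in> H"
proof -
  let ?C = "rcosets H" and ?\<phi> = "\<lambda>h. \<lambda>c\<in>rcosets H. c #> inv h" and ?K = "G\<lparr>carrier := H\<rparr>"
  interpret A: group_action ?K ?C ?\<phi> by (rule rcosets_right_action[OF H(1)])
  have HG: "H \<subseteq> carrier G" using H subgroup.subset by blast
  have fin: "finite (carrier G)" using order order_gt_0_iff_finite by fastforce
  then have finC: "finite ?C" unfolding RCOSETS_def by auto
  have lag: "card ?C * card H = 2 ^ k" using lagrange[OF H(1)] order by simp
  have C2: "even (card ?C)"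
  proof -
    obtain j where j: "card ?C = 2 ^ j" using lag by (metis dvd_triv_left divides_primepow_nat two_is_prime_nat)
    have "j \<noteq> 0"
    proof
      assume "j = 0"
      then have "card H = card (carrier G)" using j lag order by (simp add: Coset.order_def)
      then show False using card_subset_eq[OF fin HG] H(2) by blast
    qed
    then show ?thesis using j by simp
  qed
  have orb_pow: "\<exists>j. card (orbit ?K ?\<phi> c) = 2 ^ j" if "c \<in> ?C" for c
  proof -
    have "card (orbit ?K ?\<phi> c) * card (stabilizer ?K ?\<phi> c) = card H"
      using A.orbit_stabilizer_theorem[OF that] by (simp add: Coset.order_def)
    then have "card (orbit ?K ?\<phi> c) dvd card H" by (rule dvdI[OF sym])
    also have "card H dvd 2 ^ k" by (rule dvdI[of _ _ "card ?C"]) (simp add: lag[symmetric])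
    finally show ?thesis using divides_primepow_nat[OF two_is_prime_nat] by blast
  qed
  have HC: "H \<in> ?C" using rcosetsI[OF HG one_closed] coset_mult_one[OF HG] by simp
  have orbH: "orbit ?K ?\<phi> H = {H}"
  proof -
    have "H #> inv h = H" if "h \<in> H" for h
      using that H(1) by (meson coset_join2 subgroup.m_inv_closed subgroup.mem_carrier)
    then show ?thesis
      using HC subgroup.one_closed[OF H(1)] by (auto simp: orbit_def)
  qed
  have "\<exists>c\<in>?C. c \<noteq> H \<and> card (orbit ?K ?\<phi> c) = 1"
  proof (rule ccontr)
    assume neg: "\<not> ?thesis"
    have even: "even (card (orbit ?K ?\<phi> c))" if "c \<in> ?C" "c \<noteq> H" for c
      using orb_pow[OF that(1)] neg that by (metis even_power dvd_refl power_0 not_gr_zero)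
    have part: "partition ?C (orbits ?K ?C ?\<phi>)" by (rule A.orbit_partition)
    have fo: "finite (orbits ?K ?C ?\<phi>)"
      by (rule finite_UnionD) (simp only: A.orbits_coverture finC)
    have "card ?C = sum card (orbits ?K ?C ?\<phi>)"
      using partition.disjoint_sum[OF part finC, of "\<lambda>_. 1::nat"] by simp
    also have "\<dots> = card {H} + sum card (orbits ?K ?C ?\<phi> - {{H}})"
      using fo HC orbH by (subst sum.remove[of _ "{H}"]) (auto simp: orbits_def)
    also have "even (sum card (orbits ?K ?C ?\<phi> - {{H}}))"
    proof (rule dvd_sum)
      fix O' assume "O' \<in> orbits ?K ?C ?\<phi> - {{H}}"
      then obtain c where "c \<in> ?C" "O' = orbit ?K ?\<phi> c" "O' \<noteq> {H}" by (auto simp: orbits_def)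
      then show "even (card O')" using even orbH by metis
    qed
    then have "odd (card {H} + sum card (orbits ?K ?C ?\<phi> - {{H}}))" by simp
    finally show False using C2 by simp
  qed
  then obtain c where c: "c \<in> ?C" "c \<noteq> H" "card (orbit ?K ?\<phi> c) = 1" by blast
  then obtain x where x: "x \<in> carrier G" "c = H #> x" by (auto simp: RCOSETS_def)
  have "x \<notin> H" using x c(2) H(1) coset_join2 by blast
  moreover have "x \<otimes> h \<otimes> inv x \<in> H" if h: "h \<in> H" for h
  proof -
    have hG: "h \<in> carrier G" and ih: "inv h \<in> H" using h H(1) HG subgroup.m_inv_closed by auto
    have "?\<phi> (inv h) c \<in> orbit ?K ?\<phi> c" using ih by (auto simp: orbit_def)
    moreover have "c \<in> orbit ?K ?\<phi> c" by (rule A.orbit_refl[OF c(1)])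
    ultimately have "?\<phi> (inv h) c = c" using c(3) by (metis card_1_singletonE singletonD)
    then have "H #> x #> h = H #> x" using c(1) x hG by simp
    then have "H #> (x \<otimes> h) = H #> x" using x hG HG by (simp add: coset_mult_assoc)
    then have "x \<otimes> h \<in> H #> x" using x hG H(1) by (metis rcos_self m_closed)
    then obtain h' where "h' \<in> H" "x \<otimes> h = h' \<otimes> x" by (auto simp: r_coset_def)
    then show ?thesis using x hG HG by (auto simp: m_assoc)
  qed
  ultimately show ?thesis using x(1) by blast
qed

text \<open>A stand-in for the Frattini quotient. Let \<open>H\<close> be maximal among the proper
  subgroups over \<open>K\<close>, and let \<open>y\<close> outside \<open>H\<close> normalize it
  with \<open>y^2\<close> in \<open>H\<close>. Then \<open>H \<union> H y\<close> is a subgroup,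
  hence everything, and both \<open>H\<close> and \<open>H y\<close> have their squares in
  \<open>H\<close>.\<close>

lemma (in group) proper_subgroup_in_square_closed:
  assumes order: "Coset.order G = 2 ^ k" and K: "subgroup K G" "K \<noteq> carrier G"
  shows "\<exists>H. subgroup H G \<and> K \<subseteq> H \<and> H \<noteq> carrier G \<and> (\<forall>x\<in>carrier G. x \<otimes> x \<in> H)"
proof -
  let ?A = "{H. subgroup H G \<and> K \<subseteq> H \<and> H \<noteq> carrier G}"
  have fin: "finite (carrier G)" using order order_gt_0_iff_finite by fastforce
  have "?A \<subseteq> Pow (carrier G)" using subgroup.subset by blast
  then have "finite ?A" using fin finite_subset by blast
  moreover have "K \<in> ?A" using K by simp
  ultimately obtain H where HA: "H \<in> ?A" and max: "\<And>B. B \<in> ?A \<Longrightarrow> H \<subseteq> B \<Longrightarrow> H = B"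
    by (meson finite_has_maximal2)
  then have H: "subgroup H G" "K \<subseteq> H" "H \<noteq> carrier G" by auto
  interpret H: subgroup H G by (rule H)
  obtain x where x: "x \<in> carrier G" "x \<notin> H" and xH: "\<And>h. h \<in> H \<Longrightarrow> x \<otimes> h \<otimes> inv x \<in> H"
    using proper_subgroup_normalized[OF order H(1,3)] by blast
  have pw: "(x [^] n) \<otimes> h \<otimes> inv (x [^] n) \<in> H" if "h \<in> H" for h and n :: nat
    using that
  proof (induction n arbitrary: h)
    case (Suc n)
    have "x [^] Suc n \<otimes> h \<otimes> inv (x [^] Suc n) = x [^] n \<otimes> (x \<otimes> h \<otimes> inv x) \<otimes> inv (x [^] n)"
      using x Suc.prems H.mem_carrier by (simp add: inv_mult_group m_assoc)
    then show ?case using Suc.IH[OF xH[OF Suc.prems]] by simp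
  qed simp
  \<comment> \<open>The exponents are powers of 2, so one step before \<open>x\<close> first enters
    \<open>H\<close> there is a power \<open>y\<close> outside \<open>H\<close> whose square is
    inside. Such an entry exists because \<open>x\<close> to the order of the group is the
    identity.\<close>
  define j where "j = (LEAST j. x [^] ((2::nat) ^ j) \<in> H)"
  have "x [^] ((2::nat) ^ k) = \<one>" using pow_order_eq_1[OF x(1)] order by simp
  then have ex: "x [^] ((2::nat) ^ k) \<in> H" by simp
  have jH: "x [^] ((2::nat) ^ j) \<in> H" unfolding j_def by (rule LeastI[of _ k]) (rule ex)
  have "j \<noteq> 0" using jH x by (intro notI) simp
  then obtain i where i: "j = Suc i" by (cases j) auto
  define y where "y = x [^] ((2::nat) ^ i)"
  have y: "y \<in> carrier G" using x by (simp add: y_def)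
  have yH: "y \<notin> H" using not_less_Least[of i "\<lambda>j. x [^] ((2::nat) ^ j) \<in> H"] i by (simp add: y_def j_def)
  have yy: "y \<otimes> y \<in> H" using jH x by (simp add: y_def i nat_pow_mult mult_2)
  have yhy: "y \<otimes> h \<otimes> inv y \<in> H" if "h \<in> H" for h using pw[OF that] by (simp add: y_def)
  have yh: "y \<otimes> h = (y \<otimes> h \<otimes> inv y) \<otimes> y" if "h \<in> H" for h
    using that y H.mem_carrier by (simp add: m_assoc)
  have iy: "inv y = inv (y \<otimes> y) \<otimes> y" using y by (simp add: inv_mult_group m_assoc)
  have iyy: "inv y \<otimes> (y \<otimes> w) = w" if "w \<in> carrier G" for w
    using that y by (simp add: m_assoc[symmetric])
  let ?L = "{h \<otimes> z |h z. h \<in> H \<and> z \<in> {\<one>, y}}"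
  have yhL: "y \<otimes> h \<in> ?L" if "h \<in> H" for h
    using yh[OF that] yhy[OF that] by blast
  have mulL: "h \<otimes> l \<in> ?L" if "h \<in> H" "l \<in> ?L" for h l
  proof -
    from that obtain h' z where "h' \<in> H" "z \<in> {\<one>, y}" "l = h' \<otimes> z" by blast
    then show ?thesis using that y H.mem_carrier by (intro CollectI exI[of _ "h \<otimes> h'"] exI[of _ z]) (auto simp: m_assoc)
  qed
  have L: "subgroup ?L G"
  proof (rule subgroupI)
    show "?L \<subseteq> carrier G" using y H.mem_carrier by auto
    show "?L \<noteq> {}" using H.one_closed by blast
    fix a assume "a \<in> ?L"
    then obtain h z where a: "h \<in> H" "z \<in> {\<one>, y}" "a = h \<otimes> z" by blast
    have "inv z \<otimes> inv h \<in> ?L"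
    proof (cases "z = \<one>")
      case True
      then show ?thesis using a(1) H.mem_carrier by (intro CollectI exI[of _ "inv h"] exI[of _ \<one>]) auto
    next
      case False
      then have "inv z \<otimes> inv h = inv (y \<otimes> y) \<otimes> (y \<otimes> inv h)"
        using a y H.mem_carrier iy by (simp add: m_assoc)
      then show ?thesis using mulL[of "inv (y \<otimes> y)" "y \<otimes> inv h"] yhL[of "inv h"] a(1) yy by simp
    qed
    moreover have "inv a = inv z \<otimes> inv h" using a y H.mem_carrier by (auto simp: inv_mult_group)
    ultimately show "inv a \<in> ?L" by (simp only:)
  next
    fix a b assume "a \<in> ?L" "b \<in> ?L"
    then obtain h z h' z' where a: "h \<in> H" "z \<in> {\<one>, y}" "a = h \<otimes> z"
      and b: "h' \<in> H" "z' \<in> {\<one>, y}" "b = h' \<otimes> z'" by blast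
    have "z \<otimes> b \<in> ?L"
    proof (cases "z = \<one>")
      case True
      then have "z \<otimes> b = h' \<otimes> z'" using b y H.mem_carrier by auto
      then show ?thesis using b by blast
    next
      case False
      then have z: "z = y" using a by simp
      have eq: "z \<otimes> b = (y \<otimes> h' \<otimes> inv y) \<otimes> (y \<otimes> z')"
        using b y H.mem_carrier z by (auto simp: m_assoc iyy)
      have "y \<otimes> z' \<in> ?L"
      proof (cases "z' = \<one>")
        case True
        then show ?thesis using yhL[of \<one>] by simp
      next
        case False
        then have "y \<otimes> z' = (y \<otimes> y) \<otimes> \<one>" using b y by simp
        then show ?thesis using yy by blast
      qed
      then show ?thesis using mulL[OF yhy[OF b(1)]] eq by simp
    qed
    then have "h \<otimes> (z \<otimes> b) \<in> ?L" by (rule mulL[OF a(1)])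
    moreover have "a \<otimes> b = h \<otimes> (z \<otimes> b)" using a b y H.mem_carrier by (auto simp: m_assoc)
    ultimately show "a \<otimes> b \<in> ?L" by (simp only:)
  qed
  have HL: "H \<subseteq> ?L"
  proof
    fix h assume "h \<in> H"
    then show "h \<in> ?L" using H.mem_carrier by (intro CollectI exI[of _ h] exI[of _ \<one>]) simp
  qed
  have "y \<in> ?L" using yhL[of \<one>] y by simp
  then have "?L \<noteq> H" using yH by blast
  then have all: "?L = carrier G" using max[of ?L] L HL H(2) by blast
  have "z \<otimes> z \<in> H" if "z \<in> carrier G" for z
  proof -
    from that all obtain h w where z: "h \<in> H" "w \<in> {\<one>, y}" "z = h \<otimes> w" by blast
    show ?thesis
    proof (cases "w = \<one>")
      case True
      then show ?thesis using z H.mem_carrier by simp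
    next
      case False
      then have "z \<otimes> z = h \<otimes> ((y \<otimes> h \<otimes> inv y) \<otimes> (y \<otimes> y))"
        using z y H.mem_carrier by (auto simp: m_assoc iyy)
      then show ?thesis using z(1) yhy yy by simp
    qed
  qed
  then show ?thesis using H by blast
qed

text \<open>Hensel lifting at the prime 2, which has to start at modulus 8 and from the root
  1.\<close>

lemma odd_square_root_mod_pow2:
  assumes "[p = 1] (mod (8::int))"
  shows "\<exists>v. odd v \<and> [v * v = p] (mod 2 ^ k)"
proof -
  have "\<exists>v. odd v \<and> [v * v = p] (mod 2 ^ (k + 3))" for k
  proof (induction k)
    case 0
    show ?case using assms by (intro exI[of _ 1]) (simp add: cong_sym)
  next
    case (Suc k)
    then obtain v where v: "odd v" "[v * v = p] (mod 2 ^ (k + 3))" by blast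
    then obtain c where c: "p = v * v + 2 ^ (k + 3) * c"
      by (metis cong_iff_lin)
    have pows: "(2::int) ^ (k + 3) = 8 * 2 ^ k" "(2::int) ^ (Suc k + 3) = 16 * 2 ^ k"
      "(2::int) ^ (k + 2) = 4 * 2 ^ k"
      by (simp_all add: power_add)
    show ?case
    proof (cases "even c")
      case True
      then obtain d where "c = 2 * d" by blast
      then have "p = v * v + 2 ^ (Suc k + 3) * d" using c unfolding pows by simp
      then have "[v * v = p] (mod 2 ^ (Suc k + 3))" by (metis cong_iff_lin)
      then show ?thesis using v by blast
    next
      case False
      have "even (c - v)" using False v(1) by simp
      then obtain d where d: "c - v = 2 * d" by (rule evenE)
      \<comment> \<open>Adding \<open>2 ^ (k + 2)\<close> changes the square by
        \<open>2 ^ (k + 3) * v\<close> up to multiples of \<open>2 ^ (k + 4)\<close>; as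
        \<open>v\<close> is odd, this corrects exactly the wrong bit.\<close>
      let ?w = "v + 2 ^ (k + 2)"
      have "p = ?w * ?w + 2 ^ (Suc k + 3) * (d - 2 ^ k)"
        using c d unfolding pows by (simp add: algebra_simps)
      then have "[?w * ?w = p] (mod 2 ^ (Suc k + 3))" by (metis cong_iff_lin)
      moreover have "odd ?w" using v(1) by simp
      ultimately show ?thesis by blast
    qed
  qed
  from this[of k] obtain v where "odd v" "[v * v = p] (mod 2 ^ (k + 3))" by blast
  then show ?thesis using cong_pow_le[of _ _ "k + 3" k] by auto
qed

text \<open>Otherwise \<open>K\<close> lies in a proper \<open>H\<close> that contains all squares,
  hence all commutators and the fibre of the identity. Dividing any \<open>s\<close> by an element
  of \<open>K\<close> with the same residues leaves \<open>P\<close> congruent to 1 modulo 8 and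
  even \<open>Q\<close> and \<open>R\<close>; products of squares attain all such values, so
  \<open>H\<close> is everything. The bound on \<open>n\<close> makes \<open>P\<close> meaningful
  modulo 8.\<close>

lemma Mt_eq_of_residues:
  assumes n: "n \<ge> 5" and K: "subgroup K (Mgrp n)"
    and res: "\<And>p q r. odd p \<Longrightarrow>
      \<exists>t\<in>K. [Pt t = p] (mod 8) \<and> [Qt t = q] (mod 2) \<and> [Rt t = r] (mod 2)"
  shows "K = Mt n"
proof (rule ccontr)
  assume "K \<noteq> Mt n"
  interpret M: group "Mgrp n" by (rule group_Mgrp)
  obtain k where "Coset.order (Mgrp n) = 2 ^ k"
    using card_Mt_pow2[of n] by (auto simp: Coset.order_def)
  from M.proper_subgroup_in_square_closed[OF this K] \<open>K \<noteq> Mt n\<close>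
  obtain H where H: "subgroup H (Mgrp n)" "K \<subseteq> H" "H \<noteq> Mt n"
    and sq: "\<And>x. x \<in> Mt n \<Longrightarrow> tcomp x x \<in> H" by auto
  have HM: "H \<subseteq> Mt n" using subgroup.subset[OF H(1)] by simp
  have mult: "tcomp x y \<in> H" if "x \<in> H" "y \<in> H" for x y
    using subgroup.m_closed[OF H(1) that] by simp
  have inv: "tinv x \<in> H" if "x \<in> H" for x
    using subgroup.m_inv_closed[OF H(1) that] that HM by (simp add: inv_Mgrp subset_iff)
  have comm: "tcomm s t \<in> H" if st: "s \<in> Mt n" "t \<in> Mt n" for s t
  proof -
    have p: "s \<in> perfect n" "t \<in> perfect n" using st by (simp_all add: Mt_perfect)
    have cancel: "tcomp s (tcomp (tinv s) x) = x" "tcomp t (tcomp (tinv t) x) = x" if "x \<in> perfect n" for x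
      using p that tcomp_tinv_right[OF p(1)] tcomp_tinv_right[OF p(2)]
      by (simp_all add: tinv_perfect flip: tcomp_assoc[of _ n])
    \<comment> \<open>A commutator is a product of squares:
      \<open>s t s^-1 t^-1 = s^2 (s^-1 t)^2 (t^-1)^2\<close>.\<close>
    let ?u = "tcomp (tinv s) t"
    have "tcomp (tcomp s s) (tcomp (tcomp ?u ?u) (tinv (tcomp t t))) \<in> H"
      using st by (intro mult inv sq tcomp_Mt tinv_Mt)
    moreover have "tinv (tcomp t t) = tcomp (tinv t) (tinv t)"
      using M.inv_mult_group[of t t] st by (simp add: inv_Mgrp tcomp_Mt)
    moreover have "tcomp (tcomp s s) (tcomp (tcomp ?u ?u) (tcomp (tinv t) (tinv t))) = tcomm s t"
      using p by (simp add: tcomm_def tcomp_assoc[of _ n] tcomp_perfect tinv_perfect cancel)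
    ultimately show ?thesis by (simp only:)
  qed
  have V: "fibre n 1 0 0 \<subseteq> H"
    by (rule fibre_one_subset_of_commutators) (use mult inv comm fibre_subset in blast)+
  have d8: "(8::int) dvd 2 ^ (Suc n div 2)"
  proof -
    have "3 \<le> Suc n div 2" using n by linarith
    then show ?thesis using le_imp_power_dvd[of 3 "Suc n div 2" "2::int"] by simp
  qed
  have d2: "(2::int) dvd 2 ^ (Suc n div 2)" "(2::int) dvd 2 ^ (n div 2)"
    using n by (auto intro!: dvd_power)
  have "Mt n \<subseteq> H"
  proof
    fix s assume s: "s \<in> Mt n"
    obtain h where h: "h \<in> K" and hs: "[Pt h = Pt s] (mod 8)" "[Qt h = Qt s] (mod 2)" "[Rt h = Rt s] (mod 2)"
      using res[OF odd_Pt[of s], of "Qt s" "Rt s"] by blast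
    have hH: "h \<in> H" and hM: "h \<in> Mt n" using h H(2) HM by auto
    define s' where "s' = tcomp s (tinv h)"
    have s': "s' \<in> Mt n" using s hM by (simp add: s'_def tcomp_Mt tinv_Mt)
    have ss': "s = tcomp s' h"
      using s hM tcomp_tinv_left[of h n]
      by (simp add: s'_def tcomp_assoc[of _ n] Mt_perfect tinv_perfect)
    define p q r where "p = Pt s'" and "q = Qt s'" and "r = Rt s'"
    have P: "[p = 1] (mod 8)"
    proof -
      have "[p * Pt h = Pt s] (mod 8)"
        using cong_dvd_modulus[OF Pt_tcomp[OF s' hM] d8] unfolding ss'[symmetric] p_def by (rule cong_sym)
      also have "[Pt s = 1 * Pt h] (mod 8)" using hs(1) by (simp add: cong_sym)
      finally have "[p * Pt h = 1 * Pt h] (mod 2 ^ 3)" by simp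
      then show ?thesis unfolding cong_mult_odd_cancel[OF odd_Pt] by simp
    qed
    have oddp: "odd p" by (simp add: p_def odd_Pt)
    have even: "even x" if "[a = x + p * b] (mod 2)" "[b = a] (mod 2)" for x a b
    proof -
      have "even (a - (x + p * b))" "even (b - a)" using that by (simp_all add: cong_iff_dvd_diff)
      then show ?thesis using oddp by auto
    qed
    have "even q" unfolding q_def
      by (rule even[OF cong_dvd_modulus[OF Qt_tcomp[OF s' hM, folded p_def] d2(1), folded ss'] hs(2)])
    moreover have "even r" unfolding r_def
      by (rule even[OF cong_dvd_modulus[OF Rt_tcomp[OF s' hM, folded p_def] d2(2), folded ss'] hs(3)])
    ultimately obtain q' r' where qr: "q = 2 * q'" "r = 2 * r'" by (auto elim!: evenE)
    obtain v where v: "odd v" "[v * v = p] (mod 2 ^ (Suc n div 2))"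
      using odd_square_root_mod_pow2[OF P] by blast
    obtain x where x: "x \<in> fibre n v 0 0" using fibre_nonempty[OF v(1)] by blast
    obtain y where y: "y \<in> fibre n 1 q' r'" using fibre_nonempty[OF odd_one] by blast
    \<comment> \<open>By the cocycle formulas \<open>y y\<close> has the values
      \<open>(1, q, r)\<close> and \<open>x x\<close> has \<open>(v * v, 0, 0)\<close>, so
      \<open>z\<close> lies in the fibre of \<open>s'\<close>.\<close>
    define z where "z = tcomp (tcomp y y) (tcomp x x)"
    have "z \<in> fibre n (v * v) q r"
      using fibre_tcomp[OF fibre_tcomp[OF y y] fibre_tcomp[OF x x]] by (simp add: z_def qr)
    then have z: "z \<in> fibre n p q r" using v(2) unfolding fibre_def by (auto intro: cong_trans)
    have zH: "z \<in> H" unfolding z_def using x y fibre_subset by (intro mult sq) blast+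
    have "s' \<in> fibre n p q r" using s' by (simp add: fibre_def p_def q_def r_def)
    from fibre_diff[OF oddp this z] have "tcomp s' (tinv z) \<in> H" using V by blast
    from mult[OF this zH] have "s' \<in> H"
      using s' zH HM tcomp_tinv_left[of z n]
      by (simp add: tcomp_assoc[of _ n] Mt_perfect tinv_perfect subset_iff)
    from mult[OF this hH] show "s \<in> H" by (simp add: ss')
  qed
  then show False using HM H(3) by blast
qed

section \<open>Automorphisms of the tree of words\<close>

lemma all_letter: "(\<forall>c. P c) \<longleftrightarrow> P LA \<and> P LB"
  by (metis letter.exhaust)

definition flip_letter :: "bool \<Rightarrow> letter \<Rightarrow> letter" where
  "flip_letter e c = (if e then (case c of LA \<Rightarrow> LB | LB \<Rightarrow> LA) else c)"

lemma flip_letter_simps [simp]: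
  "flip_letter False c = c" "flip_letter True LA = LB" "flip_letter True LB = LA"
  by (simp_all add: flip_letter_def)

lemma UNIV_letter: "(UNIV :: letter set) = {LA, LB}"
  using letter.exhaust by blast

text \<open>Below the height of the portrait the letters are left alone, so one function serves both
  as an automorphism of \<open>T_n\<close> and as an extension of it to the infinite tree.\<close>

fun act :: "btree \<Rightarrow> word \<Rightarrow> word" where
  "act Leaf w = w"
| "act (Node e g h) [] = []"
| "act (Node e g h) (c # w) = flip_letter e c # act (case c of LA \<Rightarrow> g | LB \<Rightarrow> h) w"

lemma act_Nil [simp]: "act t [] = []"
  by (cases t) simp_all

lemma length_act [simp]: "length (act t w) = length w"
  by (induction t w rule: act.induct) simp_all

lemma act_snoc: "\<exists>d. act t (w @ [c]) = act t w @ [d]"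
proof (induction w arbitrary: t)
  case Nil
  show ?case by (cases t) simp_all
next
  case (Cons a w)
  show ?case by (cases t) (use Cons in simp_all)
qed

lemma act_tid [simp]: "act (tid n) w = w"
proof (induction n arbitrary: w)
  case (Suc n)
  then show ?case by (cases w) (auto split: letter.splits)
qed simp

lemma act_tcomp: "s \<in> perfect n \<Longrightarrow> t \<in> perfect n \<Longrightarrow> act (tcomp s t) w = act s (act t w)"
proof (induction n arbitrary: s t w)
  case (Suc n)
  obtain e g h where s: "s = Node e g h" "g \<in> perfect n" "h \<in> perfect n"
    using Suc.prems(1) by (rule perfect_SucE)
  obtain e' g' h' where t: "t = Node e' g' h'" "g' \<in> perfect n" "h' \<in> perfect n"
    using Suc.prems(2) by (rule perfect_SucE)
  show ?case
  proof (cases w)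
    case (Cons c v)
    then show ?thesis using Suc.IH s t by (cases c; cases e; cases e') simp_all
  qed simp
qed simp

lemma act_tinv: "t \<in> perfect n \<Longrightarrow> act (tinv t) (act t w) = w" "t \<in> perfect n \<Longrightarrow> act t (act (tinv t) w) = w"
  by (simp_all add: tcomp_tinv_left tcomp_tinv_right tinv_perfect flip: act_tcomp[of _ n])

lemma act_inject:
  "s \<in> perfect n \<Longrightarrow> t \<in> perfect n \<Longrightarrow> (\<And>w. length w \<le> n \<Longrightarrow> act s w = act t w) \<Longrightarrow> s = t"
proof (induction n arbitrary: s t)
  case (Suc n)
  obtain e g h where s: "s = Node e g h" "g \<in> perfect n" "h \<in> perfect n"
    using Suc.prems(1) by (rule perfect_SucE)
  obtain e' g' h' where t: "t = Node e' g' h'" "g' \<in> perfect n" "h' \<in> perfect n"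
    using Suc.prems(2) by (rule perfect_SucE)
  have "e = e'" using Suc.prems(3)[of "[LA]"] by (cases e; cases e') (simp_all add: s t)
  moreover have "g = g'"
    by (rule Suc.IH[OF s(2) t(2)]) (use Suc.prems(3)[of "LA # w" for w] in \<open>simp add: s t\<close>)
  moreover have "h = h'"
    by (rule Suc.IH[OF s(3) t(3)]) (use Suc.prems(3)[of "LB # w" for w] in \<open>simp add: s t\<close>)
  ultimately show ?case by (simp add: s t)
qed simp

primrec portrait :: "nat \<Rightarrow> (word \<Rightarrow> bool) \<Rightarrow> word \<Rightarrow> btree" where
  "portrait 0 \<pi> x = Leaf"
| "portrait (Suc d) \<pi> x = Node (\<pi> x) (portrait d \<pi> (x @ [LA])) (portrait d \<pi> (x @ [LB]))"

lemma portrait_perfect [simp]: "portrait d \<pi> x \<in> perfect d"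
  by (induction d arbitrary: x) simp_all

lemma portrait_cong:
  "(\<And>w. length w < length x + d \<Longrightarrow> \<pi> w = \<pi>' w) \<Longrightarrow> portrait d \<pi> x = portrait d \<pi>' x"
proof (induction d arbitrary: x)
  case (Suc d)
  have "portrait d \<pi> (x @ [c]) = portrait d \<pi>' (x @ [c])" for c
    by (rule Suc.IH, rule Suc.prems) simp
  then show ?case using Suc.prems[of x] by simp
qed simp

lemma trunc_portrait: "n \<le> m \<Longrightarrow> trunc n (portrait m \<pi> x) = portrait n \<pi> x"
proof (induction n arbitrary: m x)
  case (Suc n)
  then show ?case by (cases m) simp_all
qed simp

text \<open>The recursion of \<open>Mt\<close> unfolds to the condition on all nodes: a descendant
  is compared with the root one edge at a time, and each comparison survives reduction to the
  smaller modulus further down.\<close>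

lemma portrait_in_Mt:
  "portrait d \<pi> x \<in> Mt d \<longleftrightarrow> (\<forall>u. length u \<le> d \<longrightarrow>
     [Pt (portrait (d - length u) \<pi> (x @ u)) = Pt (portrait d \<pi> x)] (mod 2 ^ (Suc (d - length u) div 2)))"
proof (induction d arbitrary: x)
  case (Suc d)
  let ?t = "portrait (Suc d) \<pi> x"
  have Node: "?t = Node (\<pi> x) (portrait d \<pi> (x @ [LA])) (portrait d \<pi> (x @ [LB]))" by simp
  let ?C = "\<lambda>u. [Pt (portrait (Suc d - length u) \<pi> (x @ u)) = Pt ?t] (mod 2 ^ (Suc (Suc d - length u) div 2))"
  have mem: "?t \<in> Mt (Suc d) \<longleftrightarrow> (\<forall>c. portrait d \<pi> (x @ [c]) \<in> Mt d \<and> ?C [c])"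
    unfolding Node Node_in_Mt all_letter by (auto simp del: Pt.simps)
  have step: "?C (c # u) \<longleftrightarrow>
      [Pt (portrait (d - length u) \<pi> ((x @ [c]) @ u)) = Pt (portrait d \<pi> (x @ [c]))] (mod 2 ^ (Suc (d - length u) div 2))"
    if "?C [c]" for c u
  proof -
    have "[Pt (portrait d \<pi> (x @ [c])) = Pt ?t] (mod 2 ^ (Suc d div 2))" using that by simp
    then have "[Pt (portrait d \<pi> (x @ [c])) = Pt ?t] (mod 2 ^ (Suc (d - length u) div 2))"
      by (rule cong_pow_le) (simp add: div_le_mono)
    then have eq: "Pt (portrait d \<pi> (x @ [c])) mod 2 ^ (Suc (d - length u) div 2) =
        Pt ?t mod 2 ^ (Suc (d - length u) div 2)"
      by (simp only: cong_def)
    have idx: "Suc d - length (c # u) = d - length u" "x @ c # u = (x @ [c]) @ u" by simp_all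
    show ?thesis unfolding cong_def idx eq ..
  qed
  show ?case
  proof
    assume t: "?t \<in> Mt (Suc d)"
    show "\<forall>u. length u \<le> Suc d \<longrightarrow> ?C u"
    proof (intro allI impI)
      fix u :: word assume u: "length u \<le> Suc d"
      show "?C u"
      proof (cases u)
        case (Cons c v)
        have c: "?C [c]" "portrait d \<pi> (x @ [c]) \<in> Mt d" using t mem by blast+
        show ?thesis unfolding Cons step[OF c(1)] using c(2) Suc.IH[of "x @ [c]"] u Cons by auto
      qed simp
    qed
  next
    assume *: "\<forall>u. length u \<le> Suc d \<longrightarrow> ?C u"
    show "?t \<in> Mt (Suc d)" unfolding mem
    proof
      fix c
      have c: "?C [c]" using *[rule_format, of "[c]"] by simp
      moreover have "portrait d \<pi> (x @ [c]) \<in> Mt d"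
        unfolding Suc.IH using *[rule_format, of "c # u" for u] step[OF c] by simp
      ultimately show "portrait d \<pi> (x @ [c]) \<in> Mt d \<and> ?C [c]" by blast
    qed
  qed
qed simp

definition flips :: "(word \<Rightarrow> word) \<Rightarrow> word \<Rightarrow> bool" where
  "flips \<sigma> w \<longleftrightarrow> Par \<sigma> w = 1"

lemma Par_flips: "Par \<sigma> w = of_bool (flips \<sigma> w)"
  by (simp add: flips_def Par_def)

text \<open>Only the values on words of length at most \<open>n\<close> matter, so this covers automorphisms both of
  \<open>T\<^sub>n\<close> and of \<open>T\<^sub>\<infinity>\<close>.\<close>
definition tree_map :: "nat \<Rightarrow> (word \<Rightarrow> word) \<Rightarrow> bool" where
  "tree_map n \<sigma> \<longleftrightarrow> \<sigma> [] = [] \<and>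
     (\<forall>w c. length w < n \<longrightarrow> \<sigma> (w @ [c]) = \<sigma> w @ [flip_letter (flips \<sigma> w) c])"

lemma tautI:
  assumes inj: "inj_on \<sigma> {w. length w \<le> n}" and root: "\<sigma> [] = []"
    and child: "\<And>w c. length w < n \<Longrightarrow> \<exists>d. \<sigma> (w @ [c]) = \<sigma> w @ [d]"
  shows "tree_map n \<sigma>"
  unfolding tree_map_def
proof (intro conjI allI impI root)
  fix w :: word and c assume w: "length w < n"
  obtain d where d: "\<sigma> (w @ [LA]) = \<sigma> w @ [d]" using child[OF w] by blast
  obtain d' where d': "\<sigma> (w @ [LB]) = \<sigma> w @ [d']" using child[OF w] by blast
  have "d \<noteq> d'"
  proof
    assume "d = d'"
    then have "\<sigma> (w @ [LA]) = \<sigma> (w @ [LB])" using d d' by simp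
    then show False using w by (auto dest!: inj_onD[OF inj])
  qed
  then show "\<sigma> (w @ [c]) = \<sigma> w @ [flip_letter (flips \<sigma> w) c]"
    by (cases d; cases d'; cases c) (simp_all add: flips_def Par_def d d')
qed

text \<open>Adjacency alone would allow an edge to be mapped towards the root. The only neighbour in
  that direction of the image of \<open>v b\<close> is the image of \<open>v\<close>, which
  injectivity has already taken.\<close>

lemma tree_map_of_adjacent:
  assumes inj: "inj_on \<sigma> {w. length w \<le> n}" and root: "\<sigma> [] = []"
    and adj: "\<And>w c. length w < n \<Longrightarrow> \<exists>d. \<sigma> (w @ [c]) = \<sigma> w @ [d] \<or> \<sigma> w = \<sigma> (w @ [c]) @ [d]"
  shows "tree_map n \<sigma>"
proof (rule tautI[OF inj root])
  fix w :: word and c assume "length w < n"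
  then show "\<exists>d. \<sigma> (w @ [c]) = \<sigma> w @ [d]"
  proof (induction w arbitrary: c rule: rev_induct)
    case Nil
    then show ?case using adj[of "[]" c] root by auto
  next
    case (snoc b v)
    then obtain d where d: "\<sigma> (v @ [b]) = \<sigma> v @ [d]" by fastforce
    obtain d' where d': "\<sigma> ((v @ [b]) @ [c]) = \<sigma> (v @ [b]) @ [d'] \<or> \<sigma> (v @ [b]) = \<sigma> ((v @ [b]) @ [c]) @ [d']"
      using adj[OF snoc.prems] by blast
    have "\<sigma> ((v @ [b]) @ [c]) \<noteq> \<sigma> v"
      using inj_onD[OF inj, of "(v @ [b]) @ [c]" v] snoc.prems by auto
    then have "\<sigma> (v @ [b]) \<noteq> \<sigma> ((v @ [b]) @ [c]) @ [d']" using d by auto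
    then show ?case using d' by blast
  qed
qed

lemma tree_map_mono: "tree_map n \<sigma> \<Longrightarrow> m \<le> n \<Longrightarrow> tree_map m \<sigma>"
  by (simp add: tree_map_def)

lemma tree_map_portrait:
  "tree_map n \<sigma> \<Longrightarrow> length x + length u \<le> n \<Longrightarrow> length u \<le> d \<Longrightarrow>
     \<sigma> (x @ u) = \<sigma> x @ act (portrait d (flips \<sigma>) x) u"
proof (induction d arbitrary: x u)
  case (Suc d)
  show ?case
  proof (cases u)
    case (Cons c v)
    have "\<sigma> ((x @ [c]) @ v) = \<sigma> (x @ [c]) @ act (portrait d (flips \<sigma>) (x @ [c])) v"
      using Suc.prems Cons by (intro Suc.IH) auto
    also have "\<sigma> (x @ [c]) = \<sigma> x @ [flip_letter (flips \<sigma> x) c]"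
      using Suc.prems Cons by (simp add: tree_map_def)
    finally show ?thesis using Cons by (cases c) simp_all
  qed simp
qed simp

lemma tree_map_eq_act: "tree_map n \<sigma> \<Longrightarrow> length w \<le> n \<Longrightarrow> \<sigma> w = act (portrait n (flips \<sigma>) []) w"
  using tree_map_portrait[of n \<sigma> "[]" w n] by (simp add: tree_map_def)

lemma act_inj: "t \<in> perfect n \<Longrightarrow> inj (act t)"
  by (rule inj_on_inverseI[of _ "act (tinv t)"]) (simp add: act_tinv(1))

lemma tree_map_act: "t \<in> perfect n \<Longrightarrow> tree_map m (act t)"
  by (rule tautI) (auto intro: inj_on_subset[OF act_inj] act_snoc)

lemma portrait_act: "t \<in> perfect n \<Longrightarrow> portrait n (flips (act t)) [] = t"
  by (rule act_inject[of _ n]) (simp_all add: tree_map_eq_act[OF tree_map_act[of t n n], symmetric])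

definition wact :: "nat \<Rightarrow> btree \<Rightarrow> word \<Rightarrow> word" where
  "wact n t = restrict (act t) {w. length w \<le> n}"

lemma nodes_word_tree [simp]:
  "nodes word_tree = UNIV" "nodes (word_tree_upto n) = {w. length w \<le> n}"
  "root word_tree = []" "root (word_tree_upto n) = []"
  "adjacent word_tree u v \<longleftrightarrow> (\<exists>c. v = u @ [c] \<or> u = v @ [c])"
  "adjacent (word_tree_upto n) u v \<longleftrightarrow> (\<exists>c. v = u @ [c] \<or> u = v @ [c])"
  by (simp_all add: word_tree_def word_tree_upto_def)

lemma act_adjacent:
  assumes t: "t \<in> perfect n"
  shows "adjacent word_tree (act t u) (act t v) \<longleftrightarrow> adjacent word_tree u v"
proof -
  have *: "adjacent word_tree (act s u) (act s v)" if "adjacent word_tree u v" for s u v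
    using that act_snoc[of s u] act_snoc[of s v] by auto
  show ?thesis using *[of u v t] *[of "act t u" "act t v" "tinv t"] t by (auto simp: act_tinv simp del: nodes_word_tree)
qed

lemma act_tree_aut: "t \<in> perfect n \<Longrightarrow> act t \<in> tree_aut word_tree"
proof -
  assume t: "t \<in> perfect n"
  have "bij (act t)"
    by (rule bij_betw_byWitness[where f' = "act (tinv t)"]) (simp_all add: act_tinv[OF t])
  then show ?thesis
    using act_adjacent[OF t] by (simp add: tree_aut_def tree_iso_def Bij_def del: nodes_word_tree(5,6))
qed

lemma wact_tree_aut: "t \<in> perfect n \<Longrightarrow> wact n t \<in> tree_aut (word_tree_upto n)"
proof -
  assume t: "t \<in> perfect n"
  have "bij_betw (wact n t) {w. length w \<le> n} {w. length w \<le> n}"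
    by (rule bij_betw_byWitness[where f' = "act (tinv t)"]) (auto simp: act_tinv[OF t] wact_def)
  moreover have "wact n t \<in> extensional {w. length w \<le> n}" "wact n t [] = []" by (simp_all add: wact_def)
  moreover have "adjacent (word_tree_upto n) (wact n t u) (wact n t v) \<longleftrightarrow> adjacent (word_tree_upto n) u v"
    if "length u \<le> n" "length v \<le> n" for u v
    using that act_adjacent[OF t, of u v] by (simp add: wact_def)
  ultimately show ?thesis
    by (simp add: tree_aut_def tree_iso_def Bij_def del: nodes_word_tree(5,6))
qed

lemma tree_aut_word_tree_tree_map:
  assumes "\<sigma> \<in> tree_aut word_tree"
  shows "tree_map n \<sigma>"
proof (rule tree_map_of_adjacent)
  show "inj_on \<sigma> {w. length w \<le> n}" "\<sigma> [] = []"
    using assms by (auto simp: tree_aut_def tree_iso_def bij_betw_def intro: inj_on_subset)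
  fix w :: word and c
  have "adjacent word_tree w (w @ [c])" by simp
  then have "adjacent word_tree (\<sigma> w) (\<sigma> (w @ [c]))"
    using assms by (simp add: tree_aut_def tree_iso_def del: nodes_word_tree(5))
  then show "\<exists>d. \<sigma> (w @ [c]) = \<sigma> w @ [d] \<or> \<sigma> w = \<sigma> (w @ [c]) @ [d]" by simp
qed

lemma tree_aut_upto_tree_map:
  assumes "\<sigma> \<in> tree_aut (word_tree_upto n)"
  shows "tree_map n \<sigma>"
proof (rule tree_map_of_adjacent)
  show "inj_on \<sigma> {w. length w \<le> n}" "\<sigma> [] = []"
    using assms by (auto simp: tree_aut_def tree_iso_def bij_betw_def)
  fix w :: word and c assume "length w < n"
  moreover have "adjacent (word_tree_upto n) w (w @ [c])" by simp
  ultimately have "adjacent (word_tree_upto n) (\<sigma> w) (\<sigma> (w @ [c]))"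
    using assms by (simp add: tree_aut_def tree_iso_def del: nodes_word_tree(6))
  then show "\<exists>d. \<sigma> (w @ [c]) = \<sigma> w @ [d] \<or> \<sigma> w = \<sigma> (w @ [c]) @ [d]" by simp
qed

lemma wact_portrait: "\<sigma> \<in> tree_aut (word_tree_upto n) \<Longrightarrow> wact n (portrait n (flips \<sigma>) []) = \<sigma>"
  by (rule extensionalityI[of _ "{w. length w \<le> n}"])
    (auto simp: wact_def tree_aut_def Bij_def tree_map_eq_act[OF tree_aut_upto_tree_map, symmetric])

lemma flips_eq:
  "length w < n \<Longrightarrow> (\<And>w. length w \<le> n \<Longrightarrow> \<sigma> w = \<tau> w) \<Longrightarrow> flips \<sigma> w = flips \<tau> w"
  by (simp add: flips_def Par_def)

lemma portrait_wact: "t \<in> perfect n \<Longrightarrow> portrait n (flips (wact n t)) [] = t"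
  using portrait_cong[of "[]" n "flips (wact n t)" "flips (act t)"] flips_eq[of _ n "wact n t" "act t"] portrait_act[of t n]
  by (simp add: wact_def)

lemma inj_on_wact: "inj_on (wact n) (perfect n)"
  by (rule inj_on_inverseI[of _ "\<lambda>\<sigma>. portrait n (flips \<sigma>) []"]) (rule portrait_wact)

section \<open>The 2-adic invariants\<close>

lemma residue2_add: "residue2 (x + y) k = (residue2 x k + residue2 y k) mod 2 ^ k"
  and residue2_mult: "residue2 (x * y) k = (residue2 x k * residue2 y k) mod 2 ^ k"
  and residue2_diff: "residue2 (x - y) k = (residue2 x k - residue2 y k) mod 2 ^ k"
  by (simp_all add: plus_zint2.rep_eq times_zint2.rep_eq minus_zint2.rep_eq)

lemma residue2_of_nat: "residue2 (of_nat m) k = int m mod 2 ^ k"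
proof (induction m)
  case 0
  show ?case by (simp add: zero_zint2.rep_eq)
next
  case (Suc m)
  then show ?case by (simp add: residue2_add one_zint2.rep_eq mod_simps)
qed

text \<open>A factor 2 makes one further bit known.\<close>

lemma residue2_double:
  assumes "residue2 a k = A mod 2 ^ k"
  shows "residue2 (2 * a) (Suc k) = 2 * A mod 2 ^ Suc k"
proof -
  have "residue2 a (Suc k) mod 2 ^ k = A mod 2 ^ k"
    using residue2_mod[of k "Suc k" a] assms by simp
  then have "[2 * residue2 a (Suc k) = 2 * A] (mod 2 ^ Suc k)"
    unfolding cong_double_iff by (simp add: cong_def)
  moreover have "residue2 (2 * a) (Suc k) = 2 * residue2 a (Suc k) mod 2 ^ Suc k"
    using residue2_mult[of 2 a "Suc k"] residue2_of_nat[of 2 "Suc k"] by (simp add: mod_simps)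
  ultimately show ?thesis by (simp add: cong_def)
qed

text \<open>The residues of the partial sums are constant from index \<open>k\<close> on, and a
  residue class is open, so the limit shares that residue.\<close>

lemma residue2_suminf: "residue2 (\<Sum>i. 2 ^ i * a i) k = residue2 (\<Sum>i<k. 2 ^ i * a i) k"
proof -
  have tail: "residue2 (2 ^ i * a i) k = 0" if "k \<le> i" for i
    using that residue2_mult[of "2 ^ i" "a i" k] residue2_of_nat[of "2 ^ i" k]
    by (simp add: le_imp_power_dvd)
  have stab: "residue2 (\<Sum>i<n. 2 ^ i * a i) k = residue2 (\<Sum>i<k. 2 ^ i * a i) k" if "k \<le> n" for n
    using that
  proof (induction n rule: dec_induct)
    case (step n)
    then show ?case
      using residue2_mod[of k k "\<Sum>i<k. 2 ^ i * a i"] by (simp add: residue2_add tail)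
  qed simp
  let ?s = "\<Sum>i. 2 ^ i * a i"
  have "(\<lambda>n. \<Sum>i<n. 2 ^ i * a i) \<longlonglongrightarrow> ?s"
    using summable_sums[OF summable_zint2] by (simp add: sums_def)
  moreover have "open {y. residue2 y k = residue2 ?s k}"
    unfolding open_zint2_def by (auto intro: exI[of _ k])
  ultimately have "\<forall>\<^sub>F n in sequentially. residue2 (\<Sum>i<n. 2 ^ i * a i) k = residue2 ?s k"
    by (auto dest!: topological_tendstoD)
  from eventually_happens'[OF sequentially_bot eventually_conj[OF this eventually_ge_at_top[of k]]]
  obtain n where n: "residue2 (\<Sum>i<n. 2 ^ i * a i) k = residue2 ?s k" "k \<le> n"
    by blast
  then show ?thesis using stab[OF n(2)] by simp
qed

definition Q_sum :: "(word \<Rightarrow> word) \<Rightarrow> nat \<Rightarrow> word \<Rightarrow> nat" where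
  "Q_sum \<sigma> k x = (\<Sum>i<k. 2 ^ i *
     (\<Sum>s\<in>{s. length s = i}. Par \<sigma> (x @ concat (map (\<lambda>t. [LA, t]) s))))"

lemma residue2_Q_value: "residue2 (Q_value \<sigma> x) k = int (Q_sum \<sigma> k x) mod 2 ^ k"
  using residue2_of_nat[of "Q_sum \<sigma> k x" k]
  by (simp add: Q_value_def residue2_suminf Q_sum_def)

lemma lists_Suc: "{s :: letter list. length s = Suc i} = (\<lambda>(t, s). t # s) ` ({LA, LB} \<times> {s. length s = i})"
  by (auto simp: length_Suc_conv image_iff UNIV_letter[symmetric])

lemma finite_words [simp]: "finite {s :: letter list. length s = i}"
  by (induction i) (simp_all add: lists_Suc)

lemma sum_lists_Suc:
  fixes f :: "letter list \<Rightarrow> 'a :: comm_monoid_add"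
  shows "(\<Sum>s\<in>{s. length s = Suc i}. f s) =
    (\<Sum>s\<in>{s. length s = i}. f (LA # s)) + (\<Sum>s\<in>{s. length s = i}. f (LB # s))"
proof -
  have "(\<Sum>s\<in>{s. length s = Suc i}. f s) = (\<Sum>(t, s)\<in>{LA, LB} \<times> {s. length s = i}. f (t # s))"
    unfolding lists_Suc by (subst sum.reindex) (auto simp: inj_on_def case_prod_beta intro!: sum.cong)
  also have "\<dots> = (\<Sum>t\<in>{LA, LB}. \<Sum>s\<in>{s. length s = i}. f (t # s))"
    by (simp add: sum.cartesian_product)
  finally show ?thesis by simp
qed

lemma Q_sum_Suc:
  "Q_sum \<sigma> (Suc k) x = Par \<sigma> x + 2 * (Q_sum \<sigma> k (x @ [LA, LA]) + Q_sum \<sigma> k (x @ [LA, LB]))"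
proof -
  have "Q_sum \<sigma> (Suc k) x = Par \<sigma> x + (\<Sum>i<k. 2 ^ Suc i *
     (\<Sum>s\<in>{s. length s = Suc i}. Par \<sigma> (x @ concat (map (\<lambda>t. [LA, t]) s))))"
    unfolding Q_sum_def by (subst sum.lessThan_Suc_shift) simp
  also have "\<dots> = Par \<sigma> x + 2 * (Q_sum \<sigma> k (x @ [LA, LA]) + Q_sum \<sigma> k (x @ [LA, LB]))"
    unfolding Q_sum_def sum_lists_Suc
    by (simp add: sum.distrib sum_distrib_left algebra_simps)
  finally show ?thesis .
qed

text \<open>The lowest bit of \<open>Q\<close> needs one level and every further bit two more,
  whence \<open>2 * k \<le> Suc d\<close>.\<close>

lemma Qt_portrait: "2 * k \<le> Suc d \<Longrightarrow> [Qt (portrait d (flips \<sigma>) x) = int (Q_sum \<sigma> k x)] (mod 2 ^ k)"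
proof (induction k arbitrary: d x)
  case (Suc k)
  show ?case
  proof (cases "k = 0")
    case True
    obtain d' where d': "d = Suc d'" using Suc.prems by (cases d) auto
    have "[int (Par \<sigma> x) + 2 * Rt (portrait d' (flips \<sigma>) (x @ [LA])) = int (Par \<sigma> x)] (mod 2)"
      by (simp add: cong_def)
    then show ?thesis by (simp add: d' True Q_sum_def Par_flips)
  next
    case False
    then obtain d' where d': "d = Suc (Suc d')" "2 * k \<le> Suc d'"
      using Suc.prems by (cases d; cases "d - 1") auto
    have "[Qt (portrait d' (flips \<sigma>) (x @ [LA, LA])) + Qt (portrait d' (flips \<sigma>) (x @ [LA, LB])) =
      int (Q_sum \<sigma> k (x @ [LA, LA]) + Q_sum \<sigma> k (x @ [LA, LB]))] (mod 2 ^ k)"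
      unfolding of_nat_add by (intro cong_add Suc.IH d'(2))
    from cong_add[OF cong_refl[of "int (Par \<sigma> x)"] cong_double[OF this]]
    show ?thesis by (simp add: d' Q_sum_Suc Par_flips algebra_simps)
  qed
qed simp

text \<open>The factor 2 in front of the sums of \<open>Q\<close> saves one bit: they are needed
  only modulo \<open>2 ^ (k - 1)\<close>, which the available levels determine.\<close>

lemma residue2_P_value:
  assumes k: "k \<le> Suc d div 2"
  shows "residue2 (P_value \<sigma> x) k = Pt (portrait d (flips \<sigma>) x) mod 2 ^ k"
proof (cases k)
  case 0
  then show ?thesis using residue2_mod[of 0 0] by simp
next
  case (Suc j)
  then obtain d' where d': "d = Suc d'" using k by (cases d) auto
  have j: "2 * j \<le> d'" using Suc k d' by simp
  have Q: "residue2 (\<Sum>t\<in>{LA, LB}. Q_value \<sigma> (x @ [c, t])) j = Rt (portrait d' (flips \<sigma>) (x @ [c])) mod 2 ^ j" for c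
  proof (cases d')
    case 0
    then show ?thesis using j residue2_mod[of 0 0] by simp
  next
    case (Suc d'')
    then have j': "2 * j \<le> Suc d''" using j by simp
    have "residue2 (\<Sum>t\<in>{LA, LB}. Q_value \<sigma> (x @ [c, t])) j =
        (int (Q_sum \<sigma> j (x @ [c, LA])) + int (Q_sum \<sigma> j (x @ [c, LB]))) mod 2 ^ j"
      by (simp add: residue2_add residue2_Q_value mod_simps)
    also have "\<dots> = Rt (portrait d' (flips \<sigma>) (x @ [c])) mod 2 ^ j"
      using cong_add[OF Qt_portrait[OF j', of \<sigma> "x @ [c, LA]"] Qt_portrait[OF j', of \<sigma> "x @ [c, LB]"]]
      by (simp add: Suc cong_def)
    finally show ?thesis .
  qed
  have sgn: "residue2 ((-1) ^ Par \<sigma> x) k = (1 - 2 * of_bool (flips \<sigma> x)) mod 2 ^ k"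
    using residue2_of_nat[of 1 k] residue2_diff[of 0 1 k] residue2_of_nat[of 0 k]
    by (auto simp: Par_flips mod_simps)
  show ?thesis
    unfolding P_value_def residue2_diff residue2_add Suc sgn[unfolded Suc] residue2_double[OF Q]
    by (simp add: d' mod_simps del: power_Suc)
qed

lemma extends_to_act: "t \<in> perfect n \<Longrightarrow> extends_to n (wact n t) (act t)"
  by (simp add: extends_to_def act_tree_aut wact_def)

text \<open>The extension picked by \<open>SOME\<close> does not matter: the portrait of height
  \<open>n - length x\<close> at \<open>x\<close> reads flips only at words shorter than
  \<open>n\<close>, where all extensions agree.\<close>

lemma P_value_upto_wact:
  assumes t: "t \<in> perfect n" and x: "length x \<le> n"
  shows "P_value_upto n (wact n t) x =
    Pt (portrait (n - length x) (flips (wact n t)) x) mod 2 ^ ((n - length x + 1) div 2)"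
proof -
  define \<sigma> where "\<sigma> = (SOME \<sigma>. extends_to n (wact n t) \<sigma>)"
  have "extends_to n (wact n t) \<sigma>"
    unfolding \<sigma>_def by (rule someI[of _ "act t"]) (rule extends_to_act[OF t])
  then have "portrait (n - length x) (flips \<sigma>) x = portrait (n - length x) (flips (wact n t)) x"
    using x by (intro portrait_cong flips_eq[of _ n]) (auto simp: extends_to_def)
  then show ?thesis
    unfolding P_value_upto_def \<sigma>_def[symmetric]
    using residue2_P_value[of "(n - length x + 1) div 2" "n - length x" \<sigma> x] by simp
qed

lemma carrier_M_group: "carrier (M_group n) = wact n ` Mt n"
proof -
  have *: "wact n t \<in> carrier (M_group n) \<longleftrightarrow> t \<in> Mt n" if t: "t \<in> perfect n" for t
  proof -
    let ?\<pi> = "flips (wact n t)"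
    have "P_value_upto n (wact n t) x mod 2 ^ ((n - length x + 1) div 2)
            = P_value_upto n (wact n t) [] mod 2 ^ ((n - length x + 1) div 2) \<longleftrightarrow>
      [Pt (portrait (n - length x) ?\<pi> ([] @ x)) = Pt (portrait n ?\<pi> [])] (mod 2 ^ (Suc (n - length x) div 2))"
      if "length x \<le> n" for x
    proof -
      have "(2::int) ^ (Suc (n - length x) div 2) dvd 2 ^ (Suc n div 2)"
        by (intro le_imp_power_dvd div_le_mono) simp
      then show ?thesis
        using that P_value_upto_wact[OF t, of x] P_value_upto_wact[OF t, of "[]"]
        by (simp add: cong_def mod_mod_cancel)
    qed
    then have "wact n t \<in> carrier (M_group n) \<longleftrightarrow> portrait n ?\<pi> [] \<in> Mt n"
      unfolding portrait_in_Mt using wact_tree_aut[OF t] by (auto simp: M_group_def)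
    then show ?thesis by (simp add: portrait_wact[OF t])
  qed
  show ?thesis
  proof (intro equalityI subsetI)
    fix \<sigma> assume \<sigma>: "\<sigma> \<in> carrier (M_group n)"
    then have "wact n (portrait n (flips \<sigma>) []) = \<sigma>" by (intro wact_portrait) (simp add: M_group_def)
    with \<sigma> *[of "portrait n (flips \<sigma>) []"] show "\<sigma> \<in> wact n ` Mt n" by (metis portrait_perfect imageI)
  next
    fix \<sigma> assume "\<sigma> \<in> wact n ` Mt n"
    then show "\<sigma> \<in> carrier (M_group n)" using * Mt_perfect by auto
  qed
qed

text \<open>Equality of 2-adic integers is congruence to every precision, and every precision is
  visible at some finite height; so membership is tested on all truncations.\<close>

lemma carrier_M_group_infinity:
  "carrier M_group_infinity = {\<sigma> \<in> tree_aut word_tree. \<forall>n. portrait n (flips \<sigma>) [] \<in> Mt n}"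
proof -
  have "(\<forall>x. P_value \<sigma> x = P_value \<sigma> []) \<longleftrightarrow> (\<forall>n. portrait n (flips \<sigma>) [] \<in> Mt n)" for \<sigma>
  proof
    assume *: "\<forall>x. P_value \<sigma> x = P_value \<sigma> []"
    show "\<forall>n. portrait n (flips \<sigma>) [] \<in> Mt n"
      unfolding portrait_in_Mt
    proof (intro allI impI)
      fix n and u :: word assume u: "length u \<le> n"
      let ?k = "Suc (n - length u) div 2"
      have "?k \<le> Suc n div 2" by (rule div_le_mono) simp
      then show "[Pt (portrait (n - length u) (flips \<sigma>) ([] @ u)) = Pt (portrait n (flips \<sigma>) [])] (mod 2 ^ ?k)"
        using residue2_P_value[of ?k "n - length u" \<sigma> u] residue2_P_value[of ?k n \<sigma> "[]"] *[rule_format, of u]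
        by (simp add: cong_def)
    qed
  next
    assume *: "\<forall>n. portrait n (flips \<sigma>) [] \<in> Mt n"
    show "\<forall>x. P_value \<sigma> x = P_value \<sigma> []"
    proof
      fix x
      have "residue2 (P_value \<sigma> x) k = residue2 (P_value \<sigma> []) k" for k
      proof -
        \<comment> \<open>\<open>2 * k\<close> levels below \<open>x\<close> suffice to read off
          \<open>P\<close> at \<open>x\<close> modulo \<open>2 ^ k\<close>.\<close>
        let ?n = "length x + 2 * k"
        have "[Pt (portrait (2 * k) (flips \<sigma>) x) = Pt (portrait ?n (flips \<sigma>) [])] (mod 2 ^ k)"
          using *[unfolded portrait_in_Mt, rule_format, of x ?n] by simp
        then show ?thesis
          using residue2_P_value[of k "2 * k" \<sigma> x] residue2_P_value[of k ?n \<sigma> "[]"]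
          by (simp add: cong_def)
      qed
      then show "P_value \<sigma> x = P_value \<sigma> []" by (metis ext residue2_inject)
    qed
  qed
  then show ?thesis by (simp add: M_group_infinity_def)
qed

section \<open>Towers of square roots\<close>

lemma rta_simps [simp]:
  "carrier (ring_of_type_algebra :: 'a :: field ring) = UNIV"
  "x \<otimes>\<^bsub>ring_of_type_algebra\<^esub> y = x * (y :: 'a)" "x \<oplus>\<^bsub>ring_of_type_algebra\<^esub> y = x + y"
  "\<one>\<^bsub>ring_of_type_algebra\<^esub> = (1 :: 'a)" "\<zero>\<^bsub>ring_of_type_algebra\<^esub> = (0 :: 'a)"
  by (simp_all add: ring_of_type_algebra_def)

interpretation rta: cring "ring_of_type_algebra :: 'a :: field ring"
  by (rule cring_from_type_algebra)

lemma rta_a_inv [simp]: "\<ominus>\<^bsub>ring_of_type_algebra\<^esub> x = - (x :: 'a :: field)"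
  by (rule rta.minus_equality) simp_all

lemma rta_m_inv [simp]: "x \<noteq> 0 \<Longrightarrow> inv\<^bsub>ring_of_type_algebra\<^esub> x = inverse (x :: 'a :: field)"
  by (rule rta.inv_char) simp_all

abbreviation sfield :: "'a :: field set \<Rightarrow> bool" where
  "sfield F \<equiv> subfield F ring_of_type_algebra"

lemma sfieldI:
  fixes F :: "'a :: field set"
  assumes "1 \<in> F" "\<And>x y. x \<in> F \<Longrightarrow> y \<in> F \<Longrightarrow> x + y \<in> F" "\<And>x. x \<in> F \<Longrightarrow> - x \<in> F"
    "\<And>x y. x \<in> F \<Longrightarrow> y \<in> F \<Longrightarrow> x * y \<in> F" "\<And>x. x \<in> F \<Longrightarrow> x \<noteq> 0 \<Longrightarrow> inverse x \<in> F"
  shows "sfield F"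
proof (rule field.subfieldI'[OF field_from_type_algebra])
  show "subring F (ring_of_type_algebra :: 'a ring)"
    by (rule rta.subringI) (use assms in auto)
qed (use assms in auto)

lemma sfieldD:
  fixes F :: "'a :: field set"
  assumes "sfield F"
  shows "1 \<in> F" "0 \<in> F" "x \<in> F \<Longrightarrow> y \<in> F \<Longrightarrow> x + y \<in> F" "x \<in> F \<Longrightarrow> - x \<in> F"
    "x \<in> F \<Longrightarrow> y \<in> F \<Longrightarrow> x * y \<in> F" "x \<in> F \<Longrightarrow> inverse x \<in> F"
    "x \<in> F \<Longrightarrow> y \<in> F \<Longrightarrow> x - y \<in> F"
proof -
  note R = subfieldE(1)[OF assms]
  show one: "1 \<in> F" and zero: "0 \<in> F" and add: "x \<in> F \<Longrightarrow> y \<in> F \<Longrightarrow> x + y \<in> F"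
    and minus: "x \<in> F \<Longrightarrow> - x \<in> F" and "x \<in> F \<Longrightarrow> y \<in> F \<Longrightarrow> x * y \<in> F" for x y
    using subringE[OF R] by simp_all
  show "x \<in> F \<Longrightarrow> inverse x \<in> F"
    using rta.subfield_m_inv(1)[OF assms, of x] zero by (cases "x = 0") auto
  show "x \<in> F \<Longrightarrow> y \<in> F \<Longrightarrow> x - y \<in> F"
    using add[of x "- y"] minus[of y] by simp
qed

lemma sfield_power: "sfield F \<Longrightarrow> x \<in> F \<Longrightarrow> x ^ n \<in> F"
  by (induction n) (auto intro: sfieldD)

lemma sfield_adjoin: "sfield (adjoin F S)"
  unfolding adjoin_def by (rule field.generate_field_is_subfield[OF field_from_type_algebra]) simp

lemma adjoin_incl: "F \<subseteq> adjoin F S" "S \<subseteq> adjoin F S"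
  unfolding adjoin_def by (auto intro: generate_field.incl)

lemma adjoin_least: "sfield E \<Longrightarrow> F \<subseteq> E \<Longrightarrow> S \<subseteq> E \<Longrightarrow> adjoin F S \<subseteq> E"
  unfolding adjoin_def by (rule field.generate_field_min_subfield1[OF field_from_type_algebra]) auto

lemma adjoin_eqI:
  "sfield E \<Longrightarrow> F \<subseteq> E \<Longrightarrow> S \<subseteq> E \<Longrightarrow> E \<subseteq> adjoin F S \<Longrightarrow> adjoin F S = E"
  by (intro equalityI adjoin_least)

lemma adjoin_adjoin: "adjoin (adjoin F S) T = adjoin F (S \<union> T)"
proof (rule adjoin_eqI[OF sfield_adjoin])
  show "adjoin F S \<subseteq> adjoin F (S \<union> T)"
    using adjoin_incl[where F = F and S = "S \<union> T"] by (intro adjoin_least sfield_adjoin) auto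
  show "T \<subseteq> adjoin F (S \<union> T)" using adjoin_incl[where F = F and S = "S \<union> T"] by auto
  show "adjoin F (S \<union> T) \<subseteq> adjoin (adjoin F S) T"
    using adjoin_incl[where F = F and S = S] adjoin_incl[where F = "adjoin F S" and S = T]
    by (intro adjoin_least sfield_adjoin) blast+
qed

lemma adjoin_absorb: "sfield F \<Longrightarrow> S \<subseteq> F \<Longrightarrow> adjoin F S = F"
  using adjoin_incl[where F = F and S = S] by (intro adjoin_eqI) auto

text \<open>Embeddings over \<open>K\<close> into the ambient field, which need not map
  \<open>E\<close> to itself. Extensionality makes them countable objects and directly comparable
  with \<open>Gal\<close>.\<close>

definition Emb :: "'a :: field set \<Rightarrow> 'a set \<Rightarrow> ('a \<Rightarrow> 'a) set" where
  "Emb K E = {\<phi> \<in> extensional E.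
     (\<forall>x\<in>E. \<forall>y\<in>E. \<phi> (x + y) = \<phi> x + \<phi> y \<and> \<phi> (x * y) = \<phi> x * \<phi> y) \<and> (\<forall>x\<in>K. \<phi> x = x)}"

lemma EmbD:
  assumes "\<phi> \<in> Emb K E" "sfield K" "sfield E"
  shows "x \<in> E \<Longrightarrow> y \<in> E \<Longrightarrow> \<phi> (x + y) = \<phi> x + \<phi> y" "x \<in> E \<Longrightarrow> y \<in> E \<Longrightarrow> \<phi> (x * y) = \<phi> x * \<phi> y"
    "x \<in> K \<Longrightarrow> \<phi> x = x" "x \<in> E \<Longrightarrow> \<phi> (- x) = - \<phi> x" "x \<in> E \<Longrightarrow> \<phi> (inverse x) = inverse (\<phi> x)"
    "x \<in> E \<Longrightarrow> y \<in> E \<Longrightarrow> \<phi> x = \<phi> y \<Longrightarrow> x = y" "x \<in> E \<Longrightarrow> \<phi> (x ^ n) = \<phi> x ^ n"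
    "x \<in> E \<Longrightarrow> \<phi> x = 0 \<Longrightarrow> x = 0"
proof -
  show add: "x \<in> E \<Longrightarrow> y \<in> E \<Longrightarrow> \<phi> (x + y) = \<phi> x + \<phi> y"
    and mult: "x \<in> E \<Longrightarrow> y \<in> E \<Longrightarrow> \<phi> (x * y) = \<phi> x * \<phi> y" for x y
    using assms(1) by (simp_all add: Emb_def)
  show K: "x \<in> K \<Longrightarrow> \<phi> x = x" for x using assms(1) by (simp add: Emb_def)
  note one = K[OF sfieldD(1)[OF assms(2)]] and zero = K[OF sfieldD(2)[OF assms(2)]]
  show minus: "\<phi> (- x) = - \<phi> x" if "x \<in> E" for x
    using add[OF that sfieldD(4)[OF assms(3) that]] zero by (simp add: eq_neg_iff_add_eq_0 add.commute)
  show "\<phi> (inverse x) = inverse (\<phi> x)" if "x \<in> E" for x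
  proof (cases "x = 0")
    case False
    then have "\<phi> x * \<phi> (inverse x) = 1"
      using mult[OF that sfieldD(6)[OF assms(3) that]] one by simp
    then show ?thesis by (metis inverse_unique)
  qed (simp add: zero)
  show zeroD: "x = 0" if "x \<in> E" "\<phi> x = 0" for x
  proof (rule ccontr)
    assume "x \<noteq> 0"
    then show False using mult[OF that(1) sfieldD(6)[OF assms(3) that(1)]] one that(2) by simp
  qed
  show "x = y" if "x \<in> E" "y \<in> E" "\<phi> x = \<phi> y" for x y
    using zeroD[of "x + - y"] add[OF that(1) sfieldD(4)[OF assms(3) that(2)]] minus[OF that(2)] that
      sfieldD(7)[OF assms(3) that(1,2)] by simp
  show "x \<in> E \<Longrightarrow> \<phi> (x ^ n) = \<phi> x ^ n"
    by (induction n) (simp_all add: one mult sfield_power[OF assms(3)])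
qed

lemma Emb_restrict: "\<phi> \<in> Emb K E \<Longrightarrow> F \<subseteq> E \<Longrightarrow> sfield F \<Longrightarrow> K \<subseteq> F \<Longrightarrow> restrict \<phi> F \<in> Emb K F"
  unfolding Emb_def by (auto simp: sfieldD subset_iff)

lemma Emb_eqI:
  assumes "\<phi> \<in> Emb K (adjoin F S)" "\<psi> \<in> Emb K (adjoin F S)" "sfield K"
    "\<And>x. x \<in> F \<Longrightarrow> \<phi> x = \<psi> x" "\<And>x. x \<in> S \<Longrightarrow> \<phi> x = \<psi> x"
  shows "\<phi> = \<psi>"
proof (rule extensionalityI)
  note E = sfield_adjoin[of F S]
  note \<phi> = EmbD[OF assms(1,3) E] and \<psi> = EmbD[OF assms(2,3) E]
  have "sfield {z \<in> adjoin F S. \<phi> z = \<psi> z}"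
  proof (rule sfieldI)
    show "1 \<in> {z \<in> adjoin F S. \<phi> z = \<psi> z}"
      using \<phi>(3) \<psi>(3) sfieldD(1)[OF assms(3)] sfieldD(1)[OF E] by simp
  qed (auto simp: \<phi> \<psi> sfieldD[OF E])
  then have "adjoin F S \<subseteq> {z \<in> adjoin F S. \<phi> z = \<psi> z}"
    using assms(4,5) adjoin_incl[where F = F and S = S] by (intro adjoin_least) auto
  then show "\<phi> z = \<psi> z" if "z \<in> adjoin F S" for z using that by blast
qed (use assms(1,2) in \<open>simp_all add: Emb_def\<close>)

lemma adjoin_sqrt:
  assumes F: "sfield F" and r: "r * r \<in> F" "r \<notin> F"
  shows "adjoin F {r} = {x + y * r |x y. x \<in> F \<and> y \<in> F}"
proof (rule adjoin_eqI)
  let ?E = "{x + y * r |x y. x \<in> F \<and> y \<in> F}"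
  have I: "x \<in> F \<Longrightarrow> y \<in> F \<Longrightarrow> x + y * r \<in> ?E" for x y by blast
  show "sfield ?E"
  proof (rule sfieldI)
    show "1 \<in> ?E" using I[of 1 0] F by (simp add: sfieldD)
  next
    fix u v assume "u \<in> ?E" "v \<in> ?E"
    then obtain x y x' y' where *: "u = x + y * r" "v = x' + y' * r" "x \<in> F" "y \<in> F" "x' \<in> F" "y' \<in> F"
      by blast
    show "u + v \<in> ?E"
      using I[of "x + x'" "y + y'"] * F by (simp add: sfieldD algebra_simps)
    have "u * v = (x * x' + y * y' * (r * r)) + (x * y' + y * x') * r"
      unfolding * by (simp add: algebra_simps)
    then show "u * v \<in> ?E"
      using I[of "x * x' + y * y' * (r * r)" "x * y' + y * x'"] * F r by (simp add: sfieldD)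
  next
    fix u assume "u \<in> ?E"
    then obtain x y where *: "u = x + y * r" "x \<in> F" "y \<in> F" by blast
    show "- u \<in> ?E" using I[of "- x" "- y"] * F by (simp add: sfieldD)
    assume "u \<noteq> 0"
    have ne: "x - y * r \<noteq> 0"
    proof
      assume "x - y * r = 0"
      then have xy: "x = y * r" by simp
      show False
      proof (cases "y = 0")
        case True
        then show False using xy * \<open>u \<noteq> 0\<close> by simp
      next
        case False
        then have "r = x * inverse y" using xy by simp
        then show False using r(2) * F by (simp add: sfieldD)
      qed
    qed
    define N where "N = x * x - y * y * (r * r)"
    have N: "u * (x - y * r) = N" "N \<in> F"
      unfolding N_def *(1) by (simp add: algebra_simps) (use * F r in \<open>simp add: sfieldD\<close>)
    then have "N \<noteq> 0" using ne \<open>u \<noteq> 0\<close> by (metis mult_eq_0_iff)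
    then have "inverse u = x * inverse N + (- y * inverse N) * r"
      using N(1) \<open>u \<noteq> 0\<close> by (simp add: field_simps)
    then show "inverse u \<in> ?E"
      using I[of "x * inverse N" "- y * inverse N"] * N F by (simp add: sfieldD)
  qed
  show "F \<subseteq> ?E" using I[of _ 0] F by (auto simp: sfieldD)
  show "{r} \<subseteq> ?E" using I[of 0 1] F by (simp add: sfieldD)
  show "?E \<subseteq> adjoin F {r}"
    using adjoin_incl[where F = F and S = "{r}"]
    by (auto intro!: sfieldD(3,5)[OF sfield_adjoin[of F "{r}"]])
qed

lemma adjoin_sqrt_unique:
  assumes "sfield F" "r \<notin> F" "x \<in> F" "y \<in> F" "x' \<in> F" "y' \<in> F" "x + y * r = x' + y' * r"
  shows "x = x' \<and> y = y'"
proof -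
  have "y = y'"
  proof (rule ccontr)
    assume "y \<noteq> y'"
    moreover have "(y - y') * r = x' - x" using assms(7) by (simp add: algebra_simps)
    ultimately have "r = (x' - x) * inverse (y - y')" by (simp add: field_simps)
    then show False using assms by (simp add: sfieldD)
  qed
  then show ?thesis using assms(7) by simp
qed

lemma Emb_extend_sqrt:
  assumes K: "sfield K" and F: "sfield F" "K \<subseteq> F" and r: "r * r \<in> F" "r \<notin> F"
    and \<phi>: "\<phi> \<in> Emb K F" and \<rho>: "\<rho> * \<rho> = \<phi> (r * r)"
  shows "\<exists>\<Phi>\<in>Emb K (adjoin F {r}). (\<forall>x\<in>F. \<Phi> x = \<phi> x) \<and> \<Phi> r = \<rho>"
proof -
  note D = EmbD[OF \<phi> K F(1)]
  \<comment> \<open>\<open>cX\<close> and \<open>cY\<close> are the coordinates with respect to the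
    basis 1, \<open>r\<close>, well defined by \<open>adjoin_sqrt_unique\<close>.\<close>
  define cX where "cX z = fst (SOME p. fst p \<in> F \<and> snd p \<in> F \<and> z = fst p + snd p * r)" for z
  define cY where "cY z = snd (SOME p. fst p \<in> F \<and> snd p \<in> F \<and> z = fst p + snd p * r)" for z
  have cXY: "cX (x + y * r) = x \<and> cY (x + y * r) = y" if "x \<in> F" "y \<in> F" for x y
  proof -
    have "\<exists>p. fst p \<in> F \<and> snd p \<in> F \<and> x + y * r = fst p + snd p * r"
      using that by (intro exI[of _ "(x, y)"]) simp
    from someI_ex[OF this] have "cX (x + y * r) \<in> F" "cY (x + y * r) \<in> F"
      "x + y * r = cX (x + y * r) + cY (x + y * r) * r" by (simp_all add: cX_def cY_def)
    then show ?thesis using adjoin_sqrt_unique[OF F(1) r(2) that] by metis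
  qed
  let ?E = "{x + y * r |x y. x \<in> F \<and> y \<in> F}"
  have E: "adjoin F {r} = ?E" by (rule adjoin_sqrt[OF F(1) r])
  define \<Phi> where "\<Phi> = restrict (\<lambda>z. \<phi> (cX z) + \<phi> (cY z) * \<rho>) ?E"
  have val: "\<Phi> (x + y * r) = \<phi> x + \<phi> y * \<rho>" if "x \<in> F" "y \<in> F" for x y
  proof -
    have "x + y * r \<in> ?E" using that by blast
    then show ?thesis using cXY[OF that] by (simp add: \<Phi>_def)
  qed
  have valF: "\<Phi> x = \<phi> x" if "x \<in> F" for x
    using val[of x 0] that D(3)[of 0] F K by (simp add: sfieldD)
  have "\<Phi> (u + v) = \<Phi> u + \<Phi> v \<and> \<Phi> (u * v) = \<Phi> u * \<Phi> v" if "u \<in> ?E" "v \<in> ?E" for u v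
  proof -
    from that obtain x y x' y' where *: "u = x + y * r" "v = x' + y' * r" "x \<in> F" "y \<in> F" "x' \<in> F" "y' \<in> F"
      by blast
    note S = sfieldD[OF F(1)]
    have "u + v = (x + x') + (y + y') * r" unfolding * by (simp add: algebra_simps)
    then have 1: "\<Phi> (u + v) = \<phi> (x + x') + \<phi> (y + y') * \<rho>"
      using val[OF S(3)[OF *(3,5)] S(3)[OF *(4,6)]] by (simp only:)
    have "u * v = (x * x' + y * y' * (r * r)) + (x * y' + y * x') * r"
      unfolding * by (simp add: algebra_simps)
    then have "\<Phi> (u * v) = \<phi> (x * x' + y * y' * (r * r)) + \<phi> (x * y' + y * x') * \<rho>"
      using val[of "x * x' + y * y' * (r * r)" "x * y' + y * x'"] *(3-6) S r by (simp only:)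
    also have "\<dots> = (\<phi> x * \<phi> x' + \<phi> y * \<phi> y' * (\<rho> * \<rho>)) + (\<phi> x * \<phi> y' + \<phi> y * \<phi> x') * \<rho>"
      using D(1,2) * S r by (simp add: \<rho>)
    finally have "\<Phi> (u * v) = (\<phi> x + \<phi> y * \<rho>) * (\<phi> x' + \<phi> y' * \<rho>)"
      by (simp add: algebra_simps)
    then show ?thesis
      using 1 D(1) val[OF *(3,4)] val[OF *(5,6)] *(3-6) unfolding *(1,2) by (simp add: algebra_simps)
  qed
  moreover have "\<forall>x\<in>K. \<Phi> x = x" using valF F(2) D(3) by auto
  moreover have "\<Phi> \<in> extensional ?E" by (simp add: \<Phi>_def)
  ultimately have "\<Phi> \<in> Emb K (adjoin F {r})" unfolding E Emb_def by blast
  moreover have "\<Phi> r = \<rho>"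
    using val[of 0 1] D(3)[of 0] D(3)[of 1] sfieldD(1,2)[OF F(1)] sfieldD(1,2)[OF K] by simp
  ultimately show ?thesis using valF by blast
qed

lemma card_sqrts:
  assumes "(2 :: 'a :: alg_closed_field) \<noteq> 0" "c \<noteq> 0"
  shows "card {\<rho> :: 'a. \<rho> * \<rho> = c} = 2"
proof -
  obtain d where d: "d ^ 2 = c" using nth_root_exists[of 2 c] by auto
  have "{\<rho>. \<rho> * \<rho> = c} = {d, - d}"
    using d by (auto simp: power2_eq_square square_eq_iff)
  moreover have "d \<noteq> - d"
  proof
    assume "d = - d"
    then have "2 * d = 0" by (metis add.right_inverse mult_2)
    then show False using assms d by auto
  qed
  ultimately show ?thesis by simp
qed

text \<open>An extension is determined by the image of \<open>r\<close>, which may be either square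
  root of \<open>\<phi> (r * r)\<close>; the two differ because the characteristic is not 2.\<close>

lemma card_Emb_sqrt:
  fixes F :: "'a :: alg_closed_field set"
  assumes two: "(2 :: 'a) \<noteq> 0" and K: "sfield K" and F: "sfield F" "K \<subseteq> F"
    and r: "r * r \<in> F" "r \<notin> F" and fin: "finite (Emb K F)"
  shows "finite (Emb K (adjoin F {r})) \<and> card (Emb K (adjoin F {r})) = card (Emb K F) * 2"
proof -
  let ?E = "adjoin F {r}" and ?S = "SIGMA \<phi> : Emb K F. {\<rho>. \<rho> * \<rho> = \<phi> (r * r)}"
  have E: "sfield ?E" "F \<subseteq> ?E" "r \<in> ?E" "K \<subseteq> ?E"
    using sfield_adjoin[of F "{r}"] adjoin_incl[where F = F and S = "{r}"] F(2) by auto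
  have bij: "bij_betw (\<lambda>\<Phi>. (restrict \<Phi> F, \<Phi> r)) (Emb K ?E) ?S"
  proof (rule bij_betw_imageI)
    show "inj_on (\<lambda>\<Phi>. (restrict \<Phi> F, \<Phi> r)) (Emb K ?E)"
    proof (rule inj_onI)
      fix \<Phi> \<Psi> assume *: "\<Phi> \<in> Emb K ?E" "\<Psi> \<in> Emb K ?E" "(restrict \<Phi> F, \<Phi> r) = (restrict \<Psi> F, \<Psi> r)"
      have "\<Phi> x = \<Psi> x" if "x \<in> F" for x
      proof -
        have "restrict \<Phi> F x = restrict \<Psi> F x" using *(3) by simp
        then show ?thesis using that by simp
      qed
      then show "\<Phi> = \<Psi>" using * by (intro Emb_eqI[OF *(1,2) K]) auto
    qed
    show "(\<lambda>\<Phi>. (restrict \<Phi> F, \<Phi> r)) ` Emb K ?E = ?S"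
    proof (intro equalityI subsetI)
      fix z assume "z \<in> (\<lambda>\<Phi>. (restrict \<Phi> F, \<Phi> r)) ` Emb K ?E"
      then obtain \<Phi> where \<Phi>: "\<Phi> \<in> Emb K ?E" "z = (restrict \<Phi> F, \<Phi> r)" by blast
      then show "z \<in> ?S"
        using Emb_restrict[OF \<Phi>(1) E(2) F] EmbD(2)[OF \<Phi>(1) K E(1) E(3) E(3)] r(1) by simp
    next
      fix z assume "z \<in> ?S"
      then obtain \<phi> \<rho> where z: "z = (\<phi>, \<rho>)" "\<phi> \<in> Emb K F" "\<rho> * \<rho> = \<phi> (r * r)" by blast
      obtain \<Phi> where \<Phi>: "\<Phi> \<in> Emb K ?E" "\<forall>x\<in>F. \<Phi> x = \<phi> x" "\<Phi> r = \<rho>"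
        using Emb_extend_sqrt[OF K F r z(2,3)] by blast
      have "restrict \<Phi> F = \<phi>"
        by (rule extensionalityI[of _ F]) (use \<Phi> z in \<open>simp_all add: Emb_def\<close>)
      then show "z \<in> (\<lambda>\<Phi>. (restrict \<Phi> F, \<Phi> r)) ` Emb K ?E"
        using \<Phi> z by (intro image_eqI[of _ _ \<Phi>]) simp_all
    qed
  qed
  have card: "card {\<rho>. \<rho> * \<rho> = \<phi> (r * r)} = 2" if "\<phi> \<in> Emb K F" for \<phi>
  proof (rule card_sqrts[OF two])
    have "r \<noteq> 0" using r(2) sfieldD(2)[OF F(1)] by auto
    then show "\<phi> (r * r) \<noteq> 0" using EmbD(8)[OF that K F(1) r(1)] by auto
  qed
  have fin': "finite {\<rho>. \<rho> * \<rho> = \<phi> (r * r)}" if "\<phi> \<in> Emb K F" for \<phi>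
    by (rule card_ge_0_finite) (simp add: card[OF that])
  then have "finite ?S" using fin by (intro finite_SigmaI)
  moreover have "card ?S = (\<Sum>\<phi>\<in>Emb K F. card {\<rho>. \<rho> * \<rho> = \<phi> (r * r)})"
    using fin fin' by (intro card_SigmaI) auto
  then have "card ?S = card (Emb K F) * 2" by (simp add: card)
  ultimately show ?thesis
    using bij_betw_finite[OF bij] bij_betw_same_card[OF bij] by simp
qed

section \<open>Degrees and embeddings of towers of square roots\<close>

lemma has_degree_refl: "sfield K \<Longrightarrow> has_degree K K 1"
  unfolding has_degree_def by (rule rta.dimension_one)

lemma has_degree_sqrt:
  assumes "sfield K" "sfield F" "has_degree F K d" "r * r \<in> F" "r \<notin> F"
  shows "has_degree (adjoin F {r}) K (d * 2)"
proof -
  have "rta.dimension (Suc 1) F (rta.line_extension F r F)"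
    using assms(5) rta.dimension_one[OF assms(2)] by (intro rta.Suc_dim) auto
  moreover have "rta.line_extension F r F = adjoin F {r}"
    unfolding adjoin_sqrt[OF assms(2,4,5)]
    unfolding set_eq_iff rta.line_extension_mem_iff mem_Collect_eq rta_simps
    by (metis add.commute)
  ultimately have "rta.dimension 2 F (adjoin F {r})" by (simp add: numeral_2_eq_2)
  then show ?thesis
    using rta.telescopic_base[OF assms(1,2)] assms(3) unfolding has_degree_def by blast
qed

lemma has_degree_unique: "sfield K \<Longrightarrow> has_degree E K d \<Longrightarrow> has_degree E K d' \<Longrightarrow> d = d'"
  unfolding has_degree_def by (rule rta.dimension_is_inj)

text \<open>Trivial steps with \<open>r \<in> E\<close> are allowed, so towers can be built without
  deciding which square roots are new.\<close>

inductive qtower :: "'a :: field set \<Rightarrow> 'a set \<Rightarrow> bool" for F where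
  refl: "qtower F F"
| step: "qtower F E \<Longrightarrow> r * r \<in> E \<Longrightarrow> qtower F (adjoin E {r})"

lemma qtower_sfield: "qtower F E \<Longrightarrow> sfield F \<Longrightarrow> sfield E \<and> F \<subseteq> E"
proof (induction rule: qtower.induct)
  case (step E r)
  then show ?case using sfield_adjoin[of E "{r}"] adjoin_incl[where F = E and S = "{r}"] by blast
qed simp

lemma qtower_trans: "qtower E L \<Longrightarrow> qtower F E \<Longrightarrow> qtower F L"
  by (induction rule: qtower.induct) (auto intro: qtower.step)

lemma qtower_finite:
  "finite S \<Longrightarrow> sfield F \<Longrightarrow> (\<And>r. r \<in> S \<Longrightarrow> r * r \<in> F) \<Longrightarrow> qtower F (adjoin F S)"
proof (induction S rule: finite_induct)
  case empty
  then show ?case by (simp add: adjoin_absorb qtower.refl)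
next
  case (insert r S)
  have "r * r \<in> adjoin F S" using insert.prems(2)[of r] adjoin_incl(1)[of F S] by auto
  with insert have "qtower F (adjoin (adjoin F S) {r})" by (intro qtower.step) auto
  then show ?case by (simp add: adjoin_adjoin)
qed

text \<open>Degree and number of embeddings both double at each proper step. This is what lets a
  degree be compared with the order of a group of portraits.\<close>

lemma qtower_degree:
  fixes K :: "'a :: alg_closed_field set"
  assumes "(2 :: 'a) \<noteq> 0" "sfield K"
  shows "qtower K E \<Longrightarrow> finite (Emb K E) \<and> has_degree E K (card (Emb K E))"
proof (induction rule: qtower.induct)
  case refl
  have "Emb K K = {restrict (\<lambda>x. x) K}"
    by (auto simp: Emb_def sfieldD[OF assms(2)] intro!: extensionalityI[of _ K])
  then show ?case using has_degree_refl[OF assms(2)] by simp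
next
  case (step E r)
  have E: "sfield E" "K \<subseteq> E" using qtower_sfield[OF step.hyps(1) assms(2)] by auto
  show ?case
  proof (cases "r \<in> E")
    case True
    then show ?thesis using step.IH adjoin_absorb[OF E(1), of "{r}"] by simp
  next
    case False
    have "finite (Emb K E)" using step.IH by blast
    from card_Emb_sqrt[OF assms E step.hyps(2) False this]
      has_degree_sqrt[OF assms(2) E(1) _ step.hyps(2) False, of "card (Emb K E)"] step.IH
    show ?thesis by simp
  qed
qed

lemma qtower_extend:
  fixes K :: "'a :: alg_closed_field set"
  assumes "sfield K" "sfield F" "K \<subseteq> F" "\<phi> \<in> Emb K F"
  shows "qtower F E \<Longrightarrow> \<exists>\<Phi>\<in>Emb K E. \<forall>x\<in>F. \<Phi> x = \<phi> x"
proof (induction rule: qtower.induct)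
  case refl
  then show ?case using assms by blast
next
  case (step E r)
  have E: "sfield E" "F \<subseteq> E" using qtower_sfield[OF step.hyps(1) assms(2)] by auto
  obtain \<Psi> where \<Psi>: "\<Psi> \<in> Emb K E" "\<forall>x\<in>F. \<Psi> x = \<phi> x" using step.IH by blast
  show ?case
  proof (cases "r \<in> E")
    case True
    then show ?thesis using \<Psi> adjoin_absorb[OF E(1), of "{r}"] by auto
  next
    case False
    obtain \<rho> where "\<rho> ^ 2 = \<Psi> (r * r)" using nth_root_exists[of 2 "\<Psi> (r * r)"] by auto
    then have "\<rho> * \<rho> = \<Psi> (r * r)" by (simp add: power2_eq_square)
    from Emb_extend_sqrt[OF assms(1) E(1) _ step.hyps(2) False \<Psi>(1) this] E(2) assms(3)
    show ?thesis using \<Psi>(2) by (metis subset_trans subsetD)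
  qed
qed

text \<open>An injection of the finite set \<open>S\<close> into itself permutes it; hence the image
  of the field is again a field that contains \<open>K\<close> and \<open>S\<close>.\<close>

lemma Emb_normal_Bij:
  assumes K: "sfield K" and S: "finite S" and \<phi>: "\<phi> \<in> Emb K (adjoin K S)" and im: "\<phi> ` S \<subseteq> S"
  shows "\<phi> \<in> Bij (adjoin K S)"
proof -
  let ?E = "adjoin K S"
  note E = sfield_adjoin[of K S]
  note D = EmbD[OF \<phi> K E] and SE = sfieldD[OF E]
  have inc: "K \<subseteq> ?E" "S \<subseteq> ?E" by (rule adjoin_incl)+
  have one: "\<phi> 1 = 1" using D(3) K by (simp add: sfieldD)
  have "inj_on \<phi> ?E" using D(6) by (intro inj_onI) auto
  then have "card (\<phi> ` S) = card S" using inc(2) by (intro card_image) (auto intro: inj_on_subset)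
  then have S': "\<phi> ` S = S" using im S by (intro card_subset_eq) auto
  have "sfield {z \<in> ?E. \<phi> z \<in> ?E}"
    by (rule sfieldI) (auto simp: D SE one)
  then have "?E \<subseteq> {z \<in> ?E. \<phi> z \<in> ?E}"
    using im inc D(3) by (intro adjoin_least) auto
  then have 1: "\<phi> ` ?E \<subseteq> ?E" by auto
  have "sfield (\<phi> ` ?E)"
  proof (rule sfieldI)
    show "1 \<in> \<phi> ` ?E" using one SE(1) by (metis imageI)
    fix x assume "x \<in> \<phi> ` ?E"
    then obtain u where u: "u \<in> ?E" "x = \<phi> u" by blast
    show "- x \<in> \<phi> ` ?E" using u SE(4)[OF u(1)] D(4)[OF u(1)] by (metis imageI)
    show "inverse x \<in> \<phi> ` ?E" using u SE(6)[OF u(1)] D(5)[OF u(1)] by (metis imageI)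
    fix y assume "y \<in> \<phi> ` ?E"
    then obtain v where v: "v \<in> ?E" "y = \<phi> v" by blast
    show "x + y \<in> \<phi> ` ?E" using u v SE(3)[OF u(1) v(1)] D(1)[OF u(1) v(1)] by (metis imageI)
    show "x * y \<in> \<phi> ` ?E" using u v SE(5)[OF u(1) v(1)] D(2)[OF u(1) v(1)] by (metis imageI)
  qed
  moreover have "K \<subseteq> \<phi> ` ?E"
  proof
    fix x assume "x \<in> K"
    then show "x \<in> \<phi> ` ?E" using D(3)[of x] inc(1) by (metis imageI subsetD)
  qed
  moreover have "S \<subseteq> \<phi> ` ?E" using S' inc(2) by blast
  ultimately have "?E \<subseteq> \<phi> ` ?E" by (rule adjoin_least)
  then have "bij_betw \<phi> ?E ?E" using 1 \<open>inj_on \<phi> ?E\<close> by (simp add: bij_betw_def subset_antisym)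
  then show ?thesis using \<phi> by (simp add: Bij_def Emb_def)
qed

lemma carrier_Gal: "carrier (Gal E K) = Bij E \<inter> Emb K E"
  by (auto simp: Gal_def Emb_def Bij_def)

section \<open>The Galois action on the preimage tree\<close>

lemma prod_lists_Suc:
  fixes f :: "letter list \<Rightarrow> 'a :: comm_monoid_mult"
  shows "(\<Prod>s\<in>{s. length s = Suc i}. f s) =
    (\<Prod>s\<in>{s. length s = i}. f (LA # s)) * (\<Prod>s\<in>{s. length s = i}. f (LB # s))"
proof -
  have "(\<Prod>s\<in>{s. length s = Suc i}. f s) = (\<Prod>(t, s)\<in>{LA, LB} \<times> {s. length s = i}. f (t # s))"
    unfolding lists_Suc by (subst prod.reindex) (auto simp: inj_on_def case_prod_beta intro!: prod.cong)
  also have "\<dots> = (\<Prod>t\<in>{LA, LB}. \<Prod>s\<in>{s. length s = i}. f (t # s))"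
    by (simp add: prod.cartesian_product)
  finally show ?thesis by simp
qed

lemma primitive_root_power_eq_1:
  assumes "primitive_root_of_unity n (z :: 'a :: field)"
  shows "z ^ k = 1 \<longleftrightarrow> n dvd k"
proof
  have n: "n > 0" "z ^ n = 1" "\<And>k. 0 < k \<Longrightarrow> k < n \<Longrightarrow> z ^ k \<noteq> 1"
    using assms by (auto simp: primitive_root_of_unity_def)
  have "z ^ k = (z ^ n) ^ (k div n) * z ^ (k mod n)"
    by (simp flip: power_mult power_add)
  then have k: "z ^ k = z ^ (k mod n)" by (simp add: n(2))
  show "n dvd k" if "z ^ k = 1"
    using that n(3)[of "k mod n"] n(1) unfolding k by (auto simp: dvd_eq_mod_eq_0)
  show "z ^ k = 1" if "n dvd k" using that k by simp
qed

lemma primitive_root_nonzero: "primitive_root_of_unity n (z :: 'a :: field) \<Longrightarrow> z \<noteq> 0"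
  by (auto simp: primitive_root_of_unity_def power_0_left)

lemma primitive_root_powi_eq:
  assumes z: "primitive_root_of_unity n (z :: 'a :: field)"
  shows "z powi p = z powi q \<longleftrightarrow> [p = q] (mod int n)"
proof -
  have z0: "z \<noteq> 0" by (rule primitive_root_nonzero[OF z])
  have 1: "z powi p = 1 \<longleftrightarrow> int n dvd p" for p
  proof (cases "p \<ge> 0")
    case True
    then show ?thesis
      using primitive_root_power_eq_1[OF z, of "nat p"] by (simp add: power_int_def flip: int_dvd_int_iff)
  next
    case False
    then show ?thesis
      using primitive_root_power_eq_1[OF z, of "nat (- p)"]
      by (simp add: power_int_def power_inverse flip: int_dvd_int_iff)
  qed
  have "z powi p = z powi q \<longleftrightarrow> z powi (p - q) = 1"
    using z0 by (simp add: power_int_diff)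
  then show ?thesis unfolding 1 cong_iff_dvd_diff .
qed

text \<open>Left translations by elements of the finite set \<open>H\<close> are injective on it,
  hence onto, which produces the identity and inverses. For Galois groups only composition then has
  to be translated into portraits.\<close>

lemma finite_closed_subgroup_Mgrp:
  assumes H: "H \<subseteq> Mt n" "H \<noteq> {}" and mult: "\<And>s t. s \<in> H \<Longrightarrow> t \<in> H \<Longrightarrow> tcomp s t \<in> H"
  shows "subgroup H (Mgrp n)"
proof -
  interpret M: group "Mgrp n" by (rule group_Mgrp)
  have fin: "finite H" using H(1) finite_Mt finite_subset by blast
  have surj: "\<exists>s\<in>H. tcomp t s = u" if t: "t \<in> H" and u: "u \<in> H" for t u
  proof -
    have "inj_on (tcomp t) H"
      using M.l_cancel[of t] t H(1) by (intro inj_onI) (auto simp: subset_iff)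
    then have "tcomp t ` H = H" using t mult fin by (intro card_subset_eq) (auto simp: card_image)
    then show ?thesis using u by (metis imageE)
  qed
  have one: "tid n \<in> H"
  proof -
    obtain t where t: "t \<in> H" using H(2) by blast
    obtain s where s: "s \<in> H" "tcomp t s = t" using surj[OF t t] by blast
    then have "s = tid n" using M.l_cancel_one[of t s] t H(1) by auto
    then show ?thesis using s by simp
  qed
  show ?thesis
  proof (rule M.subgroupI)
    fix t assume t: "t \<in> H"
    obtain s where s: "s \<in> H" "tcomp t s = tid n" using surj[OF t one] by blast
    have "inv\<^bsub>Mgrp n\<^esub> t = s"
      using M.inv_unique'[of t s] s t H(1) M.inv_comm[of t s] by auto
    then show "inv\<^bsub>Mgrp n\<^esub> t \<in> H" using s by simp
  qed (use H mult in auto)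
qed

section \<open>Labels, roots of unity and the embedding of G_n into M_n\<close>

locale arboreal =
  fixes K :: "'a :: alg_closed_field set" and x :: 'a and \<zeta> :: "nat \<Rightarrow> 'a" and lab :: "word \<Rightarrow> 'a"
  assumes K: "sfield K" and xK: "x \<in> K" and x0: "x \<noteq> 0" "x \<noteq> - 1" and two: "(2 :: 'a) \<noteq> 0"
    and zeta_prim: "\<And>m. primitive_root_of_unity (2 ^ m) (\<zeta> m)"
    and zeta_compat: "\<And>m. m \<ge> 1 \<Longrightarrow> \<zeta> m ^ 2 = \<zeta> (m - 1)"
    and labeling: "tree_labeling basilica x lab"
    and lab_zeta: "\<And>y i. label_prod lab y LA i * inverse (label_prod lab y LB i) = \<zeta> (i + 1)"
begin

lemma zeta_nonzero: "\<zeta> m \<noteq> 0"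
  by (rule primitive_root_nonzero[OF zeta_prim])

lemma zeta_0: "\<zeta> 0 = 1"
  using zeta_prim[of 0] by (simp add: primitive_root_of_unity_def)

lemma zeta_powi_eq: "\<zeta> m powi p = \<zeta> m powi q \<longleftrightarrow> [p = q] (mod 2 ^ m)"
  using primitive_root_powi_eq[OF zeta_prim, of m p q] by simp

lemma zeta_double: "\<zeta> (Suc m) powi (2 * p) = \<zeta> m powi p"
  using zeta_compat[of "Suc m"] by (simp add: power_int_mult)

lemma zeta_1: "\<zeta> 1 = - 1"
proof -
  have "\<zeta> 1 ^ 2 = 1" using zeta_compat[of 1] zeta_0 by simp
  moreover have "\<zeta> 1 \<noteq> 1" using zeta_prim[of 1] by (auto simp: primitive_root_of_unity_def)
  ultimately show ?thesis by (auto simp: power2_eq_1_iff)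
qed

lemma lab_Nil: "lab [] = x"
  and lab_bij: "bij_betw (\<lambda>w. (length w, lab w)) UNIV (SIGMA n : UNIV. iter_preimage basilica x n)"
  and lab_children: "{lab (w @ [LA]), lab (w @ [LB])} = {z. basilica z = lab w}"
  using labeling by (simp_all add: tree_labeling_def preimage_tree_def)

lemma lab_inj: "length w = length w' \<Longrightarrow> lab w = lab w' \<Longrightarrow> w = w'"
  using bij_betw_imp_inj_on[OF lab_bij] by (auto dest: injD)

lemma lab_preimage: "lab w \<in> iter_preimage basilica x (length w)"
  using bij_betwE[OF lab_bij] by auto

lemma preimage_lab: "z \<in> iter_preimage basilica x n \<Longrightarrow> \<exists>w. length w = n \<and> lab w = z"
proof -
  assume "z \<in> iter_preimage basilica x n"
  then have "(n, z) \<in> range (\<lambda>w. (length w, lab w))"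
    unfolding bij_betw_imp_surj_on[OF lab_bij] by simp
  then show ?thesis by auto
qed

lemma iter_preimage_lab: "iter_preimage basilica x n = lab ` {w. length w = n}"
  using preimage_lab lab_preimage by blast

lemma finite_iter_preimage: "finite (iter_preimage basilica x n)"
  unfolding iter_preimage_lab by simp

lemma basilica_lab: "basilica (lab (w @ [c])) = lab w"
  using lab_children[of w] by (cases c) (auto simp: set_eq_iff)

lemma lab_sq: "lab (w @ [c]) * lab (w @ [c]) = 1 + lab w"
  using basilica_lab[of w c] by (simp add: basilica_def power2_eq_square diff_eq_eq add.commute)

lemma basilica_eq_labD: "basilica z = lab w \<Longrightarrow> \<exists>c. z = lab (w @ [c])"
  using lab_children[of w] by (auto simp: set_eq_iff)

lemma lab_LB: "lab (w @ [LB]) = - lab (w @ [LA])"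
proof -
  have "lab (w @ [LA]) \<noteq> lab (w @ [LB])" using lab_inj[of "w @ [LA]" "w @ [LB]"] by auto
  then show ?thesis using lab_sq[of w LA] lab_sq[of w LB] by (metis square_eq_iff)
qed

abbreviation Kn :: "nat \<Rightarrow> 'a set" where
  "Kn n \<equiv> arboreal_field K basilica x n"

lemma Kn_def: "Kn n = adjoin K (iter_preimage basilica x n)"
  by (simp add: arboreal_field_def)

lemma sfield_Kn: "sfield (Kn n)"
  unfolding Kn_def by (rule sfield_adjoin)

lemma K_Kn: "K \<subseteq> Kn n"
  unfolding Kn_def by (rule adjoin_incl)

text \<open>Only level \<open>n\<close> is adjoined; the labels of lower levels are obtained from it
  by applying \<open>basilica\<close>.\<close>

lemma lab_Kn: "length w \<le> n \<Longrightarrow> lab w \<in> Kn n"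
proof (induction "n - length w" arbitrary: w)
  case 0
  then have "lab w \<in> iter_preimage basilica x n" using lab_preimage[of w] by simp
  then show ?case unfolding Kn_def using adjoin_incl(2) by blast
next
  case (Suc d)
  then have "lab (w @ [LA]) \<in> Kn n" by (intro Suc.hyps(1)) auto
  then have "lab (w @ [LA]) * lab (w @ [LA]) - 1 \<in> Kn n"
    by (intro sfieldD[OF sfield_Kn])
  then show ?case by (simp add: lab_sq)
qed

lemma Kn_0: "Kn 0 = K"
  unfolding Kn_def using xK by (intro adjoin_absorb K) (auto simp: iter_preimage_def)

lemma Kn_Suc: "Kn (Suc n) = adjoin (Kn n) (iter_preimage basilica x (Suc n))"
proof (rule sym, rule adjoin_eqI[OF sfield_Kn])
  have sub: "iter_preimage basilica x m \<subseteq> Kn n" if "m \<le> n" for m n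
    unfolding iter_preimage_lab using lab_Kn that by auto
  show "Kn n \<subseteq> Kn (Suc n)"
    unfolding Kn_def[of n] by (rule adjoin_least[OF sfield_Kn K_Kn sub]) simp
  show "iter_preimage basilica x (Suc n) \<subseteq> Kn (Suc n)" by (rule sub) simp
  have "K \<subseteq> adjoin (Kn n) (iter_preimage basilica x (Suc n))"
    using K_Kn[of n] adjoin_incl(1) by blast
  then show "Kn (Suc n) \<subseteq> adjoin (Kn n) (iter_preimage basilica x (Suc n))"
    unfolding Kn_def[of "Suc n"] by (intro adjoin_least sfield_adjoin adjoin_incl(2))
qed

lemma Kn_mono: "m \<le> n \<Longrightarrow> Kn m \<subseteq> Kn n"
proof (induction n rule: dec_induct)
  case (step n)
  then show ?case using adjoin_incl(1)[of "Kn n"] unfolding Kn_Suc by blast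
qed simp

lemma qtower_Kn: "m \<le> n \<Longrightarrow> qtower (Kn m) (Kn n)"
proof (induction n rule: dec_induct)
  case (step n)
  have "qtower (Kn n) (Kn (Suc n))"
    unfolding Kn_Suc
  proof (rule qtower_finite[OF finite_iter_preimage sfield_Kn])
    fix z assume "z \<in> iter_preimage basilica x (Suc n)"
    then obtain w where w: "length w = Suc n" "z = lab w" by (auto simp: iter_preimage_lab)
    then obtain v c where "w = v @ [c]" by (metis length_Suc_conv_rev)
    with w show "z * z \<in> Kn n"
      using lab_sq[of v c] lab_Kn[of v n] sfieldD[OF sfield_Kn[of n]] by simp
  qed
  then show ?case using step.IH by (rule qtower_trans)
qed (rule qtower.refl)

lemma qtower_K_Kn: "qtower K (Kn n)"
  using qtower_Kn[of 0 n] by (simp add: Kn_0)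

text \<open>At \<open>w = y c\<close> this is \<open>label_prod lab y c i\<close>. Indexing by a
  single word, which may be the root, gives a recursion two levels up the tree and lets the product
  be followed under a Galois element.\<close>

definition Pi_lab :: "nat \<Rightarrow> word \<Rightarrow> 'a" where
  "Pi_lab i w = (\<Prod>s\<in>{s. length s = i}. lab (w @ concat (map (\<lambda>t. [t, LA]) s)))"

lemma Pi_lab_0: "Pi_lab 0 w = lab w"
  by (simp add: Pi_lab_def)

lemma Pi_lab_Suc: "Pi_lab (Suc i) w = Pi_lab i (w @ [LA, LA]) * Pi_lab i (w @ [LB, LA])"
  unfolding Pi_lab_def prod_lists_Suc by simp

lemma Pi_lab_zeta:
  "Pi_lab i (y @ [LA]) = Pi_lab i (y @ [LB]) * \<zeta> (Suc i)" "Pi_lab i (y @ [c]) \<noteq> 0"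
proof -
  have *: "label_prod lab y c i = Pi_lab i (y @ [c])" for c
    by (simp add: label_prod_def Pi_lab_def)
  note z = lab_zeta[of y i, unfolded *]
  have "Pi_lab i (y @ [LA]) \<noteq> 0" "Pi_lab i (y @ [LB]) \<noteq> 0"
    using z zeta_nonzero[of "i + 1"] by auto
  then show "Pi_lab i (y @ [LA]) = Pi_lab i (y @ [LB]) * \<zeta> (Suc i)" "Pi_lab i (y @ [c]) \<noteq> 0"
    using z by (auto simp: field_simps intro: letter.exhaust[of c])
qed

lemma Pi_lab_flip:
  "Pi_lab i (y @ [flip_letter e LA]) = Pi_lab i (y @ [LA]) * \<zeta> (Suc i) powi (- of_bool e)"
  using Pi_lab_zeta(1)[of i y] zeta_nonzero by (cases e) simp_all

lemma Pi_lab_Kn: "length w + 2 * i \<le> n \<Longrightarrow> Pi_lab i w \<in> Kn n"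
  by (induction i arbitrary: w) (auto simp: Pi_lab_0 Pi_lab_Suc lab_Kn intro!: sfieldD(5)[OF sfield_Kn])

lemma zeta_Kn: "2 * i < n \<Longrightarrow> \<zeta> (Suc i) \<in> Kn n"
proof -
  assume "2 * i < n"
  then have "Pi_lab i [LA] * inverse (Pi_lab i [LB]) \<in> Kn n"
    by (intro sfieldD(5,6)[OF sfield_Kn] Pi_lab_Kn) auto
  moreover have "\<zeta> (Suc i) = Pi_lab i [LA] * inverse (Pi_lab i [LB])"
    using Pi_lab_zeta(1)[of i "[]"] Pi_lab_zeta(2)[of i "[]" LB] by simp
  ultimately show ?thesis by simp
qed

definition gword :: "('a \<Rightarrow> 'a) \<Rightarrow> word \<Rightarrow> word" where
  "gword \<sigma> w = (THE w'. length w' = length w \<and> lab w' = \<sigma> (lab w))"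

context
  fixes n \<sigma> assumes \<sigma>: "\<sigma> \<in> Emb K (Kn n)"
begin

lemmas \<sigma>D = EmbD[OF \<sigma> K sfield_Kn]

lemma emb_basilica: "z \<in> Kn n \<Longrightarrow> \<sigma> (basilica z) = basilica (\<sigma> z)"
  using \<sigma>D(1)[of "z ^ 2" "- 1"] \<sigma>D(4)[of 1] \<sigma>D(7)[of z 2] \<sigma>D(3)[of 1] sfield_Kn[of n] K
  by (simp add: basilica_def sfield_power sfieldD)

lemma emb_lab: "length w \<le> n \<Longrightarrow> \<exists>w'. length w' = length w \<and> lab w' = \<sigma> (lab w)"
proof (induction w rule: rev_induct)
  case Nil
  show ?case by (rule exI[of _ "[]"]) (simp add: lab_Nil \<sigma>D(3)[OF xK])
next
  case (snoc c w)
  then obtain w' where w': "length w' = length w" "lab w' = \<sigma> (lab w)" by auto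
  have "basilica (\<sigma> (lab (w @ [c]))) = lab w'"
    using emb_basilica[OF lab_Kn[OF snoc.prems]] w' by (simp add: basilica_lab)
  from basilica_eq_labD[OF this] obtain d where "\<sigma> (lab (w @ [c])) = lab (w' @ [d])" by blast
  then show ?case using w' by (intro exI[of _ "w' @ [d]"]) simp
qed

lemma gword: "length w \<le> n \<Longrightarrow> length (gword \<sigma> w) = length w \<and> lab (gword \<sigma> w) = \<sigma> (lab w)"
proof -
  assume "length w \<le> n"
  then obtain w' where w': "length w' = length w \<and> lab w' = \<sigma> (lab w)" using emb_lab by blast
  from w' show ?thesis unfolding gword_def by (rule theI) (use w' in \<open>auto intro: lab_inj\<close>)
qed

lemma gword_eqI: "length w \<le> n \<Longrightarrow> length w' = length w \<Longrightarrow> lab w' = \<sigma> (lab w) \<Longrightarrow> gword \<sigma> w = w'"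
  using gword[of w] by (intro lab_inj) simp_all

lemma tree_map_gword: "tree_map n (gword \<sigma>)"
proof (rule tautI)
  show "inj_on (gword \<sigma>) {w. length w \<le> n}"
  proof (rule inj_onI)
    fix w w' assume "w \<in> {w. length w \<le> n}" "w' \<in> {w. length w \<le> n}" and eq: "gword \<sigma> w = gword \<sigma> w'"
    then have w: "length w \<le> n" "length w' \<le> n" by auto
    then have "length w = length w'" "\<sigma> (lab w) = \<sigma> (lab w')" using gword[of w] gword[of w'] eq by auto
    then show "w = w'" using \<sigma>D(6) w lab_Kn by (intro lab_inj) auto
  qed
  show "gword \<sigma> [] = []" by (rule gword_eqI) (simp_all add: lab_Nil \<sigma>D(3)[OF xK])
  fix w :: word and c assume w: "length w < n"
  have "basilica (\<sigma> (lab (w @ [c]))) = \<sigma> (lab w)"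
    using emb_basilica[of "lab (w @ [c])"] lab_Kn[of "w @ [c]" n] w by (simp add: basilica_lab)
  also have "\<dots> = lab (gword \<sigma> w)" using gword[of w] w by simp
  finally obtain d where "\<sigma> (lab (w @ [c])) = lab (gword \<sigma> w @ [d])" using basilica_eq_labD by blast
  then show "\<exists>d. gword \<sigma> (w @ [c]) = gword \<sigma> w @ [d]"
    using gword[of w] w by (intro exI[of _ d] gword_eqI) auto
qed

lemma gword_snoc: "length w < n \<Longrightarrow> gword \<sigma> (w @ [c]) = gword \<sigma> w @ [flip_letter (flips (gword \<sigma>) w) c]"
  using tree_map_gword by (simp add: tree_map_def)

text \<open>The exponent follows the recursion of \<open>R\<close>. The factor at
  \<open>w c a\<close> contributes \<open>2 R(w c a)\<close> once \<open>\<zeta> i\<close> is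
  written as the square of \<open>\<zeta> (Suc i)\<close>, and one more if the flip at
  \<open>w c\<close> replaces \<open>a\<close> by \<open>b\<close>; together this is
  \<open>Q(w c)\<close>. The two letters \<open>c\<close> add up to \<open>R(w)\<close>, and a flip
  at \<open>w\<close> merely interchanges the factors.\<close>

lemma emb_Pi_lab:
  "length w + d \<le> n \<Longrightarrow> 2 * i \<le> d \<Longrightarrow>
     \<sigma> (Pi_lab i w) = Pi_lab i (gword \<sigma> w) * \<zeta> i powi (- Rt (portrait d (flips (gword \<sigma>)) w))"
proof (induction i arbitrary: d w)
  case 0
  then show ?case using gword[of w] by (simp add: Pi_lab_0 zeta_0)
next
  case (Suc i)
  let ?\<pi> = "flips (gword \<sigma>)"
  obtain d' where d': "d = Suc (Suc d')" "2 * i \<le> d'"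
    using Suc.prems by (cases d; cases "d - 1") auto
  have step: "\<sigma> (Pi_lab i (w @ [c, LA])) =
      Pi_lab i (gword \<sigma> w @ [flip_letter (?\<pi> w) c, LA]) * \<zeta> (Suc i) powi (- Qt (portrait (Suc d') ?\<pi> (w @ [c])))" for c
  proof -
    have "\<sigma> (Pi_lab i (w @ [c, LA])) =
        Pi_lab i (gword \<sigma> (w @ [c, LA])) * \<zeta> i powi (- Rt (portrait d' ?\<pi> (w @ [c, LA])))"
      using Suc.prems d' by (intro Suc.IH) auto
    also have "gword \<sigma> (w @ [c, LA]) = gword \<sigma> (w @ [c]) @ [flip_letter (?\<pi> (w @ [c])) LA]"
      using gword_snoc[of "w @ [c]" LA] Suc.prems d' by simp
    also have "Pi_lab i \<dots> = Pi_lab i (gword \<sigma> (w @ [c]) @ [LA]) * \<zeta> (Suc i) powi (- of_bool (?\<pi> (w @ [c])))"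
      by (rule Pi_lab_flip)
    also have "gword \<sigma> (w @ [c]) = gword \<sigma> w @ [flip_letter (?\<pi> w) c]"
      using Suc.prems d' by (intro gword_snoc) simp
    also have "\<zeta> i powi (- Rt (portrait d' ?\<pi> (w @ [c, LA]))) = \<zeta> (Suc i) powi (2 * (- Rt (portrait d' ?\<pi> (w @ [c, LA]))))"
      by (rule zeta_double[symmetric])
    finally show ?thesis
      using zeta_nonzero[of "Suc i"] by (simp add: mult.assoc flip: power_int_add)
  qed
  have K: "Pi_lab i (w @ [c, LA]) \<in> Kn n" for c
    using Suc.prems by (intro Pi_lab_Kn) auto
  have "\<sigma> (Pi_lab (Suc i) w) = \<sigma> (Pi_lab i (w @ [LA, LA])) * \<sigma> (Pi_lab i (w @ [LB, LA]))"
    unfolding Pi_lab_Suc by (rule \<sigma>D(2)[OF K K])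
  also have "\<dots> = (Pi_lab i (gword \<sigma> w @ [flip_letter (?\<pi> w) LA, LA]) * Pi_lab i (gword \<sigma> w @ [flip_letter (?\<pi> w) LB, LA]))
     * \<zeta> (Suc i) powi (- Rt (portrait d ?\<pi> w))"
    unfolding step using zeta_nonzero[of "Suc i"] by (simp add: d' power_int_add power_int_diff power_int_minus field_simps)
  also have "Pi_lab i (gword \<sigma> w @ [flip_letter (?\<pi> w) LA, LA]) * Pi_lab i (gword \<sigma> w @ [flip_letter (?\<pi> w) LB, LA])
      = Pi_lab (Suc i) (gword \<sigma> w)"
    unfolding Pi_lab_Suc by (cases "?\<pi> w") simp_all
  finally show ?case .
qed

text \<open>Apply \<open>\<sigma>\<close> to the quotient of \<open>Pi_lab i (w @ [LA])\<close> by
  \<open>Pi_lab i (w @ [LB])\<close>. The two products contribute \<open>- 2 R(w a)\<close> and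
  \<open>2 R(w b)\<close> to the exponent, and a flip at \<open>w\<close> inverts the quotient of
  their images; in total this is \<open>P\<close>. The left side does not depend on
  \<open>w\<close>, which is the origin of the congruences that define \<open>M_n\<close>.\<close>

lemma emb_zeta:
  assumes "length w + d \<le> n" "2 * i < d"
  shows "\<sigma> (\<zeta> (Suc i)) = \<zeta> (Suc i) powi Pt (portrait d (flips (gword \<sigma>)) w)"
proof -
  let ?\<pi> = "flips (gword \<sigma>)" and ?z = "\<zeta> (Suc i)"
  obtain d' where d': "d = Suc d'" "2 * i \<le> d'" using assms by (cases d) auto
  define RA where "RA = Rt (portrait d' ?\<pi> (w @ [LA]))"
  define RB where "RB = Rt (portrait d' ?\<pi> (w @ [LB]))"
  let ?X = "Pi_lab i (gword \<sigma> w @ [LA])"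
  have z0: "?z \<noteq> 0" by (rule zeta_nonzero)
  have B: "Pi_lab i (y @ [LB]) = Pi_lab i (y @ [LA]) * ?z powi (-1)" for y
    using Pi_lab_flip[of i y True] by simp
  have img: "\<sigma> (Pi_lab i (w @ [c])) =
      Pi_lab i (gword \<sigma> w @ [flip_letter (?\<pi> w) c]) * ?z powi (2 * (- Rt (portrait d' ?\<pi> (w @ [c]))))" for c
    unfolding zeta_double using emb_Pi_lab[of "w @ [c]" d' i] gword_snoc[of w c] assms d' by simp
  have K: "Pi_lab i (w @ [LB]) \<in> Kn n" "?z \<in> Kn n"
    using assms by (auto intro: Pi_lab_Kn zeta_Kn)
  have "\<sigma> (Pi_lab i (w @ [LA])) = \<sigma> (Pi_lab i (w @ [LB])) * \<sigma> ?z"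
    unfolding Pi_lab_zeta(1)[of i w] by (rule \<sigma>D(2)[OF K])
  then have eq: "Pi_lab i (gword \<sigma> w @ [flip_letter (?\<pi> w) LA]) * ?z powi (- 2 * RA) =
      Pi_lab i (gword \<sigma> w @ [flip_letter (?\<pi> w) LB]) * ?z powi (- 2 * RB) * \<sigma> ?z"
    unfolding img by (simp add: RA_def RB_def)
  have P: "Pt (portrait d ?\<pi> w) = (if ?\<pi> w then - 1 else 1) + 2 * RB - 2 * RA"
    by (simp add: d' RA_def RB_def)
  have padd: "?z powi a * ?z powi b = ?z powi (a + b)" for a b
    using z0 by (simp add: power_int_add)
  have X0: "?X \<noteq> 0" by (rule Pi_lab_zeta(2))
  show ?thesis
  proof (cases "?\<pi> w")
    case True
    have "?X * (?z powi (-1) * ?z powi (- 2 * RA)) = ?X * (?z powi (- 2 * RB) * \<sigma> ?z)"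
      using eq True by (simp add: B mult.assoc)
    then have "?z powi (-1) * ?z powi (- 2 * RA) = ?z powi (- 2 * RB) * \<sigma> ?z"
      using X0 by simp
    then have "?z powi (2 * RB) * (?z powi (-1) * ?z powi (- 2 * RA)) =
        ?z powi (2 * RB) * ?z powi (- 2 * RB) * \<sigma> ?z"
      by (simp only: mult.assoc)
    moreover have "?z powi (2 * RB) * (?z powi (-1) * ?z powi (- 2 * RA)) = ?z powi (-1 + 2 * RB - 2 * RA)"
      unfolding padd by (rule arg_cong) simp
    moreover have "?z powi (2 * RB) * ?z powi (- 2 * RB) = 1"
      unfolding padd by simp
    ultimately show ?thesis unfolding P using True by (simp only: if_True mult_1)
  next
    case False
    have "?X * ?z powi (- 2 * RA) = ?X * (?z powi (-1) * ?z powi (- 2 * RB) * \<sigma> ?z)"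
      using eq False by (simp add: B mult.assoc)
    then have "?z powi (- 2 * RA) = ?z powi (-1) * ?z powi (- 2 * RB) * \<sigma> ?z"
      using X0 by simp
    then have "?z powi (1 + 2 * RB) * ?z powi (- 2 * RA) =
        ?z powi (1 + 2 * RB) * (?z powi (-1) * ?z powi (- 2 * RB)) * \<sigma> ?z"
      by (simp only: mult.assoc)
    moreover have "?z powi (1 + 2 * RB) * ?z powi (- 2 * RA) = ?z powi (1 + 2 * RB - 2 * RA)"
      unfolding padd by (rule arg_cong) simp
    moreover have "?z powi (1 + 2 * RB) * (?z powi (-1) * ?z powi (- 2 * RB)) = 1"
      unfolding padd by simp
    ultimately show ?thesis unfolding P using False by (simp only: if_False mult_1)
  qed
qed

end

definition ptree :: "nat \<Rightarrow> ('a \<Rightarrow> 'a) \<Rightarrow> btree" where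
  "ptree n \<sigma> = portrait n (flips (gword \<sigma>)) []"

lemma ptree_perfect: "ptree n \<sigma> \<in> perfect n"
  by (simp add: ptree_def)

lemma act_ptree: "\<sigma> \<in> Emb K (Kn n) \<Longrightarrow> length w \<le> n \<Longrightarrow> act (ptree n \<sigma>) w = gword \<sigma> w"
  unfolding ptree_def by (rule tree_map_eq_act[OF tree_map_gword, symmetric])

lemma lab_act_ptree: "\<sigma> \<in> Emb K (Kn n) \<Longrightarrow> length w \<le> n \<Longrightarrow> lab (act (ptree n \<sigma>) w) = \<sigma> (lab w)"
  by (simp add: act_ptree gword)

text \<open>Both values of \<open>P\<close> describe the action on one root of unity, the one of
  largest order whose defining products fit into the levels below \<open>u\<close>.\<close>

lemma ptree_Mt: "\<sigma> \<in> Emb K (Kn n) \<Longrightarrow> ptree n \<sigma> \<in> Mt n"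
  unfolding ptree_def portrait_in_Mt
proof (intro allI impI)
  fix u :: word assume \<sigma>: "\<sigma> \<in> Emb K (Kn n)" and u: "length u \<le> n"
  let ?k = "Suc (n - length u) div 2"
  show "[Pt (portrait (n - length u) (flips (gword \<sigma>)) ([] @ u)) = Pt (portrait n (flips (gword \<sigma>)) [])] (mod 2 ^ ?k)"
  proof (cases ?k)
    case (Suc i)
    then have i: "2 * i < n - length u" by linarith
    then have "\<zeta> ?k powi Pt (portrait (n - length u) (flips (gword \<sigma>)) u) = \<zeta> ?k powi Pt (portrait n (flips (gword \<sigma>)) [])"
      unfolding Suc using emb_zeta[OF \<sigma>, of u "n - length u" i] emb_zeta[OF \<sigma>, of "[]" n i] u by simp
    then show ?thesis by (simp add: zeta_powi_eq)
  qed simp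
qed

lemma ptree_inj: "inj_on (ptree n) (Emb K (Kn n))"
proof (rule inj_onI)
  fix \<sigma> \<tau> assume \<sigma>: "\<sigma> \<in> Emb K (Kn n)" and \<tau>: "\<tau> \<in> Emb K (Kn n)" and eq: "ptree n \<sigma> = ptree n \<tau>"
  have "\<sigma> z = \<tau> z" if z: "z \<in> iter_preimage basilica x n" for z
  proof -
    obtain w where "length w = n" "z = lab w" using z unfolding iter_preimage_lab by blast
    then show ?thesis using lab_act_ptree[OF \<sigma>, of w] lab_act_ptree[OF \<tau>, of w] eq by simp
  qed
  then show "\<sigma> = \<tau>"
    using \<sigma> \<tau> K EmbD(3)[OF \<sigma> K sfield_Kn] EmbD(3)[OF \<tau> K sfield_Kn]
    unfolding Kn_def by (intro Emb_eqI) auto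
qed

text \<open>\<open>Kn n\<close> is normal over \<open>K\<close>: an embedding permutes the labels of
  level \<open>n\<close>, which generate it.\<close>

lemma Gal_Kn: "carrier (Gal (Kn n) K) = Emb K (Kn n)"
proof -
  have "\<sigma> \<in> Bij (Kn n)" if \<sigma>: "\<sigma> \<in> Emb K (Kn n)" for \<sigma>
    unfolding Kn_def
  proof (rule Emb_normal_Bij[OF K finite_iter_preimage])
    show "\<sigma> \<in> Emb K (adjoin K (iter_preimage basilica x n))" using \<sigma> by (simp add: Kn_def)
    show "\<sigma> ` iter_preimage basilica x n \<subseteq> iter_preimage basilica x n"
    proof
      fix z assume "z \<in> \<sigma> ` iter_preimage basilica x n"
      then obtain w where "length w = n" "z = \<sigma> (lab w)" by (auto simp: iter_preimage_lab)
      then show "z \<in> iter_preimage basilica x n"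
        using gword[OF \<sigma>, of w] by (auto simp: iter_preimage_lab intro!: image_eqI[of _ _ "gword \<sigma> w"])
    qed
  qed
  then show ?thesis unfolding carrier_Gal by blast
qed

lemma Emb_compose:
  assumes "\<sigma> \<in> Emb K (Kn n)" "\<tau> \<in> Emb K (Kn n)"
  shows "compose (Kn n) \<sigma> \<tau> \<in> Emb K (Kn n)"
proof -
  have \<tau>: "\<tau> z \<in> Kn n" if "z \<in> Kn n" for z
    using assms(2) that Gal_Kn[of n] carrier_Gal[of "Kn n" K] by (auto simp: Bij_def bij_betw_def)
  note D = EmbD[OF assms(1) K sfield_Kn] and D' = EmbD[OF assms(2) K sfield_Kn]
  show ?thesis
    unfolding Emb_def using K_Kn[of n]
    by (auto simp: compose_def D D' \<tau> sfieldD(3,5)[OF sfield_Kn] subset_iff)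
qed

lemma ptree_compose:
  assumes \<sigma>: "\<sigma> \<in> Emb K (Kn n)" and \<tau>: "\<tau> \<in> Emb K (Kn n)"
  shows "ptree n (compose (Kn n) \<sigma> \<tau>) = tcomp (ptree n \<sigma>) (ptree n \<tau>)"
proof (rule act_inject[of _ n])
  fix w :: word assume w: "length w \<le> n"
  have "act (ptree n (compose (Kn n) \<sigma> \<tau>)) w = act (ptree n \<sigma>) (act (ptree n \<tau>) w)"
    by (rule lab_inj)
      (use w lab_act_ptree[OF Emb_compose[OF \<sigma> \<tau>] w] lab_act_ptree[OF \<sigma>] lab_act_ptree[OF \<tau>] lab_Kn in
        \<open>simp_all add: compose_def\<close>)
  then show "act (ptree n (compose (Kn n) \<sigma> \<tau>)) w = act (tcomp (ptree n \<sigma>) (ptree n \<tau>)) w"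
    by (simp add: act_tcomp[OF ptree_perfect ptree_perfect])
qed (simp_all add: ptree_perfect tcomp_perfect)

lemma id_Emb: "restrict (\<lambda>z. z) (Kn n) \<in> Emb K (Kn n)"
  using K_Kn[of n] by (auto simp: Emb_def sfieldD(3,5)[OF sfield_Kn] subset_iff)

lemma subgroup_image: "subgroup (ptree n ` Emb K (Kn n)) (Mgrp n)"
proof (rule finite_closed_subgroup_Mgrp)
  show "ptree n ` Emb K (Kn n) \<subseteq> Mt n" using ptree_Mt by blast
  show "ptree n ` Emb K (Kn n) \<noteq> {}" using id_Emb by blast
  fix s t assume "s \<in> ptree n ` Emb K (Kn n)" "t \<in> ptree n ` Emb K (Kn n)"
  then obtain \<sigma> \<tau> where st: "\<sigma> \<in> Emb K (Kn n)" "s = ptree n \<sigma>" "\<tau> \<in> Emb K (Kn n)" "t = ptree n \<tau>"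
    by blast
  then have "tcomp s t = ptree n (compose (Kn n) \<sigma> \<tau>)" by (simp add: ptree_compose)
  then show "tcomp s t \<in> ptree n ` Emb K (Kn n)" using Emb_compose st by blast
qed

text \<open>Injectivity of \<open>ptree\<close> and finiteness turn surjectivity into a count, the
  link between degrees and \<open>M_n\<close>.\<close>

lemma image_eq_iff: "ptree n ` Emb K (Kn n) = Mt n \<longleftrightarrow> card (Emb K (Kn n)) = card (Mt n)"
proof
  assume "card (Emb K (Kn n)) = card (Mt n)"
  then have "card (ptree n ` Emb K (Kn n)) = card (Mt n)" by (simp add: card_image[OF ptree_inj])
  then show "ptree n ` Emb K (Kn n) = Mt n"
    using ptree_Mt by (intro card_subset_eq[OF finite_Mt]) auto
next
  assume "ptree n ` Emb K (Kn n) = Mt n"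
  then show "card (Emb K (Kn n)) = card (Mt n)" using card_image[OF ptree_inj, of n] by simp
qed

end

section \<open>Restriction from M_infinity to M_n\<close>

lemma act_trunc: "length w \<le> n \<Longrightarrow> act (trunc n t) w = act t w"
proof (induction n arbitrary: t w)
  case (Suc n)
  show ?case
  proof (cases t)
    case (Node e g h)
    then show ?thesis using Suc by (cases w) (auto split: letter.splits)
  qed simp
qed simp

lemma Mt_lift_le:
  assumes "t \<in> Mt n" "n \<le> m"
  shows "\<exists>t'\<in>Mt m. trunc n t' = t"
  using assms(2)
proof (induction m rule: dec_induct)
  case base
  then show ?case using trunc_self[OF Mt_perfect] assms(1) by blast
next
  case (step m)
  then obtain t' where t': "t' \<in> Mt m" "trunc n t' = t" by blast
  obtain t'' where "t'' \<in> Mt (Suc m)" "trunc m t'' = t'" using Mt_lift[OF t'(1)] by blast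
  then show ?case using t'(2) trunc_trunc[OF step.hyps(1), of t''] by auto
qed

lemma tree_map_cong:
  assumes "tree_map n \<sigma>" and eq: "\<And>w. length w \<le> n \<Longrightarrow> \<tau> w = \<sigma> w"
  shows "tree_map n \<tau>"
  unfolding tree_map_def
proof (intro conjI allI impI)
  show "\<tau> [] = []" using assms(1) eq[of "[]"] by (simp add: tree_map_def)
  fix w :: word and c assume w: "length w < n"
  then have "flips \<tau> w = flips \<sigma> w" by (intro flips_eq[of w n] eq)
  then show "\<tau> (w @ [c]) = \<tau> w @ [flip_letter (flips \<tau> w) c]"
    using assms(1) w eq[of w] eq[of "w @ [c]"] by (simp add: tree_map_def)
qed

lemma portrait_flips_cong:
  assumes "\<And>w. length w \<le> n \<Longrightarrow> \<tau> w = \<sigma> w"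
  shows "portrait n (flips \<tau>) [] = portrait n (flips \<sigma>) []"
proof (rule portrait_cong)
  fix w :: word assume "length w < length ([] :: word) + n"
  then have "length w < n" by simp
  then show "flips \<tau> w = flips \<sigma> w" by (rule flips_eq) (rule assms)
qed

lemma tree_aut_word_treeI:
  assumes "\<And>n. tree_map n \<sigma>"
  shows "\<sigma> \<in> tree_aut word_tree"
proof -
  let ?t = "\<lambda>n. portrait n (flips \<sigma>) []"
  have act: "\<sigma> w = act (?t n) w" if "length w \<le> n" for w n
    by (rule tree_map_eq_act[OF assms that])
  have len: "length (\<sigma> w) = length w" for w using act[of w "length w"] by simp
  have "inj \<sigma>"
  proof (rule injI)
    fix u v assume eq: "\<sigma> u = \<sigma> v"
    then have "length u = length v" using len by metis
    then have "act (?t (length u)) u = act (?t (length u)) v"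
      using eq act[of u "length u"] act[of v "length u"] by simp
    then show "u = v" using act_inj[OF portrait_perfect] by (auto dest: injD)
  qed
  moreover have "w \<in> range \<sigma>" for w
    using act[of "act (tinv (?t (length w))) w" "length w"] act_tinv(2)[OF portrait_perfect]
    by (metis length_act order_refl rangeI)
  then have "surj \<sigma>" by blast
  moreover have "adjacent word_tree (\<sigma> u) (\<sigma> v) \<longleftrightarrow> adjacent word_tree u v" for u v
    using act_adjacent[OF portrait_perfect[of "max (length u) (length v)" "flips \<sigma>" "[]"], of u v]
      act[of u "max (length u) (length v)"] act[of v "max (length u) (length v)"]
    by (simp del: nodes_word_tree(5))
  moreover have "\<sigma> [] = []" using len[of "[]"] by simp
  ultimately show ?thesis
    by (simp add: tree_aut_def tree_iso_def Bij_def bij_def del: nodes_word_tree(5))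
qed

text \<open>Repeated lifting by one level gives a coherent sequence of portraits, which glue to one
  automorphism of the infinite tree.\<close>

lemma M_group_infinity_restricts_onto:
  assumes t: "t \<in> Mt n"
  shows "\<exists>\<sigma>\<in>carrier M_group_infinity. portrait n (flips \<sigma>) [] = t"
proof -
  have "\<exists>T. \<forall>k. (T k \<in> Mt (n + k) \<and> (k = 0 \<longrightarrow> T k = t)) \<and> trunc (n + k) (T (Suc k)) = T k"
    by (rule dependent_nat_choice[where P = "\<lambda>k s. s \<in> Mt (n + k) \<and> (k = 0 \<longrightarrow> s = t)"
          and Q = "\<lambda>k s s'. trunc (n + k) s' = s"])
      (use t Mt_lift in \<open>auto simp: Bex_def\<close>)
  then obtain T where T: "\<And>k. T k \<in> Mt (n + k)" "T 0 = t" "\<And>k. trunc (n + k) (T (Suc k)) = T k"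
    by blast
  have stab: "trunc (n + j) (T k) = T j" if "j \<le> k" for j k
    using that
  proof (induction k rule: dec_induct)
    case base
    show ?case using trunc_self[OF Mt_perfect[OF T(1)]] .
  next
    case (step k)
    then show ?case using trunc_trunc[of "n + j" "n + k" "T (Suc k)"] T(3)[of k] by simp
  qed
  have agree: "act (T k) w = act (T j) w" if "j \<le> k" "length w \<le> n + j" for j k w
    using act_trunc[OF that(2), of "T k"] stab[OF that(1)] by simp
  \<comment> \<open>Any portrait of the sequence that reaches \<open>w\<close> would do;
    \<open>T (length w)\<close> has height \<open>n + length w\<close>.\<close>
  define \<sigma> where "\<sigma> w = act (T (length w)) w" for w
  have \<sigma>: "\<sigma> w = act (T k) w" if "length w \<le> n + k" for w k
    using agree[of k "length w" w] agree[of "length w" k w] that unfolding \<sigma>_def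
    by (cases "k \<le> length w") simp_all
  have tree_map: "tree_map (n + k) \<sigma>" for k
    by (rule tree_map_cong[OF tree_map_act[OF Mt_perfect[OF T(1)[of k]]]]) (rule \<sigma>)
  have portrait: "portrait (n + k) (flips \<sigma>) [] = T k" for k
    using portrait_flips_cong[of "n + k" \<sigma> "act (T k)", OF \<sigma>] portrait_act[OF Mt_perfect[OF T(1)[of k]]] by simp
  have "tree_map m \<sigma>" for m by (rule tree_map_mono[OF tree_map[of m]]) simp
  then have "\<sigma> \<in> tree_aut word_tree" by (rule tree_aut_word_treeI)
  moreover have "portrait m (flips \<sigma>) [] \<in> Mt m" for m
    using Mt_trunc[OF T(1)[of m], of m] trunc_portrait[of m "n + m" "flips \<sigma>" "[]"] portrait[of m] by simp
  ultimately have "\<sigma> \<in> carrier M_group_infinity" by (simp add: carrier_M_group_infinity)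
  moreover have "portrait n (flips \<sigma>) [] = t" using portrait[of 0] T(2) by simp
  ultimately show ?thesis by blast
qed

lemma M_group_mult:
  assumes "s \<in> Mt n" "t \<in> Mt n"
  shows "wact n s \<otimes>\<^bsub>M_group n\<^esub> wact n t = wact n (tcomp s t)"
proof -
  have p: "s \<in> perfect n" "t \<in> perfect n" using assms by (simp_all add: Mt_perfect)
  have B: "wact n s \<in> Bij {w. length w \<le> n}" "wact n t \<in> Bij {w. length w \<le> n}"
    using wact_tree_aut[OF p(1)] wact_tree_aut[OF p(2)] by (simp_all add: tree_aut_def)
  have "compose {w. length w \<le> n} (wact n s) (wact n t) = wact n (tcomp s t)"
    using p by (auto simp: compose_def wact_def act_tcomp[of _ n])
  then show ?thesis using B by (simp add: M_group_def BijGroup_def)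
qed

text \<open>Square roots over \<open>K\<close> remain square roots over a larger base. It allows
  embeddings to be extended to \<open>Kn n\<close> from the field of degree 16 instead of from
  \<open>K\<close>.\<close>

lemma qtower_compositum:
  assumes "sfield F" "K \<subseteq> F"
  shows "qtower K E \<Longrightarrow> qtower F (adjoin F E)"
proof (induction rule: qtower.induct)
  case refl
  show ?case using assms by (simp add: adjoin_absorb qtower.refl)
next
  case (step E r)
  have "adjoin F (adjoin E {r}) = adjoin (adjoin F E) {r}"
  proof (rule adjoin_eqI[OF sfield_adjoin])
    show "F \<subseteq> adjoin (adjoin F E) {r}" using adjoin_incl(1) by blast
    show "adjoin E {r} \<subseteq> adjoin (adjoin F E) {r}"
      using adjoin_incl(2)[of E F] adjoin_incl[where F = "adjoin F E" and S = "{r}"]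
      by (intro adjoin_least sfield_adjoin) auto
    have "r \<in> adjoin F (adjoin E {r})" "E \<subseteq> adjoin F (adjoin E {r})"
      using adjoin_incl[where F = E and S = "{r}"] adjoin_incl(2)[of "adjoin E {r}" F] by auto
    then show "adjoin (adjoin F E) {r} \<subseteq> adjoin F (adjoin E {r})"
      using adjoin_incl(1)[of F "adjoin E {r}"] by (intro adjoin_least sfield_adjoin) auto
  qed
  moreover have "r * r \<in> adjoin F E" using step.hyps(2) adjoin_incl(2)[of E F] by auto
  ultimately show ?case using step.IH by (simp add: qtower.step)
qed

section \<open>Equivariant isomorphisms with M_n\<close>

context arboreal
begin

abbreviation full :: "nat \<Rightarrow> bool" where
  "full n \<equiv> ptree n ` Emb K (Kn n) = Mt n"

lemma has_degree_Kn: "has_degree (Kn n) K d \<longleftrightarrow> card (Emb K (Kn n)) = d"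
  using qtower_degree[OF two K qtower_K_Kn[of n]] has_degree_unique[OF K] by blast

lemma has_degree_K5_iff: "has_degree (Kn 5) K (2 ^ 25) \<longleftrightarrow> full 5"
  unfolding has_degree_Kn image_eq_iff card_Mt_5 ..

definition node_of_word :: "word \<Rightarrow> nat \<times> 'a" where
  "node_of_word w = (length w, lab w)"

definition word_of_node :: "nat \<times> 'a \<Rightarrow> word" where
  "word_of_node = inv_into UNIV node_of_word"

lemma inj_node_of_word: "inj node_of_word"
  unfolding node_of_word_def using bij_betw_imp_inj_on[OF lab_bij] .

lemma word_of_node [simp]: "word_of_node (node_of_word w) = w"
  unfolding word_of_node_def by (rule inv_f_f[OF inj_node_of_word])

lemma preimage_tree_simps [simp]:
  "nodes (preimage_tree basilica x) = range node_of_word"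
  "root (preimage_tree basilica x) = node_of_word []"
  "root (preimage_tree_upto basilica x n) = node_of_word []"
  "nodes (preimage_tree_upto basilica x n) = node_of_word ` {w. length w \<le> n}"
proof -
  show "nodes (preimage_tree basilica x) = range node_of_word"
    using bij_betw_imp_surj_on[OF lab_bij] by (simp add: preimage_tree_def node_of_word_def)
  show "nodes (preimage_tree_upto basilica x n) = node_of_word ` {w. length w \<le> n}"
    unfolding preimage_tree_upto_def node_of_word_def by (auto simp: iter_preimage_lab image_iff)
qed (simp_all add: preimage_tree_def preimage_tree_upto_def node_of_word_def lab_Nil)

lemma adjacent_node_of_word:
  "adjacent (preimage_tree basilica x) (node_of_word u) (node_of_word v) \<longleftrightarrow> adjacent word_tree u v"
proof -
  have *: "(length v = Suc (length u) \<and> basilica (lab v) = lab u) \<longleftrightarrow> (\<exists>c. v = u @ [c])" for u v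
  proof
    assume "length v = Suc (length u) \<and> basilica (lab v) = lab u"
    moreover from this obtain c where "lab v = lab (u @ [c])" using basilica_eq_labD by blast
    ultimately show "\<exists>c. v = u @ [c]" using lab_inj[of v "u @ [c]"] by auto
  qed (auto simp: basilica_lab)
  show ?thesis
    using *[of v u] *[of u v] by (auto simp: preimage_tree_def node_of_word_def)
qed

lemma adjacent_preimage_tree_upto:
  "adjacent (preimage_tree_upto basilica x n) = adjacent (preimage_tree basilica x)"
  by (simp add: preimage_tree_upto_def)

lemma tree_iso_word_of_node:
  "tree_iso (preimage_tree_upto basilica x n) (word_tree_upto n) word_of_node"
  "tree_iso (preimage_tree basilica x) word_tree word_of_node"
proof -
  have "bij_betw word_of_node (node_of_word ` A) A" for A
    by (rule bij_betw_byWitness[where f' = node_of_word]) auto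
  then show "tree_iso (preimage_tree_upto basilica x n) (word_tree_upto n) word_of_node"
    "tree_iso (preimage_tree basilica x) word_tree word_of_node"
    using adjacent_node_of_word by (auto simp: tree_iso_def adjacent_preimage_tree_upto)
qed

lemma galois_action_node: "\<sigma> \<in> Emb K (Kn n) \<Longrightarrow> length w \<le> n \<Longrightarrow>
    galois_action \<sigma> (node_of_word w) = node_of_word (gword \<sigma> w)"
  using gword[of \<sigma> n w] by (simp add: galois_action_def node_of_word_def)

text \<open>An isomorphism of any kind already forces equal orders, which gives surjectivity of
  \<open>ptree\<close> by counting. Conversely the labeling itself provides the tree
  isomorphism.\<close>

lemma iso_M_group_iff:
  "iso_acting_on_trees (Gal (Kn n) K) galois_action (preimage_tree_upto basilica x n)
     (M_group n) (\<lambda>\<tau> w. \<tau> w) (word_tree_upto n) \<longleftrightarrow> full n"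
proof
  assume "iso_acting_on_trees (Gal (Kn n) K) galois_action (preimage_tree_upto basilica x n)
     (M_group n) (\<lambda>\<tau> w. \<tau> w) (word_tree_upto n)"
  then obtain \<phi> where "bij_betw \<phi> (Emb K (Kn n)) (wact n ` Mt n)"
    by (auto simp: iso_acting_on_trees_def iso_def Gal_Kn carrier_M_group)
  then have "card (Emb K (Kn n)) = card (wact n ` Mt n)" by (rule bij_betw_same_card)
  also have "\<dots> = card (Mt n)"
    using inj_on_subset[OF inj_on_wact, of "Mt n" n] Mt_perfect by (intro card_image) blast
  finally show "full n" by (simp add: image_eq_iff)
next
  assume full: "full n"
  let ?\<phi> = "\<lambda>\<sigma>. wact n (ptree n \<sigma>)"
  have "?\<phi> \<in> hom (Gal (Kn n) K) (M_group n)"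
  proof (rule homI)
    fix \<sigma> assume "\<sigma> \<in> carrier (Gal (Kn n) K)"
    then show "?\<phi> \<sigma> \<in> carrier (M_group n)" by (simp add: Gal_Kn carrier_M_group ptree_Mt)
  next
    fix \<sigma> \<tau> assume st: "\<sigma> \<in> carrier (Gal (Kn n) K)" "\<tau> \<in> carrier (Gal (Kn n) K)"
    then have E: "\<sigma> \<in> Emb K (Kn n)" "\<tau> \<in> Emb K (Kn n)" by (simp_all add: Gal_Kn)
    have "\<sigma> \<in> Bij (Kn n)" "\<tau> \<in> Bij (Kn n)" using st by (simp_all add: carrier_Gal)
    then have "\<sigma> \<otimes>\<^bsub>Gal (Kn n) K\<^esub> \<tau> = compose (Kn n) \<sigma> \<tau>" by (simp add: Gal_def BijGroup_def)
    then show "?\<phi> (\<sigma> \<otimes>\<^bsub>Gal (Kn n) K\<^esub> \<tau>) = ?\<phi> \<sigma> \<otimes>\<^bsub>M_group n\<^esub> ?\<phi> \<tau>"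
      using E by (simp add: ptree_compose M_group_mult ptree_Mt)
  qed
  moreover have "bij_betw ?\<phi> (carrier (Gal (Kn n) K)) (carrier (M_group n))"
  proof (rule bij_betw_imageI)
    show "inj_on ?\<phi> (carrier (Gal (Kn n) K))"
      unfolding Gal_Kn
      by (rule comp_inj_on[OF ptree_inj inj_on_subset[OF inj_on_wact], unfolded o_def])
        (auto simp: ptree_perfect)
    show "?\<phi> ` carrier (Gal (Kn n) K) = carrier (M_group n)"
      unfolding Gal_Kn carrier_M_group full[symmetric] by (simp add: image_image)
  qed
  ultimately have iso: "?\<phi> \<in> iso (Gal (Kn n) K) (M_group n)" by (simp add: iso_def)
  have eqv: "word_of_node (galois_action g v) = ?\<phi> g (word_of_node v)"
    if "g \<in> carrier (Gal (Kn n) K)" "v \<in> nodes (preimage_tree_upto basilica x n)" for g v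
    using that by (auto simp: Gal_Kn galois_action_node wact_def act_ptree)
  show "iso_acting_on_trees (Gal (Kn n) K) galois_action (preimage_tree_upto basilica x n)
     (M_group n) (\<lambda>\<tau> w. \<tau> w) (word_tree_upto n)"
    unfolding iso_acting_on_trees_def
    by (intro bexI[OF _ iso] exI[of _ word_of_node] conjI ballI tree_iso_word_of_node eqv)
qed

lemma gword_cong: "\<sigma> (lab w) = \<tau> (lab w) \<Longrightarrow> gword \<sigma> w = gword \<tau> w"
  by (simp add: gword_def)

lemma gword_restrict: "length w \<le> n \<Longrightarrow> gword (restrict \<sigma> (Kn n)) w = gword \<sigma> w"
  by (rule gword_cong) (simp add: lab_Kn)

lemma Emb_restrict_Kn: "\<sigma> \<in> Emb K (Kn m) \<Longrightarrow> n \<le> m \<Longrightarrow> restrict \<sigma> (Kn n) \<in> Emb K (Kn n)"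
  by (rule Emb_restrict[OF _ Kn_mono sfield_Kn K_Kn])

lemma ptree_restrict: "n \<le> m \<Longrightarrow> ptree n (restrict \<sigma> (Kn n)) = trunc n (ptree m \<sigma>)"
  unfolding ptree_def by (simp only: trunc_portrait) (rule portrait_flips_cong, rule gword_restrict)

text \<open>Restricting embeddings corresponds to truncating portraits, and truncation from
  \<open>Mt m\<close> to \<open>Mt n\<close> is onto by \<open>Mt_lift_le\<close>.\<close>

lemma full_mono:
  assumes "full m" "n \<le> m"
  shows "full n"
proof (intro equalityI subsetI)
  fix t assume "t \<in> Mt n"
  then obtain t' where t': "t' \<in> Mt m" "trunc n t' = t" using Mt_lift_le[OF _ assms(2)] by blast
  then have "t' \<in> ptree m ` Emb K (Kn m)" by (simp only: assms(1))
  then obtain \<sigma> where \<sigma>: "\<sigma> \<in> Emb K (Kn m)" "t' = ptree m \<sigma>" by blast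
  then have "t = ptree n (restrict \<sigma> (Kn n))" using ptree_restrict[OF assms(2), of \<sigma>] t'(2) by simp
  then show "t \<in> ptree n ` Emb K (Kn n)" using Emb_restrict_Kn[OF \<sigma>(1) assms(2)] by blast
qed (auto simp: ptree_Mt)

section \<open>The infinite level\<close>

abbreviation Kinf :: "'a set" where
  "Kinf \<equiv> arboreal_field_infinity K basilica x"

lemma Kinf_def: "Kinf = (\<Union>n. Kn n)"
  by (simp add: arboreal_field_infinity_def)

lemma Kn_Kinf: "Kn n \<subseteq> Kinf"
  by (auto simp: Kinf_def)

lemma Kinf_two:
  assumes "u \<in> Kinf" "v \<in> Kinf"
  obtains n where "u \<in> Kn n" "v \<in> Kn n"
proof -
  obtain m k where "u \<in> Kn m" "v \<in> Kn k" using assms by (auto simp: Kinf_def)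
  then show thesis using that[of "max m k"] Kn_mono[of m "max m k"] Kn_mono[of k "max m k"] by auto
qed

lemma K_Kinf: "K \<subseteq> Kinf"
  using K_Kn[of 0] Kn_Kinf[of 0] by blast

lemma sfield_Kinf: "sfield Kinf"
proof (rule sfieldI)
  show "1 \<in> Kinf" using sfieldD(1)[OF K] K_Kinf by blast
  fix u assume u: "u \<in> Kinf"
  then obtain n where n: "u \<in> Kn n" by (auto simp: Kinf_def)
  show "- u \<in> Kinf" "inverse u \<in> Kinf"
    using sfieldD(4,6)[OF sfield_Kn n] Kn_Kinf[of n] by auto
  fix v assume "v \<in> Kinf"
  then obtain m where "u \<in> Kn m" "v \<in> Kn m" using Kinf_two u by blast
  then show "u + v \<in> Kinf" "u * v \<in> Kinf"
    using sfieldD(3,5)[OF sfield_Kn[of m]] Kn_Kinf[of m] by auto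
qed

lemma Emb_Kinf_restrict: "\<sigma> \<in> Emb K Kinf \<Longrightarrow> restrict \<sigma> (Kn n) \<in> Emb K (Kn n)"
  by (rule Emb_restrict[OF _ Kn_Kinf sfield_Kn K_Kn])

lemma gword_Kinf:
  assumes "\<sigma> \<in> Emb K Kinf"
  shows "length (gword \<sigma> w) = length w" "lab (gword \<sigma> w) = \<sigma> (lab w)"
  using gword[OF Emb_Kinf_restrict[OF assms, of "length w"], of w] gword_restrict[of w "length w" \<sigma>]
    lab_Kn[of w "length w"] by simp_all

lemma galois_action_Kinf: "\<sigma> \<in> Emb K Kinf \<Longrightarrow> galois_action \<sigma> (node_of_word w) = node_of_word (gword \<sigma> w)"
  by (simp add: galois_action_def node_of_word_def gword_Kinf)

lemma portrait_gword_Kinf: "portrait n (flips (gword \<sigma>)) [] = ptree n (restrict \<sigma> (Kn n))"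
  unfolding ptree_def by (rule portrait_flips_cong) (simp add: gword_restrict)

lemma gword_M_infinity:
  assumes \<sigma>: "\<sigma> \<in> Emb K Kinf"
  shows "gword \<sigma> \<in> carrier M_group_infinity"
proof -
  have "tree_map n (gword \<sigma>)" for n
    by (rule tree_map_cong[OF tree_map_gword[OF Emb_Kinf_restrict[OF \<sigma>, of n]]]) (simp add: gword_restrict)
  then show ?thesis
    using ptree_Mt[OF Emb_Kinf_restrict[OF \<sigma>]]
    by (simp add: carrier_M_group_infinity tree_aut_word_treeI portrait_gword_Kinf)
qed

lemma gword_Kinf_inj: "inj_on gword (Emb K Kinf)"
proof (rule inj_onI)
  fix \<sigma> \<tau> assume \<sigma>: "\<sigma> \<in> Emb K Kinf" and \<tau>: "\<tau> \<in> Emb K Kinf" and eq: "gword \<sigma> = gword \<tau>"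
  show "\<sigma> = \<tau>"
  proof (rule extensionalityI[of _ Kinf])
    fix z assume "z \<in> Kinf"
    then obtain n where n: "z \<in> Kn n" by (auto simp: Kinf_def)
    have "ptree n (restrict \<sigma> (Kn n)) = ptree n (restrict \<tau> (Kn n))"
      by (simp add: eq flip: portrait_gword_Kinf)
    then have "restrict \<sigma> (Kn n) = restrict \<tau> (Kn n)"
      using inj_onD[OF ptree_inj] Emb_Kinf_restrict[OF \<sigma>] Emb_Kinf_restrict[OF \<tau>] by blast
    then show "\<sigma> z = \<tau> z" using n by (metis restrict_apply')
  qed (use \<sigma> \<tau> in \<open>simp_all add: Emb_def\<close>)
qed

text \<open>Fullness gives for each \<open>n\<close> an embedding \<open>h n\<close> with the
  prescribed portrait; injectivity of \<open>ptree\<close> makes these compatible, so they glue on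
  the union of the fields.\<close>

lemma gword_Kinf_surj:
  assumes full: "\<And>n. full n" and \<sigma>: "\<sigma> \<in> carrier M_group_infinity"
  shows "\<exists>g\<in>Bij Kinf \<inter> Emb K Kinf. gword g = \<sigma>"
proof -
  have tree_map: "tree_map n \<sigma>" and M: "portrait n (flips \<sigma>) [] \<in> Mt n" for n
    using \<sigma> by (auto simp: carrier_M_group_infinity tree_aut_word_tree_tree_map)
  have "\<exists>h. h \<in> Emb K (Kn n) \<and> ptree n h = portrait n (flips \<sigma>) []" for n
    using M[of n] full[of n] by (metis imageE)
  then obtain h where h: "\<And>n. h n \<in> Emb K (Kn n)" "\<And>n. ptree n (h n) = portrait n (flips \<sigma>) []"
    by metis
  note D = EmbD[OF h(1) K sfield_Kn]
  have res: "restrict (h m) (Kn n) = h n" if "n \<le> m" for n m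
    by (rule inj_onD[OF ptree_inj])
      (use that h ptree_restrict[OF that, of "h m"] Emb_restrict_Kn[OF h(1) that] in \<open>simp_all add: trunc_portrait\<close>)
  have agree: "h m z = h n z" if "z \<in> Kn n" "z \<in> Kn m" for m n z
  proof -
    have *: "h m z = h n z" if "z \<in> Kn n" "n \<le> m" for m n
      using res[OF that(2)] that(1) by (metis restrict_apply')
    show ?thesis using *[of n m] *[of m n] that by (cases "n \<le> m") auto
  qed
  define g where "g = restrict (\<lambda>z. h (SOME n. z \<in> Kn n) z) Kinf"
  have g: "g z = h n z" if "z \<in> Kn n" for z n
  proof -
    have some: "z \<in> Kn (SOME n. z \<in> Kn n)" using that by (rule someI)
    have "z \<in> Kinf" using Kn_Kinf that by blast
    then have "g z = h (SOME n. z \<in> Kn n) z" by (simp add: g_def)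
    also have "\<dots> = h n z" by (rule agree[OF that some])
    finally show ?thesis .
  qed
  have emb: "g \<in> Emb K Kinf"
    unfolding Emb_def mem_Collect_eq
  proof (intro conjI ballI)
    show "g \<in> extensional Kinf" by (simp add: g_def)
    show "g z = z" if "z \<in> K" for z
      using g[of z 0] D(3)[OF that, of 0] K_Kn[of 0] that by auto
    fix u v assume "u \<in> Kinf" "v \<in> Kinf"
    then obtain n where "u \<in> Kn n" "v \<in> Kn n" by (rule Kinf_two)
    then show "g (u + v) = g u + g v" "g (u * v) = g u * g v"
      using D(1,2)[of u n v] g sfieldD(3,5)[OF sfield_Kn, of u n v] by simp_all
  qed
  have "h n \<in> Bij (Kn n)" for n
    using h(1)[of n] Gal_Kn[of n] carrier_Gal[of "Kn n" K] by blast
  then have im: "h n ` Kn n = Kn n" for n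
    by (auto simp: Bij_def bij_betw_def)
  have "g ` Kinf = (\<Union>n. h n ` Kn n)"
    unfolding Kinf_def image_UN using g by (intro SUP_cong image_cong) auto
  then have "g ` Kinf = Kinf" by (simp add: im Kinf_def)
  moreover have "inj_on g Kinf" using EmbD(6)[OF emb K sfield_Kinf] by (intro inj_onI)
  ultimately have "g \<in> Bij Kinf" using emb by (simp add: Bij_def bij_betw_def Emb_def)
  moreover have "gword g = \<sigma>"
  proof
    fix w
    have "gword g w = gword (h (length w)) w" by (rule gword_cong) (simp add: g[OF lab_Kn])
    also have "\<dots> = act (ptree (length w) (h (length w))) w" by (simp add: act_ptree[OF h(1)])
    also have "\<dots> = \<sigma> w" unfolding h(2) by (rule tree_map_eq_act[OF tree_map, symmetric]) simp
    finally show "gword g w = \<sigma> w" .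
  qed
  ultimately show ?thesis using emb by blast
qed

lemma tree_aut_Bij: "\<sigma> \<in> carrier M_group_infinity \<Longrightarrow> \<sigma> \<in> Bij UNIV"
  by (simp add: carrier_M_group_infinity tree_aut_def)

lemma iso_M_group_infinityI:
  assumes full: "\<And>n. full n"
  shows "iso_acting_on_trees (Gal Kinf K) galois_action (preimage_tree basilica x)
     M_group_infinity (\<lambda>\<tau> w. \<tau> w) word_tree"
proof -
  have C: "carrier (Gal Kinf K) = Bij Kinf \<inter> Emb K Kinf" by (rule carrier_Gal)
  have "gword \<in> hom (Gal Kinf K) M_group_infinity"
  proof (rule homI)
    fix \<sigma> assume "\<sigma> \<in> carrier (Gal Kinf K)"
    then show "gword \<sigma> \<in> carrier M_group_infinity" by (simp add: C gword_M_infinity)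
  next
    fix \<sigma> \<tau> assume st: "\<sigma> \<in> carrier (Gal Kinf K)" "\<tau> \<in> carrier (Gal Kinf K)"
    then have E: "\<sigma> \<in> Emb K Kinf" "\<tau> \<in> Emb K Kinf" and B: "\<sigma> \<in> Bij Kinf" "\<tau> \<in> Bij Kinf"
      by (simp_all add: C)
    have mult: "\<sigma> \<otimes>\<^bsub>Gal Kinf K\<^esub> \<tau> = compose Kinf \<sigma> \<tau>"
      using B by (simp add: Gal_def BijGroup_def)
    have im: "\<tau> z \<in> Kinf" if "z \<in> Kinf" for z using B(2) that by (auto simp: Bij_def bij_betw_def)
    note D = EmbD[OF E(1) K sfield_Kinf] and D' = EmbD[OF E(2) K sfield_Kinf]
    have comp: "compose Kinf \<sigma> \<tau> \<in> Emb K Kinf"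
      unfolding Emb_def using K_Kinf
      by (auto simp: compose_def D D' im sfieldD(3,5)[OF sfield_Kinf] subset_iff)
    have "gword (compose Kinf \<sigma> \<tau>) = compose UNIV (gword \<sigma>) (gword \<tau>)"
    proof
      fix w
      have "lab w \<in> Kinf" using lab_Kn[of w "length w"] Kn_Kinf by blast
      then show "gword (compose Kinf \<sigma> \<tau>) w = compose UNIV (gword \<sigma>) (gword \<tau>) w"
        using gword_Kinf[OF comp, of w] gword_Kinf[OF E(1), of "gword \<tau> w"] gword_Kinf[OF E(2), of w]
        by (intro lab_inj) (simp_all add: compose_def)
    qed
    also have "\<dots> = gword \<sigma> \<otimes>\<^bsub>M_group_infinity\<^esub> gword \<tau>"
      using tree_aut_Bij[OF gword_M_infinity[OF E(1)]] tree_aut_Bij[OF gword_M_infinity[OF E(2)]]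
      by (simp add: M_group_infinity_def BijGroup_def)
    finally show "gword (\<sigma> \<otimes>\<^bsub>Gal Kinf K\<^esub> \<tau>) = gword \<sigma> \<otimes>\<^bsub>M_group_infinity\<^esub> gword \<tau>"
      by (simp only: mult)
  qed
  moreover have "bij_betw gword (carrier (Gal Kinf K)) (carrier M_group_infinity)"
  proof (rule bij_betw_imageI)
    show "inj_on gword (carrier (Gal Kinf K))" unfolding C by (rule inj_on_subset[OF gword_Kinf_inj]) simp
    show "gword ` carrier (Gal Kinf K) = carrier M_group_infinity"
    proof (intro equalityI subsetI)
      fix \<sigma> assume "\<sigma> \<in> carrier M_group_infinity"
      from gword_Kinf_surj[OF full this] show "\<sigma> \<in> gword ` carrier (Gal Kinf K)" unfolding C by blast
    qed (auto simp: C gword_M_infinity)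
  qed
  ultimately have iso: "gword \<in> iso (Gal Kinf K) M_group_infinity" by (simp add: iso_def)
  have eqv: "word_of_node (galois_action g v) = gword g (word_of_node v)"
    if "g \<in> carrier (Gal Kinf K)" "v \<in> nodes (preimage_tree basilica x)" for g v
    using that by (auto simp: C galois_action_Kinf)
  show ?thesis
    unfolding iso_acting_on_trees_def
    by (intro bexI[OF _ iso] exI[of _ word_of_node] conjI ballI tree_iso_word_of_node eqv)
qed

text \<open>The given tree isomorphism need not be the labeling, but read through the labeling it is
  an automorphism \<open>\<beta>\<close> that preserves levels and conjugates \<open>gword g\<close>
  to \<open>\<phi> g\<close>. Galois elements whose images differ on \<open>T_n\<close> therefore
  restrict differently to \<open>Kn n\<close>. As all of \<open>Mt n\<close> comes from
  \<open>M_group_infinity\<close>, there are enough embeddings of \<open>Kn n\<close>.\<close>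

lemma iso_M_group_infinityD:
  assumes "iso_acting_on_trees (Gal Kinf K) galois_action (preimage_tree basilica x)
     M_group_infinity (\<lambda>\<tau> w. \<tau> w) word_tree"
  shows "full n"
proof -
  obtain \<phi> \<psi> where \<phi>: "bij_betw \<phi> (Bij Kinf \<inter> Emb K Kinf) (carrier M_group_infinity)"
    and \<psi>: "tree_iso (preimage_tree basilica x) word_tree \<psi>"
    and eqv: "\<And>g w. g \<in> Bij Kinf \<inter> Emb K Kinf \<Longrightarrow>
      \<psi> (galois_action g (node_of_word w)) = \<phi> g (\<psi> (node_of_word w))"
    using assms unfolding iso_acting_on_trees_def by (auto simp: iso_def carrier_Gal)
  define \<beta> where "\<beta> = \<psi> \<circ> node_of_word"
  have "\<beta> \<in> tree_aut word_tree"
  proof -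
    have "bij_betw node_of_word UNIV (range node_of_word)"
      by (simp add: bij_betw_def inj_node_of_word)
    moreover have "bij_betw \<psi> (range node_of_word) UNIV" using \<psi> by (simp add: tree_iso_def)
    ultimately have "bij \<beta>" unfolding \<beta>_def by (rule bij_betw_trans)
    then show ?thesis
      using \<psi> adjacent_node_of_word
      by (simp add: tree_aut_def tree_iso_def Bij_def \<beta>_def del: nodes_word_tree(5))
  qed
  then have tree_map: "tree_map m \<beta>" for m by (rule tree_aut_word_tree_tree_map)
  define t where "t = portrait n (flips \<beta>) []"
  have \<beta>: "\<beta> w = act t w" if "length w \<le> n" for w
    unfolding t_def by (rule tree_map_eq_act[OF tree_map that])
  have tp: "t \<in> perfect n" by (simp add: t_def)
  have eq: "\<beta> (gword g w) = \<phi> g (\<beta> w)" if "g \<in> Bij Kinf \<inter> Emb K Kinf" for g w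
    using eqv[OF that, of w] galois_action_Kinf[of g w] that by (simp add: \<beta>_def)
  have "\<forall>s\<in>Mt n. \<exists>g. g \<in> Bij Kinf \<inter> Emb K Kinf \<and> portrait n (flips (\<phi> g)) [] = s"
  proof
    fix s assume "s \<in> Mt n"
    then obtain \<sigma> where "\<sigma> \<in> carrier M_group_infinity" "portrait n (flips \<sigma>) [] = s"
      using M_group_infinity_restricts_onto by blast
    then show "\<exists>g. g \<in> Bij Kinf \<inter> Emb K Kinf \<and> portrait n (flips (\<phi> g)) [] = s"
      using bij_betw_imp_surj_on[OF \<phi>] by (metis imageE)
  qed
  then obtain G where G: "\<And>s. s \<in> Mt n \<Longrightarrow> G s \<in> Bij Kinf \<inter> Emb K Kinf"
    "\<And>s. s \<in> Mt n \<Longrightarrow> portrait n (flips (\<phi> (G s))) [] = s" by metis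
  have "inj_on (\<lambda>s. restrict (G s) (Kn n)) (Mt n)"
  proof (rule inj_onI)
    fix s s' assume s: "s \<in> Mt n" "s' \<in> Mt n" and r: "restrict (G s) (Kn n) = restrict (G s') (Kn n)"
    have "\<phi> (G s) w = \<phi> (G s') w" if w: "length w \<le> n" for w
    proof -
      define u where "u = act (tinv t) w"
      have u: "length u \<le> n" "\<beta> u = w" using w act_tinv(2)[OF tp] \<beta>[of u] by (simp_all add: u_def)
      have "gword (G s) u = gword (G s') u" using r gword_restrict[OF u(1)] by metis
      then show ?thesis using eq[OF G(1)[OF s(1)], of u] eq[OF G(1)[OF s(2)], of u] u(2) by simp
    qed
    then have "portrait n (flips (\<phi> (G s))) [] = portrait n (flips (\<phi> (G s'))) []" by (rule portrait_flips_cong)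
    then show "s = s'" using G(2) s by simp
  qed
  moreover have "(\<lambda>s. restrict (G s) (Kn n)) ` Mt n \<subseteq> Emb K (Kn n)"
    using G(1) Emb_Kinf_restrict by auto
  moreover have "finite (Emb K (Kn n))" using qtower_degree[OF two K qtower_K_Kn] by blast
  ultimately have "card (Mt n) \<le> card (Emb K (Kn n))" by (rule card_inj_on_le)
  moreover have "card (Emb K (Kn n)) \<le> card (Mt n)"
    using ptree_Mt by (intro card_inj_on_le[OF ptree_inj]) auto
  ultimately show ?thesis unfolding image_eq_iff by simp
qed

end

section \<open>The field of degree 16 and the theorem\<close>

locale arboreal_sqrts = arboreal K x \<zeta> lab
  for K :: "'a :: alg_closed_field set" and x \<zeta> lab +
  fixes r s :: 'a
  assumes r: "r ^ 2 = - x" and s: "s ^ 2 = 1 + x"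
begin

abbreviation E16 :: "'a set" where
  "E16 \<equiv> adjoin K {r, s, \<zeta> 3}"

lemma zeta_powers: "\<zeta> 3 * \<zeta> 3 = \<zeta> 2" "\<zeta> 2 * \<zeta> 2 = - 1"
  using zeta_compat[of 3] zeta_compat[of 2] zeta_1 by (simp_all add: power2_eq_square)

lemma rs_nonzero: "r \<noteq> 0" "s \<noteq> 0"
  using r s x0 by (auto simp: add_eq_0_iff)

lemma s_lab: "s = lab [LA] \<or> s = - lab [LA]"
  using s lab_sq[of "[]" LA] by (simp add: lab_Nil power2_eq_square flip: square_eq_iff)

text \<open>Since \<open>[b] = - [a]\<close>, the square of \<open>[aa] [ba]\<close> is
  \<open>(1 + [a]) (1 + [b]) = 1 - [a]^2 = - x\<close>.\<close>

lemma r_lab: "r = Pi_lab 1 [] \<or> r = - Pi_lab 1 []"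
proof -
  have "Pi_lab 1 [] * Pi_lab 1 [] =
      (lab ([LA] @ [LA]) * lab ([LA] @ [LA])) * (lab ([LB] @ [LA]) * lab ([LB] @ [LA]))"
    using Pi_lab_Suc[of 0 "[]"] by (simp add: Pi_lab_0 mult_ac)
  also have "\<dots> = (1 + lab ([] @ [LA])) * (1 + lab ([] @ [LB]))"
    unfolding lab_sq by simp
  also have "\<dots> = 1 - lab ([] @ [LA]) * lab ([] @ [LA])"
    unfolding lab_LB by (simp add: algebra_simps)
  also have "\<dots> = r * r"
    unfolding lab_sq using r by (simp add: lab_Nil power2_eq_square)
  finally show ?thesis by (metis square_eq_iff)
qed

lemma sfield_E16: "sfield E16"
  by (rule sfield_adjoin)

lemma E16_mem: "r \<in> E16" "s \<in> E16" "\<zeta> 3 \<in> E16" "K \<subseteq> E16" "\<zeta> 2 \<in> E16"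
proof -
  show "r \<in> E16" "s \<in> E16" "\<zeta> 3 \<in> E16" "K \<subseteq> E16"
    using adjoin_incl[where F = K and S = "{r, s, \<zeta> 3}"] by auto
  then show "\<zeta> 2 \<in> E16" using sfieldD(5)[OF sfield_E16, of "\<zeta> 3" "\<zeta> 3"] by (simp add: zeta_powers)
qed

text \<open>The bound comes from \<open>\<zeta> 3\<close>, whose products of labels use words of
  length 5; the two square roots already live on the first two levels.\<close>

lemma E16_subset: "n \<ge> 5 \<Longrightarrow> E16 \<subseteq> Kn n"
proof (intro adjoin_least sfield_Kn K_Kn)
  assume n: "n \<ge> 5"
  note S = sfieldD(4)[OF sfield_Kn, of _ n]
  have "Pi_lab 1 [] \<in> Kn n" "lab [LA] \<in> Kn n" "\<zeta> 3 \<in> Kn n"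
    using n Pi_lab_Kn[of "[]" 1 n] lab_Kn[of "[LA]" n] zeta_Kn[of 2 n] by (simp_all add: eval_nat_numeral)
  then show "{r, s, \<zeta> 3} \<subseteq> Kn n" using r_lab s_lab S by auto
qed

lemma qtower_E16: "qtower K E16"
proof -
  have S: "- 1 \<in> K" "- x \<in> K" "1 + x \<in> K"
    using sfieldD[OF K] xK by blast+
  let ?F = "adjoin K {r, s, \<zeta> 2}"
  have "qtower K ?F"
    using r s S zeta_powers by (intro qtower_finite K) (auto simp: power2_eq_square)
  moreover have "\<zeta> 3 * \<zeta> 3 \<in> ?F"
    using adjoin_incl(2)[of "{r, s, \<zeta> 2}" K] by (simp add: zeta_powers)
  ultimately have "qtower K (adjoin ?F {\<zeta> 3})" by (rule qtower.step)
  also have "adjoin ?F {\<zeta> 3} = adjoin K ({r, s, \<zeta> 2} \<union> {\<zeta> 3})" by (rule adjoin_adjoin)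
  also have "\<dots> = E16"
    using E16_mem adjoin_incl(2)[of "{r, s, \<zeta> 2} \<union> {\<zeta> 3}" K]
      adjoin_incl(1)[of K "{r, s, \<zeta> 2} \<union> {\<zeta> 3}"]
    by (intro adjoin_eqI sfield_E16 adjoin_least sfield_adjoin) auto
  finally show ?thesis .
qed

lemma has_degree_E16: "has_degree E16 K d \<longleftrightarrow> card (Emb K E16) = d"
  using qtower_degree[OF two K qtower_E16] has_degree_unique[OF K] by blast

text \<open>The value at \<open>(\<rho>, q, p)\<close> is the image of \<open>(r, s, \<zeta> 3)\<close> under an automorphism
  with invariants \<open>R \<equiv> \<rho>\<close>, \<open>Q \<equiv> q\<close> modulo 2 and \<open>P \<equiv> p\<close> modulo 8.\<close>
definition conj_triple :: "int \<Rightarrow> int \<Rightarrow> int \<Rightarrow> 'a \<times> 'a \<times> 'a" where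
  "conj_triple \<rho> q p = (\<zeta> 1 powi \<rho> * r, \<zeta> 1 powi q * s, \<zeta> 3 powi p)"

lemma conj_triple_eq:
  "conj_triple \<rho> q p = conj_triple \<rho>' q' p' \<longleftrightarrow>
     [\<rho> = \<rho>'] (mod 2) \<and> [q = q'] (mod 2) \<and> [p = p'] (mod 8)"
  using rs_nonzero zeta_powi_eq[of 1 \<rho> \<rho>'] zeta_powi_eq[of 1 q q'] zeta_powi_eq[of 3 p p']
  by (simp add: conj_triple_def)

definition conj_triples :: "('a \<times> 'a \<times> 'a) set" where
  "conj_triples = (\<lambda>(\<rho>, q, p). conj_triple \<rho> q p) ` ({0, 1} \<times> {0, 1} \<times> {1, 3, 5, 7})"

lemma conj_triple_in: "odd p \<Longrightarrow> conj_triple \<rho> q p \<in> conj_triples"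
proof -
  assume "odd p"
  then have "odd (p mod 8)" by (simp add: even_even_mod_4_iff dvd_mod_iff)
  moreover have "p mod 8 \<in> {0..<8}" by simp
  moreover have "{0..<8 :: int} = {0, 1, 2, 3, 4, 5, 6, 7}" by auto
  ultimately have "p mod 8 \<in> {1, 3, 5, 7}" by auto
  moreover have "\<rho> mod 2 \<in> {0, 1}" "q mod 2 \<in> {0, 1}" by auto
  moreover have "conj_triple \<rho> q p = conj_triple (\<rho> mod 2) (q mod 2) (p mod 8)"
    unfolding conj_triple_eq by simp
  ultimately show ?thesis unfolding conj_triples_def by force
qed

lemma conj_triplesE:
  assumes "z \<in> conj_triples"
  obtains \<rho> q p where "odd p" "z = conj_triple \<rho> q p"
proof -
  obtain y where y: "y \<in> {0, 1} \<times> {0, 1} \<times> {1, 3, 5, 7}" "z = (\<lambda>(\<rho>, q, p). conj_triple \<rho> q p) y"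
    using assms unfolding conj_triples_def by (elim imageE)
  obtain \<rho> q p where eq: "y = (\<rho>, q, p)" by (rule prod_cases3)
  have "odd p" using y(1) unfolding eq by auto
  then show thesis using that[of p \<rho> q] y(2) by (simp add: eq)
qed

lemma card_conj_triples: "card conj_triples = 16" "finite conj_triples"
proof -
  have "inj_on (\<lambda>(\<rho>, q, p). conj_triple \<rho> q p) ({0, 1} \<times> {0, 1} \<times> {1, 3, 5, 7})"
    by (rule inj_onI) (auto simp: conj_triple_eq cong_def)
  then show "card conj_triples = 16" unfolding conj_triples_def by (simp add: card_image card_cartesian_product)
  show "finite conj_triples" by (simp add: conj_triples_def)
qed

definition triple :: "('a \<Rightarrow> 'a) \<Rightarrow> 'a \<times> 'a \<times> 'a" where
  "triple \<phi> = (\<phi> r, \<phi> s, \<phi> (\<zeta> 3))"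

lemma inj_triple: "inj_on triple (Emb K E16)"
proof (rule inj_onI)
  fix \<phi> \<psi> assume *: "\<phi> \<in> Emb K E16" "\<psi> \<in> Emb K E16" "triple \<phi> = triple \<psi>"
  then show "\<phi> = \<psi>"
    using EmbD(3)[OF *(1) K sfield_E16] EmbD(3)[OF *(2) K sfield_E16]
    by (intro Emb_eqI[OF *(1,2) K]) (auto simp: triple_def)
qed

text \<open>The images of \<open>r\<close>, \<open>s\<close> and \<open>\<zeta> 2\<close> are fixed
  up to sign because their squares lie in \<open>K\<close>. For \<open>\<zeta> 3\<close> this takes
  a second step over the image of \<open>\<zeta> 2\<close>; rewriting each sign as a power of a root
  of unity leaves an odd exponent.\<close>

lemma triple_in: "\<phi> \<in> Emb K E16 \<Longrightarrow> triple \<phi> \<in> conj_triples"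
proof -
  assume \<phi>: "\<phi> \<in> Emb K E16"
  note D = EmbD[OF \<phi> K sfield_E16]
  have sign: "\<exists>q. z = \<zeta> 1 powi q * y" if "z * z = y * y" for z y
    using that zeta_1 by (auto simp: square_eq_iff intro: exI[of _ 0] exI[of _ 1])
  have rK: "r * r \<in> K" "s * s \<in> K" "- 1 \<in> K"
    using r s xK sfieldD[OF K] by (auto simp: power2_eq_square)
  have "\<phi> r * \<phi> r = r * r" using D(2)[OF E16_mem(1) E16_mem(1)] D(3)[OF rK(1)] by simp
  then obtain \<rho> where \<rho>: "\<phi> r = \<zeta> 1 powi \<rho> * r" using sign by blast
  have "\<phi> s * \<phi> s = s * s" using D(2)[OF E16_mem(2) E16_mem(2)] D(3)[OF rK(2)] by simp
  then obtain q where q: "\<phi> s = \<zeta> 1 powi q * s" using sign by blast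
  have "\<phi> (\<zeta> 2) * \<phi> (\<zeta> 2) = \<zeta> 2 * \<zeta> 2"
    using D(2)[OF E16_mem(5) E16_mem(5)] D(3)[OF rK(3)] by (simp add: zeta_powers)
  then obtain a where "\<phi> (\<zeta> 2) = \<zeta> 1 powi a * \<zeta> 2" using sign by blast
  also have "\<dots> = \<zeta> 2 powi (2 * a + 1)"
    using zeta_double[of 1 a] zeta_nonzero[of 2] by (simp add: power_int_add numeral_2_eq_2)
  also have "\<dots> = \<zeta> 3 powi (2 * a + 1) * \<zeta> 3 powi (2 * a + 1)"
    using zeta_double[of 2 "2 * a + 1"] zeta_nonzero[of 3]
    by (simp add: numeral_3_eq_3 numeral_2_eq_2 algebra_simps flip: power_int_add)
  finally have "\<phi> (\<zeta> 3) * \<phi> (\<zeta> 3) = \<zeta> 3 powi (2 * a + 1) * \<zeta> 3 powi (2 * a + 1)"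
    using D(2)[OF E16_mem(3) E16_mem(3)] by (simp add: zeta_powers)
  then obtain b where "\<phi> (\<zeta> 3) = \<zeta> 1 powi b * \<zeta> 3 powi (2 * a + 1)" using sign by blast
  also have "\<zeta> 1 powi b = \<zeta> 3 powi (2 * (2 * b))"
    using zeta_double[of 2 "2 * b"] zeta_double[of 1 b] by (simp add: numeral_3_eq_3 numeral_2_eq_2)
  finally have "\<phi> (\<zeta> 3) = \<zeta> 3 powi (2 * (2 * b) + (2 * a + 1))"
    using zeta_nonzero[of 3] by (simp add: power_int_add)
  then have "triple \<phi> = conj_triple \<rho> q (2 * (2 * b) + (2 * a + 1))"
    using \<rho> q by (simp add: triple_def conj_triple_def)
  then show ?thesis using conj_triple_in by simp
qed

text \<open>An embedding is determined by its triple and only 16 triples are possible, so degree 16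
  says that all of them occur.\<close>

lemma has_degree_E16_iff: "has_degree E16 K 16 \<longleftrightarrow> triple ` Emb K E16 = conj_triples"
proof -
  have sub: "triple ` Emb K E16 \<subseteq> conj_triples" using triple_in by blast
  have card: "card (triple ` Emb K E16) = card (Emb K E16)" by (rule card_image[OF inj_triple])
  show ?thesis
    unfolding has_degree_E16
    using card_subset_eq[OF card_conj_triples(2) sub] card card_conj_triples(1) by metis
qed

text \<open>Here the invariants meet the field: up to sign \<open>r\<close> and \<open>s\<close> are
  \<open>Pi_lab 1 []\<close> and \<open>lab [LA]\<close>, so \<open>emb_Pi_lab\<close> yields
  \<open>R\<close>, the flip at the root yields \<open>Q\<close> modulo 2, and
  \<open>emb_zeta\<close> yields \<open>P\<close>.\<close>

lemma emb_triple:
  assumes n: "n \<ge> 5" and \<sigma>: "\<sigma> \<in> Emb K (Kn n)"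
  shows "triple \<sigma> = conj_triple (Rt (ptree n \<sigma>)) (Qt (ptree n \<sigma>)) (Pt (ptree n \<sigma>))"
proof -
  let ?t = "ptree n \<sigma>" and ?\<pi> = "flips (gword \<sigma>)"
  note D = EmbD[OF \<sigma> K sfield_Kn]
  \<comment> \<open>Exponents of -1 matter only modulo 2, which absorbs the minus sign of
    \<open>emb_Pi_lab\<close>.\<close>
  have z1: "\<zeta> 1 powi (- p) = \<zeta> 1 powi p" for p
    unfolding zeta_powi_eq by (simp add: cong_iff_dvd_diff)
  have Kn: "Pi_lab 1 [] \<in> Kn n" "lab [LA] \<in> Kn n"
    using n Pi_lab_Kn[of "[]" 1 n] lab_Kn[of "[LA]" n] by simp_all
  have gword0: "gword \<sigma> [] = []" using tree_map_gword[OF \<sigma>] by (simp add: tree_map_def)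
  have "\<sigma> (Pi_lab 1 []) = Pi_lab 1 [] * \<zeta> 1 powi (- Rt ?t)"
    using emb_Pi_lab[OF \<sigma>, of "[]" n 1] n by (simp add: gword0 ptree_def)
  then have "\<sigma> (Pi_lab 1 []) = \<zeta> 1 powi (Rt ?t) * Pi_lab 1 []"
    by (simp only: z1 mult.commute[of "Pi_lab 1 []"])
  then have R: "\<sigma> r = \<zeta> 1 powi (Rt ?t) * r" using r_lab D(4)[OF Kn(1)] by auto
  obtain n' where n': "n = Suc n'" using n by (cases n) auto
  have "\<sigma> (lab [LA]) = lab (gword \<sigma> [LA])" using gword[OF \<sigma>, of "[LA]"] n by simp
  also have "gword \<sigma> [LA] = [flip_letter (?\<pi> []) LA]"
    using gword_snoc[OF \<sigma>, of "[]" LA] n by (simp add: gword0)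
  also have "lab [flip_letter (?\<pi> []) LA] = \<zeta> 1 powi (of_bool (?\<pi> [])) * lab [LA]"
    using lab_LB[of "[]"] zeta_1 by (cases "?\<pi> []") simp_all
  also have "\<zeta> 1 powi (of_bool (?\<pi> [])) = \<zeta> 1 powi (Qt ?t)"
    unfolding zeta_powi_eq by (simp add: ptree_def n' cong_iff_dvd_diff)
  finally have Q: "\<sigma> s = \<zeta> 1 powi (Qt ?t) * s" using s_lab D(4)[OF Kn(2)] by auto
  have "\<sigma> (\<zeta> 3) = \<zeta> 3 powi Pt ?t"
    using emb_zeta[OF \<sigma>, of "[]" n 2] n by (simp add: ptree_def numeral_3_eq_3 numeral_2_eq_2)
  then show ?thesis using R Q by (simp add: triple_def conj_triple_def)
qed

text \<open>Every triple comes from an embedding of \<open>E16\<close>, which extends to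
  \<open>Kn n\<close> because \<open>Kn n\<close> is a tower of square roots over
  \<open>E16\<close>. The extension has the residues that \<open>Mt_eq_of_residues\<close> asks
  for.\<close>

lemma full_if_degree_16:
  assumes "has_degree E16 K 16" and n: "n \<ge> 5"
  shows "full n"
proof (rule Mt_eq_of_residues[OF n subgroup_image])
  fix p q \<rho> :: int assume p: "odd p"
  have "conj_triple \<rho> q p \<in> triple ` Emb K E16"
    using assms(1) conj_triple_in[OF p] by (simp add: has_degree_E16_iff)
  then obtain \<phi> where \<phi>: "\<phi> \<in> Emb K E16" "triple \<phi> = conj_triple \<rho> q p" by (metis imageE)
  have "qtower E16 (adjoin E16 (Kn n))"
    by (rule qtower_compositum[OF sfield_E16 E16_mem(4) qtower_K_Kn])
  also have "adjoin E16 (Kn n) = Kn n"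
    using adjoin_incl(2)[of "Kn n" E16] by (intro adjoin_eqI sfield_Kn E16_subset n) auto
  finally obtain \<sigma> where \<sigma>: "\<sigma> \<in> Emb K (Kn n)" "\<forall>z\<in>E16. \<sigma> z = \<phi> z"
    using qtower_extend[OF K sfield_E16 E16_mem(4) \<phi>(1)] by blast
  then have "triple \<sigma> = triple \<phi>" using E16_mem by (simp add: triple_def)
  then have "conj_triple (Rt (ptree n \<sigma>)) (Qt (ptree n \<sigma>)) (Pt (ptree n \<sigma>)) = conj_triple \<rho> q p"
    using emb_triple[OF n \<sigma>(1)] \<phi>(2) by simp
  then show "\<exists>t\<in>ptree n ` Emb K (Kn n). [Pt t = p] (mod 8) \<and> [Qt t = q] (mod 2) \<and> [Rt t = \<rho>] (mod 2)"
    using \<sigma>(1) unfolding conj_triple_eq by blast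
qed

text \<open>Fibres are nonempty, so fullness supplies an embedding with any prescribed residues; its
  restriction to \<open>E16\<close> realises the triple.\<close>

lemma degree_16_if_full:
  assumes "full 5"
  shows "has_degree E16 K 16"
  unfolding has_degree_E16_iff
proof (intro equalityI subsetI)
  fix z assume "z \<in> conj_triples"
  then obtain \<rho> q p where z: "odd p" "z = conj_triple \<rho> q p" by (rule conj_triplesE)
  obtain t where t: "t \<in> fibre 5 p q \<rho>" using fibre_nonempty[OF z(1)] by blast
  then have "t \<in> ptree 5 ` Emb K (Kn 5)" using assms by (simp add: fibre_def)
  then obtain \<sigma> where \<sigma>: "\<sigma> \<in> Emb K (Kn 5)" "t = ptree 5 \<sigma>" by blast
  have c: "[Pt t = p] (mod 8)" "[Qt t = q] (mod 2 ^ 3)" "[Rt t = \<rho>] (mod 2 ^ 2)"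
    using t by (simp_all add: fibre_def)
  have "triple \<sigma> = z"
    unfolding emb_triple[OF order_refl \<sigma>(1)] z(2) conj_triple_eq \<sigma>(2)[symmetric]
    using c(1) cong_pow_le[OF c(2), of 1] cong_pow_le[OF c(3), of 1] by simp
  moreover have "triple (restrict \<sigma> E16) = triple \<sigma>" using E16_mem by (simp add: triple_def)
  moreover have "restrict \<sigma> E16 \<in> Emb K E16"
    by (rule Emb_restrict[OF \<sigma>(1) E16_subset sfield_E16 E16_mem(4)]) simp
  ultimately show "z \<in> triple ` Emb K E16" by (metis imageI)
qed (auto simp: triple_in)

end

theorem theorem5p5:
  fixes x0 :: "'k :: field"
    and \<zeta> :: "nat \<Rightarrow> 'k alg_closure"
    and lab :: "word \<Rightarrow> 'k alg_closure"
    and r s :: "'k alg_closure"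
  assumes char: "CHAR('k) \<noteq> 2"
    and x0: "x0 \<noteq> 0" "x0 \<noteq> -1"
    and zeta_prim: "\<And>m. primitive_root_of_unity (2 ^ m) (\<zeta> m)"
    and zeta_compat: "\<And>m. m \<ge> 1 \<Longrightarrow> \<zeta> m ^ 2 = \<zeta> (m - 1)"
    and labeling: "tree_labeling basilica (to_ac x0) lab"
    and lab_zeta: "\<And>y i. label_prod lab y LA i * inverse (label_prod lab y LB i) = \<zeta> (i + 1)"
    and sqrts: "r ^ 2 = to_ac (- x0)" "s ^ 2 = to_ac (1 + x0)"
  shows "let K = range (to_ac :: 'k \<Rightarrow> 'k alg_closure);
             x = to_ac x0;
             Kn = arboreal_field K basilica x;
             Kinf = arboreal_field_infinity K basilica x;
             iso_G_M = (\<lambda>n. iso_acting_on_trees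
               (Gal (Kn n) K) galois_action (preimage_tree_upto basilica x n)
               (M_group n) (\<lambda>\<tau> w. \<tau> w) (word_tree_upto n));
             c1 = has_degree (adjoin K {r, s, \<zeta> 3}) K 16;
             c2 = has_degree (Kn 5) K (2 ^ 25);
             c3 = iso_G_M 5;
             c4 = (\<forall>n\<ge>1. iso_G_M n);
             c5 = iso_acting_on_trees
               (Gal Kinf K) galois_action (preimage_tree basilica x)
               M_group_infinity (\<lambda>\<tau> w. \<tau> w) word_tree
         in (c1 \<longleftrightarrow> c2) \<and> (c2 \<longleftrightarrow> c3) \<and> (c3 \<longleftrightarrow> c4) \<and> (c4 \<longleftrightarrow> c5)"
proof -
  let ?K = "range (to_ac :: 'k \<Rightarrow> 'k alg_closure)"
  interpret arboreal_sqrts ?K "to_ac x0" \<zeta> lab r s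
  proof (intro arboreal_sqrts.intro arboreal.intro arboreal_sqrts_axioms.intro)
    show "sfield ?K"
      by (rule sfieldI)
        (auto simp flip: to_ac_1 to_ac_add to_ac_minus to_ac_mult to_ac_inverse)
    have "(2 :: 'k alg_closure) \<noteq> 0"
    proof
      assume "(2 :: 'k alg_closure) = 0"
      then have dvd: "CHAR('k) dvd 2" using of_nat_eq_0_iff_char_dvd[of 2, where ?'a = "'k alg_closure"] by simp
      then have "CHAR('k) \<le> 2" by (rule dvd_imp_le) simp
      moreover have "CHAR('k) \<noteq> 0" using dvd by (intro notI) simp
      ultimately show False using char CHAR_not_1[where ?'a = 'k] by linarith
    qed
    then show "(2 :: 'k alg_closure) \<noteq> 0" .
    show "to_ac x0 \<noteq> 0" "to_ac x0 \<noteq> - 1" using x0 by (simp_all flip: to_ac_1 to_ac_minus)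
  qed (use zeta_prim zeta_compat labeling lab_zeta sqrts in auto)
  have c1: "has_degree E16 ?K 16 \<longleftrightarrow> full 5"
    using full_if_degree_16[of 5] degree_16_if_full by blast
  have all: "full 5 \<longleftrightarrow> (\<forall>n\<ge>1. full n)"
  proof
    assume "full 5"
    \<comment> \<open>The detour through degree 16 carries fullness from height 5 to all greater
      heights; smaller heights follow by truncation.\<close>
    then have ge: "full n" if "n \<ge> 5" for n
      using full_if_degree_16[OF degree_16_if_full that] by blast
    have "full n" for n
      by (rule full_mono[OF ge[of "max n 5"]]) simp_all
    then show "\<forall>n\<ge>1. full n" by blast
  qed simp
  have inf: "(\<forall>n\<ge>1. full n) \<longleftrightarrow> iso_acting_on_trees
      (Gal Kinf ?K) galois_action (preimage_tree basilica (to_ac x0))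
      M_group_infinity (\<lambda>\<tau> w. \<tau> w) word_tree"
  proof
    assume "\<forall>n\<ge>1. full n"
    then have "full n" for n by (intro full_mono[of "Suc n" n]) simp_all
    then show "iso_acting_on_trees
      (Gal Kinf ?K) galois_action (preimage_tree basilica (to_ac x0))
      M_group_infinity (\<lambda>\<tau> w. \<tau> w) word_tree" by (rule iso_M_group_infinityI)
  qed (use iso_M_group_infinityD in blast)
  show ?thesis
    unfolding Let_def iso_M_group_iff has_degree_K5_iff c1 using all inf by blast
qed

end
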